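(* Let $G_1,G_2,H_1,H_2$ be finite groups such that for each $k=1,2$ the pair $(G_k,H_k)$ is a compatible pair (in the sense defined in the context). Then the following hold: (i) $G_1\times G_2\sim_{\mathbb C}H_1\times H_2$. (ii) For every finite abelian group $A$, $G_1\times A\sim_{\mathbb C}H_1\times A$.
   Context: For a finite group $G$, $Z^2(G,\mathbb C^\times)$ is the group of $2$-cocycles with trivial $G$-action on $\mathbb C^\times$, and $H^2(G,\mathbb C^\times)$ is the second cohomology group. For $\alpha\in Z^2(G,\mathbb C^\times)$, the twisted group algebra $\mathbb C^\alpha G$ is the $\mathbb C$-vector space with basis $\{\bar g: g\in G\}$ and multiplication determined by $\bar g\,\bar h=\alpha(g,h)\overline{gh}$; up to isomorphism it depends only on the class $[\alpha]$. For finite groups $G,H$ we write $G\sim_{\mathbb C}H$ if there is a group isomorphism $\psi:H^2(G,\mathbb C^\times)\to H^2(H,\mathbb C^\times)$ such that $\mathbb C^\alpha G\cong\mathbb C^{\psi(\alpha)}H$ (as $\mathbb C$-algebras) for every $[\alpha]\in H^2(G,\mathbb C^\times)$, where $\psi(\alpha)$ denotes a cocycle representing $\psi([\alpha])$. Inflation: for $Z\trianglelefteq G$, $\inf:H^2(G/Z,\mathbb C^\times)\to H^2(G,\mathbb C^\times)$ sends $[\alpha]$ to $[\alpha']$ with $\alpha'(x,y)=\alpha(xZ,yZ)$. Transgression: for a central extension $1\to Z\to G\to G/Z\to 1$ with a section $\mu: G/Z\to G$, $\mathrm{tra}:\mathrm{Hom}(Z,\mathbb C^\times)\to H^2(G/Z,\mathbb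 C^\times)$ sends $\chi$ to the class of $(x,y)\mapsto\chi(\mu(x)\mu(y)\mu(xy)^{-1})$. Compatible pair: a pair $(G,H)$ of finite groups is called compatible here if there are central subgroups $Z\le G$ and $\bar Z\le H$ such that both sequences $$1\to\mathrm{Hom}(Z,\mathbb C^\times)\xrightarrow{\mathrm{tra}_1}H^2(G/Z,\mathbb C^\times)\xrightarrow{\inf_1}H^2(G,\mathbb C^\times)\to1,$$ $$1\to\mathrm{Hom}(\bar Z,\mathbb C^\times)\xrightarrow{\mathrm{tra}_2}H^2(H/\bar Z,\mathbb C^\times)\xrightarrow{\inf_2}H^2(H,\mathbb C^\times)\to1$$ (transgression and inflation for $1\to Z\to G\to G/Z\to 1$ and $1\to \bar Z\to H\to H/\bar Z\to 1$ respectively) are exact, and there are group isomorphisms $i:\bar Z\to Z$ and $\phi:H/\bar Z\to G/Z$ with $\bar\phi\circ\mathrm{tra}_1=\mathrm{tra}_2\circ\bar i$, where $\bar i(\chi)=\chi\circ i$ and $\bar\phi([\alpha])=[\beta]$ with $\beta(g,h)=\alpha(\phi(g),\phi(h))$ for $g,h\in H/\bar Z$. *)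

theory Defs
  imports "HOL-Algebra.Algebra"
begin

subsection \<open>Second cohomology with trivial action\<close>

definition cstar :: "complex monoid" where
  "cstar = \<lparr>carrier = UNIV - {0}, monoid.mult = (*), one = 1\<rparr>"

text \<open>Cochains are extensional functions on pairs of group elements, so that equality of cochains
  is equality of functions.  Cocycles are not assumed to be normalized.\<close>

definition Z2 :: "('a, 'm) monoid_scheme \<Rightarrow> ('a \<times> 'a \<Rightarrow> complex) monoid" where
  "Z2 G = \<lparr>carrier = {\<alpha> \<in> carrier G \<times> carrier G \<rightarrow>\<^sub>E carrier cstar.
              \<forall>g\<in>carrier G. \<forall>h\<in>carrier G. \<forall>k\<in>carrier G.
                \<alpha> (g, h) * \<alpha> (g \<otimes>\<^bsub>G\<^esub> h, k) = \<alpha> (g, h \<otimes>\<^bsub>G\<^esub> k) * \<alpha> (h, k)},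
           monoid.mult = (\<lambda>\<alpha> \<beta>. \<lambda>p\<in>carrier G \<times> carrier G. \<alpha> p * \<beta> p),
           one = (\<lambda>p\<in>carrier G \<times> carrier G. 1)\<rparr>"

definition coboundary :: "('a, 'm) monoid_scheme \<Rightarrow> ('a \<Rightarrow> complex) \<Rightarrow> 'a \<times> 'a \<Rightarrow> complex" where
  "coboundary G f = (\<lambda>(g, h)\<in>carrier G \<times> carrier G. f g * f h / f (g \<otimes>\<^bsub>G\<^esub> h))"

definition B2 :: "('a, 'm) monoid_scheme \<Rightarrow> ('a \<times> 'a \<Rightarrow> complex) set" where
  "B2 G = coboundary G ` (carrier G \<rightarrow> carrier cstar)"

definition H2 :: "('a, 'm) monoid_scheme \<Rightarrow> ('a \<times> 'a \<Rightarrow> complex) set monoid" where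
  "H2 G = Z2 G Mod B2 G"

definition H2_class :: "('a, 'm) monoid_scheme \<Rightarrow> ('a \<times> 'a \<Rightarrow> complex) \<Rightarrow> ('a \<times> 'a \<Rightarrow> complex) set" where
  "H2_class G \<alpha> = B2 G #>\<^bsub>Z2 G\<^esub> \<alpha>"


subsection \<open>Twisted group algebras\<close>

text \<open>An element is given by its coefficient function with respect to the basis indexed by the
  elements of the group.  The unit is \<open>\<alpha>(1,1)\<^sup>-\<^sup>1\<close> times the basis
  element of the neutral element, since \<open>\<alpha>\<close> need not be normalized.\<close>

definition twisted_group_algebra ::
  "('a, 'm) monoid_scheme \<Rightarrow> ('a \<times> 'a \<Rightarrow> complex) \<Rightarrow> (complex, 'a \<Rightarrow> complex) module" where
  "twisted_group_algebra G \<alpha> =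
    \<lparr>carrier = carrier G \<rightarrow>\<^sub>E UNIV,
     monoid.mult = (\<lambda>u v. \<lambda>x\<in>carrier G.
        \<Sum>(g, h)\<in>{(g, h) \<in> carrier G \<times> carrier G. g \<otimes>\<^bsub>G\<^esub> h = x}. u g * v h * \<alpha> (g, h)),
     one = (\<lambda>x\<in>carrier G. if x = \<one>\<^bsub>G\<^esub> then inverse (\<alpha> (\<one>\<^bsub>G\<^esub>, \<one>\<^bsub>G\<^esub>)) else 0),
     ring.zero = (\<lambda>x\<in>carrier G. 0),
     ring.add = (\<lambda>u v. \<lambda>x\<in>carrier G. u x + v x),
     module.smult = (\<lambda>c u. \<lambda>x\<in>carrier G. c * u x)\<rparr>"

definition algebra_iso ::
  "('c, 'a, 'm) module_scheme \<Rightarrow> ('c, 'b, 'n) module_scheme \<Rightarrow> ('a \<Rightarrow> 'b) set" where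
  "algebra_iso A B =
    {f \<in> ring_iso A B. \<forall>c. \<forall>u\<in>carrier A. f (c \<odot>\<^bsub>A\<^esub> u) = c \<odot>\<^bsub>B\<^esub> f u}"

text \<open>The algebra only depends on the class up to isomorphism, so quantifying over all
  representatives is the same as picking one of each class.\<close>

definition twisted_equiv :: "('a, 'm) monoid_scheme \<Rightarrow> ('b, 'n) monoid_scheme \<Rightarrow> bool"
    (infix \<open>\<sim>\<^sub>\<complex>\<close> 50) where
  "G \<sim>\<^sub>\<complex> H \<longleftrightarrow>
    (\<exists>\<psi>\<in>iso (H2 G) (H2 H). \<forall>c\<in>carrier (H2 G). \<forall>\<alpha>\<in>c. \<forall>\<beta>\<in>\<psi> c.
       algebra_iso (twisted_group_algebra G \<alpha>) (twisted_group_algebra H \<beta>) \<noteq> {})"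


subsection \<open>Inflation and transgression\<close>

definition pullback_cochain ::
  "('a, 'm) monoid_scheme \<Rightarrow> ('a \<Rightarrow> 'b) \<Rightarrow> ('b \<times> 'b \<Rightarrow> complex) \<Rightarrow> 'a \<times> 'a \<Rightarrow> complex" where
  "pullback_cochain K f \<alpha> = (\<lambda>(x, y)\<in>carrier K \<times> carrier K. \<alpha> (f x, f y))"

text \<open>All representatives of a class have pullbacks in the same class (lemma
  \<open>H2_pullback_class\<close> below).\<close>

definition H2_pullback ::
  "('a, 'm) monoid_scheme \<Rightarrow> ('a \<Rightarrow> 'b) \<Rightarrow> ('b \<times> 'b \<Rightarrow> complex) set \<Rightarrow> ('a \<times> 'a \<Rightarrow> complex) set" where
  "H2_pullback K f c = the_elem ((\<lambda>\<alpha>. H2_class K (pullback_cochain K f \<alpha>)) ` c)"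

definition inflation ::
  "('a, 'm) monoid_scheme \<Rightarrow> 'a set \<Rightarrow> ('a set \<times> 'a set \<Rightarrow> complex) set \<Rightarrow> ('a \<times> 'a \<Rightarrow> complex) set" where
  "inflation G Z = H2_pullback G (\<lambda>x. Z #>\<^bsub>G\<^esub> x)"

definition central_subgroup :: "'a set \<Rightarrow> ('a, 'm) monoid_scheme \<Rightarrow> bool" where
  "central_subgroup Z G \<longleftrightarrow>
    subgroup Z G \<and> (\<forall>z\<in>Z. \<forall>g\<in>carrier G. z \<otimes>\<^bsub>G\<^esub> g = g \<otimes>\<^bsub>G\<^esub> z)"

definition char_group :: "('a, 'm) monoid_scheme \<Rightarrow> ('a \<Rightarrow> complex) monoid" where
  "char_group Z = \<lparr>carrier = hom Z cstar \<inter> extensional (carrier Z),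
                   monoid.mult = (\<lambda>\<chi> \<theta>. \<lambda>z\<in>carrier Z. \<chi> z * \<theta> z),
                   one = (\<lambda>z\<in>carrier Z. 1)\<rparr>"

definition is_section :: "('a, 'm) monoid_scheme \<Rightarrow> 'a set \<Rightarrow> ('a set \<Rightarrow> 'a) \<Rightarrow> bool" where
  "is_section G Z \<mu> \<longleftrightarrow> (\<forall>U\<in>carrier (G Mod Z). \<mu> U \<in> U)"

definition transgression_cocycle ::
  "('a, 'm) monoid_scheme \<Rightarrow> 'a set \<Rightarrow> ('a set \<Rightarrow> 'a) \<Rightarrow> ('a \<Rightarrow> complex) \<Rightarrow> 'a set \<times> 'a set \<Rightarrow> complex" where
  "transgression_cocycle G Z \<mu> \<chi> =
    (\<lambda>(U, V)\<in>carrier (G Mod Z) \<times> carrier (G Mod Z).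
       \<chi> (\<mu> U \<otimes>\<^bsub>G\<^esub> \<mu> V \<otimes>\<^bsub>G\<^esub> inv\<^bsub>G\<^esub> (\<mu> (U \<otimes>\<^bsub>G Mod Z\<^esub> V))))"

text \<open>The class does not depend on the section (lemma \<open>transgression_indep\<close> below), so one
  is fixed by choice.\<close>

definition transgression ::
  "('a, 'm) monoid_scheme \<Rightarrow> 'a set \<Rightarrow> ('a \<Rightarrow> complex) \<Rightarrow> ('a set \<times> 'a set \<Rightarrow> complex) set" where
  "transgression G Z \<chi> =
    H2_class (G Mod Z) (transgression_cocycle G Z (SOME \<mu>. is_section G Z \<mu>) \<chi>)"


subsection \<open>Compatible pairs\<close>

text \<open>Exactness of \<open>1 \<rightarrow> A \<rightarrow> B \<rightarrow> C \<rightarrow> 1\<close>.  The library's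
  \<open>short_exact_sequence\<close> requires all groups to have the same element type.\<close>

definition short_exact ::
  "('a, 'k) monoid_scheme \<Rightarrow> ('b, 'm) monoid_scheme \<Rightarrow> ('c, 'n) monoid_scheme
    \<Rightarrow> ('a \<Rightarrow> 'b) \<Rightarrow> ('b \<Rightarrow> 'c) \<Rightarrow> bool" where
  "short_exact A B C f g \<longleftrightarrow> f \<in> mon A B \<and> kernel B C g = f ` carrier A \<and> g \<in> epi B C"

definition tra_inf_exact :: "('a, 'm) monoid_scheme \<Rightarrow> 'a set \<Rightarrow> bool" where
  "tra_inf_exact G Z \<longleftrightarrow>
    short_exact (char_group (G\<lparr>carrier := Z\<rparr>)) (H2 (G Mod Z)) (H2 G)
      (transgression G Z) (inflation G Z)"

definition compatible_pair :: "('a, 'm) monoid_scheme \<Rightarrow> ('b, 'n) monoid_scheme \<Rightarrow> bool" where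
  "compatible_pair G H \<longleftrightarrow>
    group G \<and> finite (carrier G) \<and> group H \<and> finite (carrier H) \<and>
    (\<exists>Z Z'. central_subgroup Z G \<and> central_subgroup Z' H \<and>
       tra_inf_exact G Z \<and> tra_inf_exact H Z' \<and>
       (\<exists>i\<in>iso (H\<lparr>carrier := Z'\<rparr>) (G\<lparr>carrier := Z\<rparr>). \<exists>\<phi>\<in>iso (H Mod Z') (G Mod Z).
          \<forall>\<chi>\<in>carrier (char_group (G\<lparr>carrier := Z\<rparr>)).
            H2_pullback (H Mod Z') \<phi> (transgression G Z \<chi>) =
            transgression H Z' (\<lambda>z\<in>Z'. \<chi> (i z))))"


subsection \<open>Well-definedness\<close>

lemma Z2_comm_group:
  assumes "group G" shows "comm_group (Z2 G)"
proof -
  interpret group G by fact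
  show ?thesis
  proof (rule comm_groupI, goal_cases)
    case (1 x y)
    then show ?case
      apply (auto simp: Z2_def cstar_def PiE_def Pi_def extensional_def)
      apply (simp add: mult.assoc mult.left_commute)
      done
  next
    case 2
    then show ?case by (auto simp: Z2_def cstar_def PiE_def)
  next
    case (3 x y z)
    then show ?case by (auto simp: Z2_def fun_eq_iff)
  next
    case (4 x y)
    then show ?case by (auto simp: Z2_def fun_eq_iff)
  next
    case (5 x)
    then show ?case by (auto simp: Z2_def fun_eq_iff PiE_def extensional_def)
  next
    case (6 x)
    let ?y = "\<lambda>p\<in>carrier G \<times> carrier G. inverse (x p)"
    have "?y \<in> carrier (Z2 G)"
      using 6 by (auto simp: Z2_def cstar_def PiE_def Pi_def simp flip: inverse_mult_distrib)
    moreover have "?y \<otimes>\<^bsub>Z2 G\<^esub> x = \<one>\<^bsub>Z2 G\<^esub>"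
      using 6 by (auto simp: Z2_def cstar_def PiE_def Pi_def fun_eq_iff)
    ultimately show ?case by blast
  qed
qed

lemma coboundary_Z2:
  assumes "group G" "f \<in> carrier G \<rightarrow> carrier cstar"
  shows "coboundary G f \<in> carrier (Z2 G)"
proof -
  interpret group G by fact
  show ?thesis
    using assms(2)
    by (auto simp: coboundary_def Z2_def cstar_def PiE_def Pi_def m_assoc)
qed

lemma B2_subgroup:
  assumes "group G" shows "subgroup (B2 G) (Z2 G)"
proof -
  interpret group G by fact
  interpret Z: comm_group "Z2 G" by (rule Z2_comm_group) fact
  have mult: "coboundary G f \<otimes>\<^bsub>Z2 G\<^esub> coboundary G f' = coboundary G (\<lambda>x. f x * f' x)" for f f'
    by (auto simp: Z2_def coboundary_def fun_eq_iff)
  have one: "\<one>\<^bsub>Z2 G\<^esub> = coboundary G (\<lambda>x. 1)"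
    by (auto simp: Z2_def coboundary_def fun_eq_iff)
  have inv: "inv\<^bsub>Z2 G\<^esub> (coboundary G f) = coboundary G (\<lambda>x. inverse (f x))"
    if f: "f \<in> carrier G \<rightarrow> carrier cstar" for f
  proof (rule Z.inv_equality)
    have f': "(\<lambda>x. inverse (f x)) \<in> carrier G \<rightarrow> carrier cstar"
      using f by (auto simp: cstar_def Pi_def)
    show "coboundary G f \<in> carrier (Z2 G)" "coboundary G (\<lambda>x. inverse (f x)) \<in> carrier (Z2 G)"
      using coboundary_Z2 assms f f' by blast+
    show "coboundary G (\<lambda>x. inverse (f x)) \<otimes>\<^bsub>Z2 G\<^esub> coboundary G f = \<one>\<^bsub>Z2 G\<^esub>"
      unfolding mult one using f by (auto simp: coboundary_def fun_eq_iff cstar_def Pi_def)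
  qed
  show ?thesis
  proof
    show "B2 G \<subseteq> carrier (Z2 G)" unfolding B2_def using coboundary_Z2[OF assms] by blast
    show "x \<otimes>\<^bsub>Z2 G\<^esub> y \<in> B2 G" if "x \<in> B2 G" "y \<in> B2 G" for x y
    proof -
      obtain f f' where "f \<in> carrier G \<rightarrow> carrier cstar" "f' \<in> carrier G \<rightarrow> carrier cstar"
        "x = coboundary G f" "y = coboundary G f'" using \<open>x \<in> B2 G\<close> \<open>y \<in> B2 G\<close> unfolding B2_def by blast
      then show ?thesis
        unfolding B2_def by (auto simp: mult cstar_def Pi_def intro!: imageI)
    qed
    show "\<one>\<^bsub>Z2 G\<^esub> \<in> B2 G"
      unfolding B2_def one by (auto simp: cstar_def intro!: imageI)
    show "inv\<^bsub>Z2 G\<^esub> x \<in> B2 G" if "x \<in> B2 G" for x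
    proof -
      obtain f where "f \<in> carrier G \<rightarrow> carrier cstar" "x = coboundary G f"
        using \<open>x \<in> B2 G\<close> unfolding B2_def by blast
      then show ?thesis
        unfolding B2_def by (auto simp: inv cstar_def Pi_def intro!: imageI)
    qed
  qed
qed

lemma H2_comm_group:
  assumes "group G" shows "comm_group (H2 G)"
  unfolding H2_def
  by (intro comm_group.abelian_FactGroup Z2_comm_group B2_subgroup assms)

lemma H2_class_eqI:
  assumes "group G" "\<alpha> \<in> carrier (Z2 G)" "f \<in> carrier G \<rightarrow> carrier cstar"
  shows "H2_class G (coboundary G f \<otimes>\<^bsub>Z2 G\<^esub> \<alpha>) = H2_class G \<alpha>"
proof -
  interpret Z: comm_group "Z2 G" by (rule Z2_comm_group) fact
  have b: "coboundary G f \<in> B2 G" unfolding B2_def using assms(3) by blast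
  have sub: "subgroup (B2 G) (Z2 G)" by (rule B2_subgroup) fact
  show ?thesis
    unfolding H2_class_def
    using b assms(2) sub Z.coset_mult_assoc[OF subgroup.subset[OF sub], of "coboundary G f" \<alpha>]
      Z.coset_join2[of "coboundary G f" "B2 G"] subgroup.mem_carrier[OF sub b]
    by auto
qed

lemma H2_pullback_class:
  assumes "group K" "group G" "f \<in> hom K G" "\<alpha> \<in> carrier (Z2 G)"
  shows "pullback_cochain K f \<alpha> \<in> carrier (Z2 K)"
    and "H2_pullback K f (H2_class G \<alpha>) = H2_class K (pullback_cochain K f \<alpha>)"
proof -
  interpret K: group K by fact
  interpret G: group G by fact
  have f: "f x \<in> carrier G" if "x \<in> carrier K" for x using assms(3) that by (auto simp: hom_def)
  have fm: "f (x \<otimes>\<^bsub>K\<^esub> y) = f x \<otimes>\<^bsub>G\<^esub> f y" if "x \<in> carrier K" "y \<in> carrier K" for x y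
    using assms(3) that by (auto simp: hom_def)
  show pb: "pullback_cochain K f \<alpha> \<in> carrier (Z2 K)"
    using assms(4) by (auto simp: pullback_cochain_def Z2_def cstar_def PiE_def Pi_def f fm)
  have "H2_class K (pullback_cochain K f \<beta>) = H2_class K (pullback_cochain K f \<alpha>)"
    if b: "\<beta> \<in> H2_class G \<alpha>" for \<beta>
  proof -
    obtain h where h: "h \<in> carrier G \<rightarrow> carrier cstar" "\<beta> = coboundary G h \<otimes>\<^bsub>Z2 G\<^esub> \<alpha>"
      using b unfolding H2_class_def r_coset_def B2_def by blast
    have "pullback_cochain K f \<beta> = coboundary K (h \<circ> f) \<otimes>\<^bsub>Z2 K\<^esub> pullback_cochain K f \<alpha>"
      unfolding h(2) by (auto simp: pullback_cochain_def Z2_def coboundary_def f fm fun_eq_iff)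
    moreover have "h \<circ> f \<in> carrier K \<rightarrow> carrier cstar" using h(1) f by auto
    ultimately show ?thesis using H2_class_eqI[OF assms(1) pb] by simp
  qed
  moreover have "\<alpha> \<in> H2_class G \<alpha>"
    unfolding H2_class_def
    using assms(2,4) B2_subgroup Z2_comm_group comm_group.axioms(2) group.rcos_self by metis
  ultimately have "(\<lambda>\<alpha>. H2_class K (pullback_cochain K f \<alpha>)) ` H2_class G \<alpha>
      = {H2_class K (pullback_cochain K f \<alpha>)}" by blast
  then show "H2_pullback K f (H2_class G \<alpha>) = H2_class K (pullback_cochain K f \<alpha>)"
    unfolding H2_pullback_def by simp
qed

lemma central_subgroup_normal:
  assumes "group G" "central_subgroup Z G" shows "Z \<lhd> G"
proof -
  interpret group G by fact
  have Z: "subgroup Z G" using assms(2) by (simp add: central_subgroup_def)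
  show ?thesis
  proof (intro normal_invI Z)
    fix x h assume x: "x \<in> carrier G" and h: "h \<in> Z"
    have hc: "h \<in> carrier G" using Z h by (rule subgroup.mem_carrier)
    have "x \<otimes>\<^bsub>G\<^esub> h = h \<otimes>\<^bsub>G\<^esub> x" using assms(2) x h by (metis central_subgroup_def)
    then have "x \<otimes>\<^bsub>G\<^esub> h \<otimes>\<^bsub>G\<^esub> inv\<^bsub>G\<^esub> x = h" using x hc by (simp add: m_assoc)
    then show "x \<otimes>\<^bsub>G\<^esub> h \<otimes>\<^bsub>G\<^esub> inv\<^bsub>G\<^esub> x \<in> Z" using h by simp
  qed
qed

lemma section_exists:
  assumes "group G" "subgroup Z G" shows "\<exists>\<mu>. is_section G Z \<mu>"
proof -
  have "\<exists>x. x \<in> U" if "U \<in> carrier (G Mod Z)" for U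
    using that assms group.rcos_self[OF assms(1) _ assms(2)] by (auto simp: FactGroup_def RCOSETS_def)
  then have "is_section G Z (\<lambda>U. SOME x. x \<in> U)"
    unfolding is_section_def by (meson someI_ex)
  then show ?thesis by blast
qed

lemma section_defect:
  assumes "group G" "central_subgroup Z G" "is_section G Z \<mu>"
    and "U \<in> carrier (G Mod Z)" "V \<in> carrier (G Mod Z)"
  shows "\<mu> U \<in> carrier G" "\<mu> U \<otimes>\<^bsub>G\<^esub> \<mu> V \<otimes>\<^bsub>G\<^esub> inv\<^bsub>G\<^esub> (\<mu> (U \<otimes>\<^bsub>G Mod Z\<^esub> V)) \<in> Z"
proof -
  interpret normal Z G using central_subgroup_normal assms(1,2) by blast
  interpret Q: group "G Mod Z" by (rule factorgroup_is_group)
  have car: "\<mu> W \<in> carrier G" "W = Z #>\<^bsub>G\<^esub> \<mu> W" if W: "W \<in> carrier (G Mod Z)" for W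
  proof -
    have "\<mu> W \<in> W" using assms(3) W by (simp add: is_section_def)
    moreover obtain a where a: "a \<in> carrier G" "W = Z #>\<^bsub>G\<^esub> a"
      using W by (auto simp: FactGroup_def RCOSETS_def)
    ultimately show "\<mu> W \<in> carrier G" "W = Z #>\<^bsub>G\<^esub> \<mu> W"
      using r_coset_subset_G[OF subset a(1)] repr_independence[OF _ a(1) is_subgroup] by auto
  qed
  let ?UV = "U \<otimes>\<^bsub>G Mod Z\<^esub> V"
  have UV: "?UV \<in> carrier (G Mod Z)" using assms(4,5) by (rule Q.m_closed)
  show "\<mu> U \<in> carrier G" using car assms(4) by blast
  have "Z #>\<^bsub>G\<^esub> (\<mu> U \<otimes>\<^bsub>G\<^esub> \<mu> V) = ?UV"
    using rcos_sum[OF car(1)[OF assms(4)] car(1)[OF assms(5)]]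
    by (simp add: FactGroup_def flip: car(2)[OF assms(4)] car(2)[OF assms(5)])
  also have "\<dots> = Z #>\<^bsub>G\<^esub> \<mu> ?UV" using car(2)[OF UV] .
  finally have eq: "Z #>\<^bsub>G\<^esub> (\<mu> U \<otimes>\<^bsub>G\<^esub> \<mu> V) = Z #>\<^bsub>G\<^esub> \<mu> ?UV" .
  have "\<mu> U \<otimes>\<^bsub>G\<^esub> \<mu> V \<in> Z #>\<^bsub>G\<^esub> \<mu> ?UV"
    using rcos_self[OF _ is_subgroup, of "\<mu> U \<otimes>\<^bsub>G\<^esub> \<mu> V"] car(1) assms(4,5) eq by auto
  then show "\<mu> U \<otimes>\<^bsub>G\<^esub> \<mu> V \<otimes>\<^bsub>G\<^esub> inv\<^bsub>G\<^esub> (\<mu> ?UV) \<in> Z"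
    using car(1)[OF UV] by (auto simp: r_coset_def m_assoc)
qed

lemma transgression_cocycle_Z2:
  assumes "group G" "central_subgroup Z G" "is_section G Z \<mu>"
    and "\<chi> \<in> carrier (char_group (G\<lparr>carrier := Z\<rparr>))"
  shows "transgression_cocycle G Z \<mu> \<chi> \<in> carrier (Z2 (G Mod Z))"
proof -
  interpret normal Z G using central_subgroup_normal assms(1,2) by blast
  interpret Q: group "G Mod Z" by (rule factorgroup_is_group)
  note [simp del] = mult_FactGroup carrier_FactGroup
  note def = section_defect[OF assms(1-3)]
  define d where "d U V = \<mu> U \<otimes>\<^bsub>G\<^esub> \<mu> V \<otimes>\<^bsub>G\<^esub> inv\<^bsub>G\<^esub> (\<mu> (U \<otimes>\<^bsub>G Mod Z\<^esub> V))" for U V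
  have c: "z \<otimes>\<^bsub>G\<^esub> g = g \<otimes>\<^bsub>G\<^esub> z" if "z \<in> Z" "g \<in> carrier G" for z g
    using assms(2) that by (auto simp: central_subgroup_def)
  have chi: "\<chi> z \<noteq> 0" "\<chi> (z \<otimes>\<^bsub>G\<^esub> w) = \<chi> z * \<chi> w" if "z \<in> Z" "w \<in> Z" for z w
    using assms(4) that by (auto simp: char_group_def hom_def cstar_def)
  have dZ: "d U V \<in> Z" if "U \<in> carrier (G Mod Z)" "V \<in> carrier (G Mod Z)" for U V
    using def(2)[OF that] by (simp add: d_def)
  have dG: "d U V \<in> carrier G" if "U \<in> carrier (G Mod Z)" "V \<in> carrier (G Mod Z)" for U V
    using dZ that by (blast intro: mem_carrier)
  have m: "\<mu> U \<in> carrier G" if "U \<in> carrier (G Mod Z)" for U using def(1) that by blast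
  have dm: "\<mu> U \<otimes>\<^bsub>G\<^esub> \<mu> V = d U V \<otimes>\<^bsub>G\<^esub> \<mu> (U \<otimes>\<^bsub>G Mod Z\<^esub> V)"
    if "U \<in> carrier (G Mod Z)" "V \<in> carrier (G Mod Z)" for U V
    unfolding d_def using that m by (simp add: m_assoc)
  have co: "d U V \<otimes>\<^bsub>G\<^esub> d (U \<otimes>\<^bsub>G Mod Z\<^esub> V) W = d U (V \<otimes>\<^bsub>G Mod Z\<^esub> W) \<otimes>\<^bsub>G\<^esub> d V W"
    if h: "U \<in> carrier (G Mod Z)" "V \<in> carrier (G Mod Z)" "W \<in> carrier (G Mod Z)" for U V W
  proof -
    let ?w = "\<mu> (U \<otimes>\<^bsub>G Mod Z\<^esub> V \<otimes>\<^bsub>G Mod Z\<^esub> W)"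
    have w: "?w \<in> carrier G" using m h by simp
    have "d U V \<otimes>\<^bsub>G\<^esub> d (U \<otimes>\<^bsub>G Mod Z\<^esub> V) W \<otimes>\<^bsub>G\<^esub> ?w = d U V \<otimes>\<^bsub>G\<^esub> (\<mu> (U \<otimes>\<^bsub>G Mod Z\<^esub> V) \<otimes>\<^bsub>G\<^esub> \<mu> W)"
      using h w by (simp add: dm dG m_assoc)
    also have "\<dots> = \<mu> U \<otimes>\<^bsub>G\<^esub> \<mu> V \<otimes>\<^bsub>G\<^esub> \<mu> W"
      using h m dG by (simp add: dm m_assoc)
    also have "\<dots> = \<mu> U \<otimes>\<^bsub>G\<^esub> (\<mu> V \<otimes>\<^bsub>G\<^esub> \<mu> W)" using h m by (simp add: m_assoc)
    also have "\<dots> = \<mu> U \<otimes>\<^bsub>G\<^esub> (d V W \<otimes>\<^bsub>G\<^esub> \<mu> (V \<otimes>\<^bsub>G Mod Z\<^esub> W))" using h by (simp add: dm)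
    also have "\<dots> = d V W \<otimes>\<^bsub>G\<^esub> (\<mu> U \<otimes>\<^bsub>G\<^esub> \<mu> (V \<otimes>\<^bsub>G Mod Z\<^esub> W))"
      using h m dG dZ c[of "d V W" "\<mu> U"] by (simp flip: m_assoc)
    also have "\<dots> = d V W \<otimes>\<^bsub>G\<^esub> (d U (V \<otimes>\<^bsub>G Mod Z\<^esub> W) \<otimes>\<^bsub>G\<^esub> ?w)"
      using h by (simp add: dm Q.m_assoc)
    also have "\<dots> = d U (V \<otimes>\<^bsub>G Mod Z\<^esub> W) \<otimes>\<^bsub>G\<^esub> d V W \<otimes>\<^bsub>G\<^esub> ?w"
      using h w m dG dZ c[of "d V W" "d U (V \<otimes>\<^bsub>G Mod Z\<^esub> W)"] by (simp flip: m_assoc)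
    finally show ?thesis by (rule r_cancel) (use w dG h in simp_all)
  qed
  have "\<chi> (d U V) * \<chi> (d (U \<otimes>\<^bsub>G Mod Z\<^esub> V) W) = \<chi> (d U (V \<otimes>\<^bsub>G Mod Z\<^esub> W)) * \<chi> (d V W)"
    if h: "U \<in> carrier (G Mod Z)" "V \<in> carrier (G Mod Z)" "W \<in> carrier (G Mod Z)" for U V W
    using co[OF h] h dZ by (simp flip: chi(2))
  moreover have "\<chi> (d U V) \<noteq> 0" if "U \<in> carrier (G Mod Z)" "V \<in> carrier (G Mod Z)" for U V
    using chi(1) dZ that by blast
  ultimately show ?thesis
    unfolding transgression_cocycle_def d_def[symmetric]
    by (auto simp: Z2_def cstar_def PiE_def Pi_def)
qed

lemma transgression_indep:
  assumes "group G" "central_subgroup Z G" "is_section G Z \<mu>"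
    and "\<chi> \<in> carrier (char_group (G\<lparr>carrier := Z\<rparr>))"
  shows "transgression G Z \<chi> = H2_class (G Mod Z) (transgression_cocycle G Z \<mu> \<chi>)"
proof -
  interpret normal Z G using central_subgroup_normal assms(1,2) by blast
  interpret Q: group "G Mod Z" by (rule factorgroup_is_group)
  define \<nu> where "\<nu> = (SOME \<mu>. is_section G Z \<mu>)"
  have \<nu>: "is_section G Z \<nu>"
    unfolding \<nu>_def using section_exists[OF assms(1) is_subgroup] by (rule someI_ex)
  note [simp del] = mult_FactGroup carrier_FactGroup
  note defm = section_defect[OF assms(1-3)] and defn = section_defect[OF assms(1,2) \<nu>]
  have c: "z \<otimes>\<^bsub>G\<^esub> g = g \<otimes>\<^bsub>G\<^esub> z" if "z \<in> Z" "g \<in> carrier G" for z g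
    using assms(2) that by (auto simp: central_subgroup_def)
  have chi: "\<chi> z \<noteq> 0" "\<chi> (z \<otimes>\<^bsub>G\<^esub> w) = \<chi> z * \<chi> w" if "z \<in> Z" "w \<in> Z" for z w
    using assms(4) that by (auto simp: char_group_def hom_def cstar_def)
  define e where "e U = \<nu> U \<otimes>\<^bsub>G\<^esub> inv\<^bsub>G\<^esub> (\<mu> U)" for U
  have eZ: "e U \<in> Z" if U: "U \<in> carrier (G Mod Z)" for U
  proof -
    obtain a where a: "a \<in> carrier G" "U = Z #>\<^bsub>G\<^esub> a"
      using U by (auto simp: carrier_FactGroup)
    have "\<mu> U \<in> U" "\<nu> U \<in> U" using U assms(3) \<nu> by (auto simp: is_section_def)
    then obtain y z where yz: "y \<in> Z" "z \<in> Z" "\<mu> U = y \<otimes>\<^bsub>G\<^esub> a" "\<nu> U = z \<otimes>\<^bsub>G\<^esub> a"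
      using a by (auto simp: r_coset_def)
    then have "e U = z \<otimes>\<^bsub>G\<^esub> inv\<^bsub>G\<^esub> y"
      unfolding e_def using a mem_carrier by (simp add: inv_mult_group m_assoc) (simp flip: m_assoc)
    then show ?thesis using yz by simp
  qed
  let ?dm = "\<lambda>U V. \<mu> U \<otimes>\<^bsub>G\<^esub> \<mu> V \<otimes>\<^bsub>G\<^esub> inv\<^bsub>G\<^esub> (\<mu> (U \<otimes>\<^bsub>G Mod Z\<^esub> V))"
  let ?dn = "\<lambda>U V. \<nu> U \<otimes>\<^bsub>G\<^esub> \<nu> V \<otimes>\<^bsub>G\<^esub> inv\<^bsub>G\<^esub> (\<nu> (U \<otimes>\<^bsub>G Mod Z\<^esub> V))"
  have key: "\<chi> (?dn U V) = \<chi> (e U) * \<chi> (e V) / \<chi> (e (U \<otimes>\<^bsub>G Mod Z\<^esub> V)) * \<chi> (?dm U V)"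
    if h: "U \<in> carrier (G Mod Z)" "V \<in> carrier (G Mod Z)" for U V
  proof -
    let ?UV = "U \<otimes>\<^bsub>G Mod Z\<^esub> V"
    have UV: "?UV \<in> carrier (G Mod Z)" using h by simp
    have mc: "\<mu> U \<in> carrier G" "\<mu> V \<in> carrier G" "\<mu> ?UV \<in> carrier G"
      "\<nu> U \<in> carrier G" "\<nu> V \<in> carrier G" "\<nu> ?UV \<in> carrier G"
      using defm(1) defn(1) h UV by blast+
    have ec: "e U \<in> carrier G" "e V \<in> carrier G" "e ?UV \<in> carrier G" "?dn U V \<in> carrier G" "?dm U V \<in> carrier G"
      using eZ h UV mem_carrier defm(2)[OF h] defn(2)[OF h] by blast+
    have n: "\<nu> U = e U \<otimes>\<^bsub>G\<^esub> \<mu> U" "\<nu> V = e V \<otimes>\<^bsub>G\<^esub> \<mu> V" "\<nu> ?UV = e ?UV \<otimes>\<^bsub>G\<^esub> \<mu> ?UV"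
      unfolding e_def using mc by (simp_all add: m_assoc)
    have "?dn U V \<otimes>\<^bsub>G\<^esub> e ?UV \<otimes>\<^bsub>G\<^esub> \<mu> ?UV = ?dn U V \<otimes>\<^bsub>G\<^esub> \<nu> ?UV"
      using mc ec n(3) by (simp add: m_assoc)
    also have "\<dots> = \<nu> U \<otimes>\<^bsub>G\<^esub> \<nu> V" using mc by (simp add: m_assoc)
    also have "\<dots> = e U \<otimes>\<^bsub>G\<^esub> (\<mu> U \<otimes>\<^bsub>G\<^esub> e V) \<otimes>\<^bsub>G\<^esub> \<mu> V" using mc ec n by (simp add: m_assoc)
    also have "\<dots> = e U \<otimes>\<^bsub>G\<^esub> e V \<otimes>\<^bsub>G\<^esub> (\<mu> U \<otimes>\<^bsub>G\<^esub> \<mu> V)"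
      using mc ec c[OF eZ[OF h(2)] mc(1)] by (simp add: m_assoc flip: m_assoc[of "e V"])
    also have "\<dots> = e U \<otimes>\<^bsub>G\<^esub> e V \<otimes>\<^bsub>G\<^esub> ?dm U V \<otimes>\<^bsub>G\<^esub> \<mu> ?UV"
      using mc ec by (simp add: m_assoc)
    finally have "?dn U V \<otimes>\<^bsub>G\<^esub> e ?UV = e U \<otimes>\<^bsub>G\<^esub> e V \<otimes>\<^bsub>G\<^esub> ?dm U V"
      by (rule r_cancel) (use mc ec in simp_all)
    then have "\<chi> (?dn U V) * \<chi> (e ?UV) = \<chi> (e U) * \<chi> (e V) * \<chi> (?dm U V)"
      using defm(2)[OF h] defn(2)[OF h] eZ h UV by (simp flip: chi(2))
    then show ?thesis using chi(1)[OF eZ[OF UV] eZ[OF UV]] by (simp add: field_simps)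
  qed
  have "transgression_cocycle G Z \<nu> \<chi> =
      coboundary (G Mod Z) (\<chi> \<circ> e) \<otimes>\<^bsub>Z2 (G Mod Z)\<^esub> transgression_cocycle G Z \<mu> \<chi>"
    using key by (auto simp: transgression_cocycle_def coboundary_def Z2_def fun_eq_iff)
  moreover have "\<chi> \<circ> e \<in> carrier (G Mod Z) \<rightarrow> carrier cstar"
    using chi(1)[OF eZ eZ] by (auto simp: cstar_def)
  ultimately show ?thesis
    unfolding transgression_def \<nu>_def[symmetric]
    using H2_class_eqI[OF Q.is_group transgression_cocycle_Z2[OF assms]] by simp
qed

definition basis_elem :: "('a, 'm) monoid_scheme \<Rightarrow> 'a \<Rightarrow> 'a \<Rightarrow> complex" where
  "basis_elem G g = (\<lambda>x\<in>carrier G. if x = g then 1 else 0)"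

lemma basis_elem_mult:
  assumes "group G" "finite (carrier G)" "g \<in> carrier G" "h \<in> carrier G"
  shows "basis_elem G g \<otimes>\<^bsub>twisted_group_algebra G \<alpha>\<^esub> basis_elem G h =
    \<alpha> (g, h) \<odot>\<^bsub>twisted_group_algebra G \<alpha>\<^esub> basis_elem G (g \<otimes>\<^bsub>G\<^esub> h)"
proof -
  interpret group G by fact
  have "(\<Sum>(a, b)\<in>{(a, b) \<in> carrier G \<times> carrier G. a \<otimes>\<^bsub>G\<^esub> b = x}.
      basis_elem G g a * basis_elem G h b * \<alpha> (a, b)) = (if x = g \<otimes>\<^bsub>G\<^esub> h then \<alpha> (g, h) else 0)" for x
  proof -
    let ?S = "{(a, b) \<in> carrier G \<times> carrier G. a \<otimes>\<^bsub>G\<^esub> b = x}"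
    have fin: "finite ?S" by (rule finite_subset[of _ "carrier G \<times> carrier G"]) (auto simp: assms)
    have "(\<Sum>(a, b)\<in>?S. basis_elem G g a * basis_elem G h b * \<alpha> (a, b)) =
        (\<Sum>p\<in>?S. if p = (g, h) then \<alpha> (g, h) else 0)"
      by (rule sum.cong) (auto simp: basis_elem_def assms split: if_splits)
    also have "\<dots> = (if (g, h) \<in> ?S then \<alpha> (g, h) else 0)" using fin by (simp only: sum.delta)
    finally show ?thesis using assms(3,4) by auto
  qed
  then show ?thesis by (auto simp: twisted_group_algebra_def basis_elem_def fun_eq_iff)
qed

end

theory Submission
  imports Defs
begin

text \<open>
  For a central extension \<open>1 \<rightarrow> Z \<rightarrow> G \<rightarrow> Q \<rightarrow> 1\<close>, a Fourier transform along the fibres of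
  \<open>G \<rightarrow> Q\<close> decomposes the twisted group algebra of an inflated class \<open>inf \<alpha>\<close> as the direct sum, over
  the characters \<open>\<chi>\<close> of \<open>Z\<close>, of the twisted group algebras of \<open>Q\<close> at \<open>\<alpha> \<cdot> tra \<chi>\<close>.  Two groups that
  cover the same \<open>Q\<close> with the same family of transgression classes and with surjective inflations
  therefore have isomorphic twisted group algebras, and their second cohomology groups are the same
  quotient of that of \<open>Q\<close>.

  This situation passes to direct products.  A cocycle on \<open>G \<times> G'\<close> is cohomologous to the product of
  its restrictions to the factors and a bimultiplicative pairing of \<open>G\<close> with \<open>G'\<close>.  Injectivity of the
  transgression means that homomorphisms \<open>G \<rightarrow> \<complex>\<^sup>\<times>\<close> are trivial on \<open>Z\<close>, so the pairing
  descends to the quotients and inflation remains surjective.  Part (ii) is the case in which \<open>A\<close>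
  covers itself.
\<close>

section \<open>Characters of finite abelian groups\<close>

text \<open>A direct product of compatible pairs is awkward to treat as a compatible pair itself:
  character groups, quotients and exact sequences of the product would have to be rebuilt. Exactness
  is therefore first traded for identities between cochains, mostly finite sums that factor over a
  product. The weights \<open>C\<close> come from a section mu of G -> G/Z. The function sending z *
  mu(U) to chi(z) has as coboundary, up to inversion, the inflation of tra chi. Compatibility
  identifies only classes of transgressions, whereas the algebras are built from cocycles; a further
  cochain on the quotient absorbs the difference, so that both groups use literally the same
  cocycles. The pairing on G x G' is the Kuenneth term Hom(Gab tensor G'ab, C^x), invisible to the
  restrictions to the factors. That it descends rests on the five-term sequence: a homomorphism G ->
  C^x restricts to a character of Z with trivial transgression, and injectivity makes this character
  trivial.\<close>

lemma extend_character:
  fixes G (structure)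
  assumes "comm_group G" and K: "subgroup K G" and \<chi>: "\<chi> \<in> hom (G\<lparr>carrier := K\<rparr>) cstar"
    and g: "g \<in> carrier G" and c0: "c \<noteq> 0"
    and c: "\<And>j::nat. g [^] j \<in> K \<Longrightarrow> \<chi> (g [^] j) = c ^ j"
    and fin: "finite (carrier G)"
  obtains K' \<chi>' where "subgroup K' G" "K \<subseteq> K'" "g \<in> K'"
    "\<chi>' \<in> hom (G\<lparr>carrier := K'\<rparr>) cstar" "\<And>k. k \<in> K \<Longrightarrow> \<chi>' k = \<chi> k" "\<chi>' g = c"
proof -
  interpret comm_group G by fact
  interpret K: subgroup K G by fact
  \<comment> \<open>Natural exponents suffice: in a finite group the inverse of \<open>x\<close> is
    the power of \<open>x\<close> with exponent \<open>order G - 1\<close>, so closure under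
    products already gives closure under inverses.\<close>
  define K' where "K' = {k \<otimes> g [^] (n::nat) | k n. k \<in> K}"
  have \<chi>m: "\<chi> (x \<otimes> y) = \<chi> x * \<chi> y" and \<chi>0: "\<chi> x \<noteq> 0" if "x \<in> K" "y \<in> K" for x y
    using \<chi> that by (auto simp: hom_def cstar_def)
  \<comment> \<open>Cancelling \<open>g [^] n\<close> leaves \<open>g [^] (m - n)\<close> in
    \<open>K\<close>, where the condition on \<open>c\<close> fixes the value of \<chi>. This is
    what makes the value \<open>\<chi> k * c ^ n\<close> independent of the representation of an
    element of \<open>K'\<close>.\<close>
  have le: "\<chi> k * c ^ n = \<chi> l * c ^ m"
    if "k \<in> K" "l \<in> K" "k \<otimes> g [^] n = l \<otimes> g [^] m" "n \<le> m" for k l and n m :: nat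
  proof -
    have "k \<otimes> g [^] n = l \<otimes> g [^] (m - n) \<otimes> g [^] n"
      using that g K.mem_carrier by (simp add: m_assoc nat_pow_mult)
    then have *: "k = l \<otimes> g [^] (m - n)"
      using g that K.mem_carrier by simp
    then have "g [^] (m - n) = inv l \<otimes> k"
      using g that K.mem_carrier by (simp flip: m_assoc)
    then have "g [^] (m - n) \<in> K" using that by simp
    then have "\<chi> k = \<chi> l * c ^ (m - n)" using * \<chi>m that c by simp
    then show ?thesis using that by (simp add: mult.assoc flip: power_add)
  qed
  have wd: "\<chi> k * c ^ n = \<chi> l * c ^ m"
    if "k \<in> K" "l \<in> K" "k \<otimes> g [^] n = l \<otimes> g [^] m" for k l and n m :: nat
    using le[of k l n m] le[of l k m n] that by (cases "n \<le> m") auto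
  define \<chi>' where "\<chi>' x = (THE v. \<exists>k n. k \<in> K \<and> x = k \<otimes> g [^] (n::nat) \<and> v = \<chi> k * c ^ n)" for x
  have \<chi>': "\<chi>' (k \<otimes> g [^] n) = \<chi> k * c ^ n" if "k \<in> K" for k and n :: nat
    unfolding \<chi>'_def
  proof (rule the_equality)
    show "\<exists>l m. l \<in> K \<and> k \<otimes> g [^] n = l \<otimes> g [^] (m::nat) \<and> \<chi> k * c ^ n = \<chi> l * c ^ m"
      using that by blast
  qed (use wd that in metis)
  have "\<one> \<otimes> g [^] (0::nat) \<in> K'" "K' \<subseteq> carrier G"
    unfolding K'_def using K.one_closed g by (blast, auto)
  then have "K' \<noteq> {}" "K' \<subseteq> carrier G" by auto
  moreover have mult: "(k \<otimes> g [^] n) \<otimes> (l \<otimes> g [^] m) = (k \<otimes> l) \<otimes> g [^] (n + m)"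
    if "k \<in> K" "l \<in> K" for k l and n m :: nat
    using that g K.mem_carrier by (simp add: m_ac flip: nat_pow_mult)
  then have prodK': "x \<otimes> y \<in> K'" if "x \<in> K'" "y \<in> K'" for x y
    using that unfolding K'_def by clarsimp (metis K.m_closed)
  moreover have "inv x \<in> K'" if x: "x \<in> K'" for x
  proof -
    have xG: "x \<in> carrier G" using x \<open>K' \<subseteq> carrier G\<close> by blast
    have pow: "x [^] n \<in> K'" for n :: nat
    proof (induction n)
      case 0
      show ?case using \<open>\<one> \<otimes> g [^] (0::nat) \<in> K'\<close> by simp
    next
      case (Suc n)
      then show ?case using x prodK' by simp
    qed
    have "0 < order G" using fin order_gt_0_iff_finite by blast
    then have "x [^] (order G - 1) \<otimes> x = x [^] order G"
      by (metis Suc_pred' nat_pow_Suc)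
    then have "inv x = x [^] (order G - 1)"
      using xG pow_order_eq_1[OF xG] by (intro inv_equality) auto
    then show ?thesis using pow by simp
  qed
  ultimately have sub: "subgroup K' G"
    by (intro subgroupI) auto
  have K'I: "k \<otimes> g [^] n \<in> K'" if "k \<in> K" for k and n :: nat
    unfolding K'_def using that by blast
  have KK': "K \<subseteq> K'"
    using K'I[of _ 0] K.mem_carrier by auto
  have gK': "g \<in> K'"
    using K'I[OF K.one_closed, of 1] g by simp
  have "\<chi>' \<in> hom (G\<lparr>carrier := K'\<rparr>) cstar"
  proof (rule homI)
    fix x assume "x \<in> carrier (G\<lparr>carrier := K'\<rparr>)"
    then obtain k and n :: nat where "k \<in> K" "x = k \<otimes> g [^] n"
      unfolding K'_def by auto
    then show "\<chi>' x \<in> carrier cstar"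
      by (simp add: \<chi>' \<chi>0[of k k] c0 cstar_def)
  next
    fix x y assume "x \<in> carrier (G\<lparr>carrier := K'\<rparr>)" "y \<in> carrier (G\<lparr>carrier := K'\<rparr>)"
    then obtain k l and n m :: nat where
      "k \<in> K" "l \<in> K" "x = k \<otimes> g [^] n" "y = l \<otimes> g [^] m"
      unfolding K'_def by auto
    then show "\<chi>' (x \<otimes>\<^bsub>G\<lparr>carrier := K'\<rparr>\<^esub> y) = \<chi>' x \<otimes>\<^bsub>cstar\<^esub> \<chi>' y"
      by (simp add: mult \<chi>' \<chi>m cstar_def power_add)
  qed
  moreover have "\<chi>' k = \<chi> k" if "k \<in> K" for k
    using \<chi>'[OF that, of 0] that K.mem_carrier by simp
  moreover have "\<chi>' g = c"
    using \<chi>'[OF K.one_closed, of 1] \<chi>m[of \<one> \<one>] \<chi>0[of \<one> \<one>] g by simp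
  ultimately show ?thesis using that sub KK' gK' by blast
qed

text \<open>If m is the least positive exponent with \<open>g [^] m\<close> in \<open>K\<close>,
  then all conditions on c reduce to the single equation c^m = chi(g^m). Since g is not in
  \<open>K\<close>, m is at least 2, and a nonzero complex number has m distinct m-th roots, one of
  which differs from 1. That freedom is the source of nontrivial characters.\<close>

lemma character_value_exists:
  fixes G (structure)
  assumes "group G" and K: "subgroup K G" and \<chi>: "\<chi> \<in> hom (G\<lparr>carrier := K\<rparr>) cstar"
    and g: "g \<in> carrier G" "g \<notin> K" and fin: "finite (carrier G)"
  obtains c where "c \<noteq> 0" "c \<noteq> 1" "\<And>j::nat. g [^] j \<in> K \<Longrightarrow> \<chi> (g [^] j) = c ^ j"
proof -
  interpret group G by fact
  interpret K: subgroup K G by fact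
  have \<chi>m: "\<chi> (x \<otimes> y) = \<chi> x * \<chi> y" and \<chi>0: "\<chi> x \<noteq> 0" if "x \<in> K" "y \<in> K" for x y
    using \<chi> that by (auto simp: hom_def cstar_def)
  define m where "m = (LEAST m::nat. 0 < m \<and> g [^] m \<in> K)"
  have "0 < order G \<and> g [^] order G \<in> K"
    using g fin pow_order_eq_1 order_gt_0_iff_finite by simp
  then have m: "0 < m" "g [^] m \<in> K"
    unfolding m_def using LeastI[of "\<lambda>m::nat. 0 < m \<and> g [^] m \<in> K"] by blast+
  have least: "m \<le> j" if "0 < j" "g [^] j \<in> K" for j
    unfolding m_def using that by (intro Least_le) simp
  have "m \<noteq> 1" using m g by auto
  then have "card {z. z ^ m = \<chi> (g [^] m)} \<ge> 2"
    using card_nth_roots[of "\<chi> (g [^] m)" m] m \<chi>0 by auto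
  then have "\<not> {z. z ^ m = \<chi> (g [^] m)} \<subseteq> {1}"
    by (metis card_mono card.empty card_insert_disjoint finite.emptyI finite.insertI empty_iff
        One_nat_def Suc_1 not_less_eq_eq)
  then obtain c where c: "c ^ m = \<chi> (g [^] m)" "c \<noteq> 1" by blast
  have c0: "c \<noteq> 0" using c(1) m \<chi>0[OF m(2) m(2)] by (auto simp: power_0_left)
  have mult: "g [^] (m * q) \<in> K \<and> \<chi> (g [^] (m * q)) = c ^ (m * q)" for q
  proof (induction q)
    case 0
    then show ?case using \<chi>m[of \<one> \<one>] \<chi>0[of \<one> \<one>] by simp
  next
    case (Suc q)
    have "g [^] (m * Suc q) = g [^] m \<otimes> g [^] (m * q)"
      using g by (simp add: nat_pow_mult)
    then show ?case using Suc m c \<chi>m by (simp add: power_add)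
  qed
  \<comment> \<open>Division of \<open>j\<close> by \<open>m\<close> with remainder: the power of
    \<open>g\<close> with the remainder as exponent lies in \<open>K\<close> again, so minimality of
    \<open>m\<close> makes the remainder 0.\<close>
  have "\<chi> (g [^] j) = c ^ j" if "g [^] j \<in> K" for j
  proof -
    have "g [^] j = g [^] (m * (j div m)) \<otimes> g [^] (j mod m)"
      using g by (simp add: nat_pow_mult)
    then have "g [^] (j mod m) = inv (g [^] (m * (j div m))) \<otimes> g [^] j"
      using g by (simp flip: m_assoc)
    then have "g [^] (j mod m) \<in> K" using mult that by simp
    then have "j mod m = 0" using least[of "j mod m"] m by (metis mod_less_divisor not_le gr0I)
    then have "j = m * (j div m)" by auto
    then show ?thesis using mult by metis
  qed
  then show ?thesis using that c0 c by blast
qed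

text \<open>Start from the trivial subgroup, extend to a subgroup containing t with a value other
  than 1 at t, and take a maximal subgroup with such a character; finiteness replaces Zorn's lemma.
  An element outside it would allow a further extension that keeps the value at t.\<close>

lemma character_separates:
  fixes G (structure)
  assumes "comm_group G" and fin: "finite (carrier G)" and t: "t \<in> carrier G" "t \<noteq> \<one>"
  obtains \<chi> where "\<chi> \<in> hom G cstar" "\<chi> t \<noteq> 1"
proof -
  interpret comm_group G by fact
  define P where "P K \<longleftrightarrow> subgroup K G \<and> t \<in> K \<and>
    (\<exists>\<chi>\<in>hom (G\<lparr>carrier := K\<rparr>) cstar. \<chi> t \<noteq> 1)" for K
  have one: "subgroup {\<one>} G" "(\<lambda>_. 1) \<in> hom (G\<lparr>carrier := {\<one>}\<rparr>) cstar"
    by (auto simp: triv_subgroup hom_def cstar_def)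
  have "\<exists>c::complex. c \<noteq> 0 \<and> c \<noteq> 1 \<and> (\<forall>j::nat. t [^] j \<in> {\<one>} \<longrightarrow> 1 = c ^ j)"
    by (rule character_value_exists[OF is_group one t(1) _ fin]) (use t(2) in auto)
  then obtain c :: complex where c: "c \<noteq> 0" "c \<noteq> 1" "\<And>j::nat. t [^] j \<in> {\<one>} \<Longrightarrow> 1 = c ^ j"
    by blast
  obtain K1 where "P K1"
    using extend_character[OF assms(1) one t(1) c(1,3) fin] c(2) unfolding P_def by metis
  moreover have "finite {K. P K}"
    by (rule finite_subset[of _ "Pow (carrier G)"]) (auto simp: P_def fin dest: subgroup.subset)
  ultimately obtain K where K: "P K" and max: "\<And>K'. P K' \<Longrightarrow> K \<subseteq> K' \<Longrightarrow> K = K'"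
    using finite_has_maximal[of "{K. P K}"] by auto
  obtain \<chi> where \<chi>: "\<chi> \<in> hom (G\<lparr>carrier := K\<rparr>) cstar" "\<chi> t \<noteq> 1"
    and sub: "subgroup K G" and tK: "t \<in> K"
    using K unfolding P_def by blast
  have "g \<in> K" if g: "g \<in> carrier G" for g
  proof (rule ccontr)
    assume gK: "g \<notin> K"
    obtain c where c: "c \<noteq> 0" "\<And>j::nat. g [^] j \<in> K \<Longrightarrow> \<chi> (g [^] j) = c ^ j"
      using character_value_exists[OF is_group sub \<chi>(1) g gK fin] by blast
    obtain K' \<chi>' where "subgroup K' G" "K \<subseteq> K'" "g \<in> K'"
      "\<chi>' \<in> hom (G\<lparr>carrier := K'\<rparr>) cstar" "\<And>k. k \<in> K \<Longrightarrow> \<chi>' k = \<chi> k"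
      using extend_character[OF assms(1) sub \<chi>(1) g c fin] by blast
    then have "P K'" using \<chi>(2) tK unfolding P_def by (metis subsetD)
    then show False using max \<open>K \<subseteq> K'\<close> \<open>g \<in> K'\<close> gK by blast
  qed
  then have "K = carrier G" using subgroup.subset[OF sub] by blast
  then show ?thesis using that \<chi> by simp
qed

section \<open>Orthogonality relations and the order of the character group\<close>

lemma character_one:
  assumes "group G" "\<chi> \<in> hom G cstar"
  shows "\<chi> \<one>\<^bsub>G\<^esub> = 1"
proof -
  interpret group G by fact
  show ?thesis using hom_mult[OF assms(2), of "\<one>\<^bsub>G\<^esub>" "\<one>\<^bsub>G\<^esub>"] assms(2)
    by (auto simp: cstar_def hom_def)
qed

text \<open>By Lagrange all values are roots of unity of exponent \<open>order G\<close>, so the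
  characters lie in a finite function space.\<close>

lemma finite_char_group:
  assumes "group G" "finite (carrier G)"
  shows "finite (carrier (char_group G))"
proof -
  interpret group G by fact
  have "carrier (char_group G) \<subseteq> carrier G \<rightarrow>\<^sub>E {z. z ^ order G = 1}"
  proof
    fix \<chi> assume \<chi>: "\<chi> \<in> carrier (char_group G)"
    have "\<chi> g ^ order G = 1" if g: "g \<in> carrier G" for g
    proof -
      have "\<chi> (g [^]\<^bsub>G\<^esub> n) = \<chi> g ^ n" for n :: nat
      proof (induction n)
        case 0
        have "\<chi> \<one>\<^bsub>G\<^esub> = 1" using \<chi> character_one[OF assms(1)] by (simp add: char_group_def)
        then show ?case by simp
      next
        case (Suc n)
        have "\<chi> (g [^]\<^bsub>G\<^esub> n \<otimes>\<^bsub>G\<^esub> g) = \<chi> (g [^]\<^bsub>G\<^esub> n) * \<chi> g"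
          using \<chi> g by (auto simp: char_group_def cstar_def hom_def)
        then show ?case using Suc by simp
      qed
      then have "\<chi> g ^ order G = \<chi> \<one>\<^bsub>G\<^esub>" "\<chi> \<one>\<^bsub>G\<^esub> = 1"
        using pow_order_eq_1[OF g] by (metis, metis nat_pow_0 power_0)
      then show ?thesis by simp
    qed
    then show "\<chi> \<in> carrier G \<rightarrow>\<^sub>E {z. z ^ order G = 1}"
      using \<chi> by (auto simp: char_group_def PiE_def)
  qed
  moreover have "finite {z::complex. z ^ order G = 1}"
    using assms order_gt_0_iff_finite by (intro finite_roots_unity) auto
  ultimately show ?thesis
    by (meson assms finite_PiE finite_subset)
qed

lemma char_group_group:
  assumes "group G" shows "group (char_group G)"
proof -
  interpret group G by fact
  show ?thesis
  proof (rule groupI)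
    fix \<chi> assume \<chi>: "\<chi> \<in> carrier (char_group G)"
    have "(\<lambda>z\<in>carrier G. inverse (\<chi> z)) \<in> carrier (char_group G)"
      using \<chi> by (auto simp: char_group_def hom_def cstar_def)
    moreover have "(\<lambda>z\<in>carrier G. inverse (\<chi> z)) \<otimes>\<^bsub>char_group G\<^esub> \<chi> = \<one>\<^bsub>char_group G\<^esub>"
      using \<chi> by (auto simp: char_group_def hom_def cstar_def fun_eq_iff Pi_def)
    ultimately show "\<exists>\<theta>\<in>carrier (char_group G). \<theta> \<otimes>\<^bsub>char_group G\<^esub> \<chi> = \<one>\<^bsub>char_group G\<^esub>"
      by blast
  qed (auto simp: char_group_def hom_def cstar_def fun_eq_iff extensional_def)
qed

text \<open>Translating the summation variable by t multiplies the sum by chi(t).\<close>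

lemma sum_nontrivial_character:
  assumes "group G" "\<chi> \<in> hom G cstar" "t \<in> carrier G" "\<chi> t \<noteq> 1"
  shows "(\<Sum>z\<in>carrier G. \<chi> z) = 0"
proof -
  interpret group G by fact
  have "bij_betw (\<lambda>z. t \<otimes>\<^bsub>G\<^esub> z) (carrier G) (carrier G)"
    using assms(3) by (simp add: bij_betw_def inj_on_cmult surj_const_mult)
  then have "(\<Sum>z\<in>carrier G. \<chi> z) = (\<Sum>z\<in>carrier G. \<chi> (t \<otimes>\<^bsub>G\<^esub> z))"
    by (rule sum.reindex_bij_betw[symmetric])
  also have "\<dots> = \<chi> t * (\<Sum>z\<in>carrier G. \<chi> z)"
    using assms(2,3) by (auto simp: hom_def cstar_def sum_distrib_left intro!: sum.cong)
  finally show ?thesis using assms(4) by simp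
qed

text \<open>Evaluation at t is a character of the character group. A character separating t from the
  identity makes it nontrivial, so the previous lemma applies to the dual.\<close>

lemma sum_characters_nontrivial:
  assumes "comm_group G" "finite (carrier G)" "t \<in> carrier G" "t \<noteq> \<one>\<^bsub>G\<^esub>"
  shows "(\<Sum>\<chi>\<in>carrier (char_group G). \<chi> t) = 0"
proof -
  interpret comm_group G by fact
  obtain \<theta> where \<theta>: "\<theta> \<in> hom G cstar" "\<theta> t \<noteq> 1"
    using character_separates[OF assms] .
  show ?thesis
  proof (rule sum_nontrivial_character[OF char_group_group])
    show "(\<lambda>\<chi>. \<chi> t) \<in> hom (char_group G) cstar"
      using assms(3) by (auto simp: char_group_def hom_def cstar_def)
    show "restrict \<theta> (carrier G) \<in> carrier (char_group G)"
      using \<theta> by (auto simp: char_group_def hom_def)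
    show "restrict \<theta> (carrier G) t \<noteq> 1" using \<theta> assms(3) by simp
  qed (rule is_group)
qed

lemma character_orthogonality:
  assumes "group G" "\<chi> \<in> carrier (char_group G)" "\<theta> \<in> carrier (char_group G)" "\<chi> \<noteq> \<theta>"
  shows "(\<Sum>z\<in>carrier G. \<chi> z / \<theta> z) = 0"
proof -
  obtain t where t: "t \<in> carrier G" "\<chi> t \<noteq> \<theta> t"
    using assms(2-4) by (auto simp: char_group_def intro: extensionalityI)
  show ?thesis
  proof (rule sum_nontrivial_character[OF assms(1) _ t(1)])
    show "(\<lambda>z. \<chi> z / \<theta> z) \<in> hom G cstar" "\<chi> t / \<theta> t \<noteq> 1"
      using assms(2,3) t by (auto simp: char_group_def hom_def cstar_def divide_eq_eq_1)
  qed
qed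

text \<open>The double sum of chi(z) over all chi and z is evaluated in both orders: only z = 1
  contributes in one order, only the trivial character \<open>?e\<close> in the other.\<close>

lemma card_char_group:
  assumes "comm_group G" "finite (carrier G)"
  shows "card (carrier (char_group G)) = card (carrier G)"
proof -
  interpret comm_group G by fact
  let ?X = "carrier (char_group G)" and ?e = "\<lambda>z\<in>carrier G. 1::complex"
  have fin: "finite ?X" using finite_char_group is_group assms(2) by blast
  have e: "?e \<in> ?X" by (auto simp: char_group_def hom_def cstar_def)
  have "of_nat (card ?X) = (\<Sum>z\<in>carrier G. if z = \<one>\<^bsub>G\<^esub> then of_nat (card ?X) else 0 :: complex)"
    using assms(2) by simp
  also have "\<dots> = (\<Sum>z\<in>carrier G. \<Sum>\<chi>\<in>?X. \<chi> z)"
  proof (intro sum.cong refl)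
    fix z assume "z \<in> carrier G"
    moreover have "(\<Sum>\<chi>\<in>?X. \<chi> \<one>\<^bsub>G\<^esub>) = (\<Sum>\<chi>\<in>?X. 1)"
      using character_one[OF is_group] by (intro sum.cong) (auto simp: char_group_def)
    ultimately show "(if z = \<one>\<^bsub>G\<^esub> then of_nat (card ?X) else 0) = (\<Sum>\<chi>\<in>?X. \<chi> z)"
      using sum_characters_nontrivial[OF assms] by simp
  qed
  also have "\<dots> = (\<Sum>\<chi>\<in>?X. \<Sum>z\<in>carrier G. \<chi> z)" by (rule sum.swap)
  also have "\<dots> = (\<Sum>\<chi>\<in>?X. if \<chi> = ?e then of_nat (card (carrier G)) else 0)"
  proof (intro sum.cong refl)
    fix \<chi> assume \<chi>: "\<chi> \<in> ?X"
    have "(\<Sum>z\<in>carrier G. \<chi> z / ?e z) = (\<Sum>z\<in>carrier G. \<chi> z)" by (intro sum.cong) auto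
    then show "(\<Sum>z\<in>carrier G. \<chi> z) = (if \<chi> = ?e then of_nat (card (carrier G)) else 0)"
      using character_orthogonality[OF is_group \<chi> e] by auto
  qed
  also have "\<dots> = of_nat (card (carrier G))" using fin e by simp
  finally show ?thesis by (simp only: of_nat_eq_iff)
qed

section \<open>Cohomologous cocycles\<close>

text \<open>This says that \<alpha> is the coboundary of \<open>f\<close> times \<beta>, written
  without division. Only values on the carrier enter, so it also applies to non-extensional cochains
  such as pointwise products.\<close>

definition cohomologous ::
  "('a, 'm) monoid_scheme \<Rightarrow> ('a \<times> 'a \<Rightarrow> complex) \<Rightarrow> ('a \<times> 'a \<Rightarrow> complex) \<Rightarrow> bool" where
  "cohomologous G \<alpha> \<beta> \<longleftrightarrow> (\<exists>f. (\<forall>g\<in>carrier G. f g \<noteq> 0) \<and>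
     (\<forall>g\<in>carrier G. \<forall>h\<in>carrier G. f g * f h * \<beta> (g, h) = f (g \<otimes>\<^bsub>G\<^esub> h) * \<alpha> (g, h)))"

lemma cohomologousI:
  assumes "\<And>g. g \<in> carrier G \<Longrightarrow> f g \<noteq> 0"
    and "\<And>g h. g \<in> carrier G \<Longrightarrow> h \<in> carrier G \<Longrightarrow> f g * f h * \<beta> (g, h) = f (g \<otimes>\<^bsub>G\<^esub> h) * \<alpha> (g, h)"
  shows "cohomologous G \<alpha> \<beta>"
  unfolding cohomologous_def using assms by blast

lemma cohomologousE:
  assumes "cohomologous G \<alpha> \<beta>"
  obtains f where "\<And>g. g \<in> carrier G \<Longrightarrow> f g \<noteq> 0"
    and "\<And>g h. g \<in> carrier G \<Longrightarrow> h \<in> carrier G \<Longrightarrow> f g * f h * \<beta> (g, h) = f (g \<otimes>\<^bsub>G\<^esub> h) * \<alpha> (g, h)"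
  using assms unfolding cohomologous_def by blast

lemma Z2_nonzero: "\<alpha> \<in> carrier (Z2 G) \<Longrightarrow> g \<in> carrier G \<Longrightarrow> h \<in> carrier G \<Longrightarrow> \<alpha> (g, h) \<noteq> 0"
  by (auto simp: Z2_def cstar_def PiE_def Pi_def)

lemma Z2_cocycle:
  "\<alpha> \<in> carrier (Z2 G) \<Longrightarrow> g \<in> carrier G \<Longrightarrow> h \<in> carrier G \<Longrightarrow> k \<in> carrier G \<Longrightarrow>
    \<alpha> (g, h) * \<alpha> (g \<otimes>\<^bsub>G\<^esub> h, k) = \<alpha> (g, h \<otimes>\<^bsub>G\<^esub> k) * \<alpha> (h, k)"
  by (auto simp: Z2_def)

lemma Z2_restrictI:
  assumes "group G"
    and "\<And>g h. g \<in> carrier G \<Longrightarrow> h \<in> carrier G \<Longrightarrow> \<alpha> (g, h) \<noteq> 0"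
    and "\<And>g h k. g \<in> carrier G \<Longrightarrow> h \<in> carrier G \<Longrightarrow> k \<in> carrier G \<Longrightarrow>
      \<alpha> (g, h) * \<alpha> (g \<otimes>\<^bsub>G\<^esub> h, k) = \<alpha> (g, h \<otimes>\<^bsub>G\<^esub> k) * \<alpha> (h, k)"
  shows "restrict \<alpha> (carrier G \<times> carrier G) \<in> carrier (Z2 G)"
proof -
  interpret group G by fact
  show ?thesis using assms(2,3) by (auto simp: Z2_def cstar_def)
qed

lemma Z2_mult_apply:
  "g \<in> carrier G \<Longrightarrow> h \<in> carrier G \<Longrightarrow> (\<alpha> \<otimes>\<^bsub>Z2 G\<^esub> \<beta>) (g, h) = \<alpha> (g, h) * \<beta> (g, h)"
  by (simp add: Z2_def)

text \<open>This replaces normalization: it is the cocycle identity at (1, 1, g) after cancelling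
  the value at (1, g).\<close>

lemma Z2_one_left:
  assumes "group G" "\<alpha> \<in> carrier (Z2 G)" "g \<in> carrier G"
  shows "\<alpha> (\<one>\<^bsub>G\<^esub>, g) = \<alpha> (\<one>\<^bsub>G\<^esub>, \<one>\<^bsub>G\<^esub>)"
proof -
  interpret group G by fact
  show ?thesis
    using Z2_cocycle[OF assms(2), of "\<one>\<^bsub>G\<^esub>" "\<one>\<^bsub>G\<^esub>" g] Z2_nonzero[OF assms(2), of "\<one>\<^bsub>G\<^esub>" g] assms(3)
    by simp
qed

lemma mem_H2_class:
  assumes "group G" "\<alpha> \<in> carrier (Z2 G)"
  shows "\<beta> \<in> H2_class G \<alpha> \<longleftrightarrow> \<beta> \<in> carrier (Z2 G) \<and> cohomologous G \<beta> \<alpha>"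
proof -
  interpret group G by fact
  interpret Z: comm_group "Z2 G" by (rule Z2_comm_group) fact
  show ?thesis
  proof
    assume "\<beta> \<in> H2_class G \<alpha>"
    then obtain f where f: "f \<in> carrier G \<rightarrow> carrier cstar" "\<beta> = coboundary G f \<otimes>\<^bsub>Z2 G\<^esub> \<alpha>"
      unfolding H2_class_def r_coset_def B2_def by blast
    have "cohomologous G \<beta> \<alpha>"
      using f by (intro cohomologousI[of _ f]) (auto simp: Z2_mult_apply coboundary_def cstar_def Pi_def)
    then show "\<beta> \<in> carrier (Z2 G) \<and> cohomologous G \<beta> \<alpha>"
      using f coboundary_Z2[OF assms(1) f(1)] assms(2) by simp
  next
    assume \<beta>: "\<beta> \<in> carrier (Z2 G) \<and> cohomologous G \<beta> \<alpha>"
    obtain f where f: "\<And>g. g \<in> carrier G \<Longrightarrow> f g \<noteq> 0"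
      "\<And>g h. g \<in> carrier G \<Longrightarrow> h \<in> carrier G \<Longrightarrow> f g * f h * \<alpha> (g, h) = f (g \<otimes>\<^bsub>G\<^esub> h) * \<beta> (g, h)"
      by (rule cohomologousE[OF conjunct2[OF \<beta>]]) blast
    have "\<beta> = coboundary G f \<otimes>\<^bsub>Z2 G\<^esub> \<alpha>"
    proof (rule extensionalityI)
      show "\<beta> \<in> extensional (carrier G \<times> carrier G)"
        "coboundary G f \<otimes>\<^bsub>Z2 G\<^esub> \<alpha> \<in> extensional (carrier G \<times> carrier G)"
        using \<beta> by (auto simp: Z2_def PiE_def)
      show "\<beta> p = (coboundary G f \<otimes>\<^bsub>Z2 G\<^esub> \<alpha>) p" if "p \<in> carrier G \<times> carrier G" for p
        using that f(1)[OF m_closed] f(2) by (auto simp: Z2_def coboundary_def)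
    qed
    moreover have "f \<in> carrier G \<rightarrow> carrier cstar" using f(1) by (auto simp: cstar_def)
    ultimately show "\<beta> \<in> H2_class G \<alpha>"
      unfolding H2_class_def r_coset_def B2_def by blast
  qed
qed

lemma H2_class_self:
  assumes "group G" "\<alpha> \<in> carrier (Z2 G)"
  shows "\<alpha> \<in> H2_class G \<alpha>"
  using mem_H2_class[OF assms] assms(2) by (auto intro!: cohomologousI[of _ "\<lambda>_. 1"])

lemma H2_class_eq_iff:
  assumes "group G" "\<alpha> \<in> carrier (Z2 G)" "\<beta> \<in> carrier (Z2 G)"
  shows "H2_class G \<alpha> = H2_class G \<beta> \<longleftrightarrow> cohomologous G \<alpha> \<beta>"
proof -
  interpret Z: comm_group "Z2 G" by (rule Z2_comm_group) fact
  have "H2_class G \<alpha> = H2_class G \<beta>" if "\<alpha> \<in> H2_class G \<beta>"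
    using Z.repr_independence[OF that[unfolded H2_class_def] assms(3) B2_subgroup[OF assms(1)]]
    by (simp add: H2_class_def)
  then show ?thesis
    using H2_class_self[OF assms(1,2)] mem_H2_class[OF assms(1,3)] assms(2) by auto
qed

lemma carrier_H2: "carrier (H2 G) = H2_class G ` carrier (Z2 G)"
  by (auto simp: H2_def FactGroup_def RCOSETS_def H2_class_def)

lemma H2_class_hom:
  assumes "group G" shows "H2_class G \<in> hom (Z2 G) (H2 G)"
proof -
  interpret Z: comm_group "Z2 G" by (rule Z2_comm_group) fact
  have "B2 G \<lhd> Z2 G" by (rule Z.subgroup_imp_normal[OF B2_subgroup[OF assms]])
  then show ?thesis
    unfolding H2_class_def H2_def by (rule normal.r_coset_hom_Mod)
qed

lemma pullback_cochain_apply [simp]: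
  "g \<in> carrier K \<Longrightarrow> h \<in> carrier K \<Longrightarrow> pullback_cochain K f \<alpha> (g, h) = \<alpha> (f g, f h)"
  by (simp add: pullback_cochain_def)

lemma H2_class_pullback_hom:
  assumes "group K" "group G" "f \<in> hom K G"
  shows "(\<lambda>\<alpha>. H2_class K (pullback_cochain K f \<alpha>)) \<in> hom (Z2 G) (H2 K)"
proof -
  have "pullback_cochain K f \<in> hom (Z2 G) (Z2 K)"
  proof (rule homI)
    fix \<alpha> \<beta> assume "\<alpha> \<in> carrier (Z2 G)" "\<beta> \<in> carrier (Z2 G)"
    show "pullback_cochain K f (\<alpha> \<otimes>\<^bsub>Z2 G\<^esub> \<beta>) =
        pullback_cochain K f \<alpha> \<otimes>\<^bsub>Z2 K\<^esub> pullback_cochain K f \<beta>"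
      using hom_in_carrier[OF assms(3)] by (auto simp: pullback_cochain_def Z2_def fun_eq_iff)
  qed (rule H2_pullback_class[OF assms])
  then have "H2_class K \<circ> pullback_cochain K f \<in> hom (Z2 G) (H2 K)"
    using H2_class_hom[OF assms(1)] by (rule hom_compose)
  then show ?thesis by (simp add: comp_def)
qed

text \<open>Both targets are the same quotient of \<open>A\<close>. It will be used with
  \<open>A\<close> the cocycles on the common quotient, so that the classes of two groups are
  compared through cocycles rather than through classes.\<close>

lemma iso_of_epis_same_kernel:
  assumes "p \<in> hom A B" "p ` carrier A = carrier B" "q \<in> hom A C" "q ` carrier A = carrier C"
    and "group A" and eq: "\<And>x y. x \<in> carrier A \<Longrightarrow> y \<in> carrier A \<Longrightarrow> p x = p y \<longleftrightarrow> q x = q y"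
  obtains \<psi> where "\<psi> \<in> iso B C" "\<And>x. x \<in> carrier A \<Longrightarrow> \<psi> (p x) = q x"
proof -
  interpret group A by fact
  define \<psi> where "\<psi> b = q (inv_into (carrier A) p b)" for b
  have \<psi>: "\<psi> (p x) = q x" if "x \<in> carrier A" for x
    unfolding \<psi>_def using that eq by (metis f_inv_into_f image_eqI inv_into_into)
  have "\<psi> \<in> hom B C"
  proof (rule homI)
    show "\<psi> x \<in> carrier C" if "x \<in> carrier B" for x
      using that \<psi> unfolding assms(2,4)[symmetric] by auto
    show "\<psi> (x \<otimes>\<^bsub>B\<^esub> y) = \<psi> x \<otimes>\<^bsub>C\<^esub> \<psi> y" if xy: "x \<in> carrier B" "y \<in> carrier B" for x y
    proof -
      obtain a b where "x = p a" "y = p b" "a \<in> carrier A" "b \<in> carrier A"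
        using xy assms(2) by blast
      then show ?thesis
        by (simp add: \<psi> hom_mult[OF assms(3)] flip: hom_mult[OF assms(1)])
    qed
  qed
  moreover have "inj_on \<psi> (carrier B)"
    unfolding assms(2)[symmetric] by (rule inj_onI) (use \<psi> eq in auto)
  moreover have "\<psi> ` carrier B = carrier C"
    unfolding assms(2)[symmetric] assms(4)[symmetric] image_image using \<psi> by simp
  ultimately show ?thesis using that \<psi> by (simp add: iso_def bij_betw_def)
qed

section \<open>Isomorphisms of twisted group algebras\<close>

lemma twisted_group_algebra_closed:
  assumes "u \<in> carrier (twisted_group_algebra G \<alpha>)" "v \<in> carrier (twisted_group_algebra G \<alpha>)"
  shows "u \<otimes>\<^bsub>twisted_group_algebra G \<alpha>\<^esub> v \<in> carrier (twisted_group_algebra G \<alpha>)"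
    and "u \<oplus>\<^bsub>twisted_group_algebra G \<alpha>\<^esub> v \<in> carrier (twisted_group_algebra G \<alpha>)"
    and "c \<odot>\<^bsub>twisted_group_algebra G \<alpha>\<^esub> u \<in> carrier (twisted_group_algebra G \<alpha>)"
    and "\<one>\<^bsub>twisted_group_algebra G \<alpha>\<^esub> \<in> carrier (twisted_group_algebra G \<alpha>)"
  using assms by (auto simp: twisted_group_algebra_def)

text \<open>The isomorphism is f followed by the inverse of g. Each identity is verified after
  applying g, which is injective on the carrier of \<open>B\<close>; thus no ring axioms for
  \<open>D\<close> enter.\<close>

lemma algebra_iso_common_target:
  fixes G :: "('a, 'm) monoid_scheme" and \<alpha> :: "'a \<times> 'a \<Rightarrow> complex"
  defines "A \<equiv> twisted_group_algebra G \<alpha>"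
  assumes f: "f \<in> algebra_iso A D" and g: "g \<in> algebra_iso B D"
    and B: "B = twisted_group_algebra H \<beta>"
  shows "algebra_iso A B \<noteq> {}"
proof -
  note A = twisted_group_algebra_closed[of _ G \<alpha>, folded A_def]
  note Bc = twisted_group_algebra_closed[of _ H \<beta>, folded B]
  have fb: "bij_betw f (carrier A) (carrier D)" and gb: "bij_betw g (carrier B) (carrier D)"
    using f g by (auto simp: algebra_iso_def ring_iso_def)
  define k where "k = inv_into (carrier B) g \<circ> f"
  have kb: "bij_betw k (carrier A) (carrier B)"
    unfolding k_def using fb bij_betw_inv_into[OF gb] by (rule bij_betw_trans)
  have gk: "g (k x) = f x" if "x \<in> carrier A" for x
    using that fb gb unfolding k_def comp_def by (intro f_inv_into_f[of _ g "carrier B"]) (auto simp: bij_betw_def)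
  have kc: "k x \<in> carrier B" if "x \<in> carrier A" for x
    using kb that by (auto simp: bij_betw_def)
  have gi: "x = y" if "g x = g y" "x \<in> carrier B" "y \<in> carrier B" for x y
    using gb that by (auto simp: bij_betw_def inj_on_def)
  have fm: "f (x \<otimes>\<^bsub>A\<^esub> y) = f x \<otimes>\<^bsub>D\<^esub> f y" "f (x \<oplus>\<^bsub>A\<^esub> y) = f x \<oplus>\<^bsub>D\<^esub> f y"
      "f (c \<odot>\<^bsub>A\<^esub> x) = c \<odot>\<^bsub>D\<^esub> f x" "f \<one>\<^bsub>A\<^esub> = \<one>\<^bsub>D\<^esub>"
    if "x \<in> carrier A" "y \<in> carrier A" for x y c
    using f that by (auto simp: algebra_iso_def ring_iso_def ring_hom_def)
  have gm: "g (x \<otimes>\<^bsub>B\<^esub> y) = g x \<otimes>\<^bsub>D\<^esub> g y" "g (x \<oplus>\<^bsub>B\<^esub> y) = g x \<oplus>\<^bsub>D\<^esub> g y"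
      "g (c \<odot>\<^bsub>B\<^esub> x) = c \<odot>\<^bsub>D\<^esub> g x" "g \<one>\<^bsub>B\<^esub> = \<one>\<^bsub>D\<^esub>"
    if "x \<in> carrier B" "y \<in> carrier B" for x y c
    using g that by (auto simp: algebra_iso_def ring_iso_def ring_hom_def)
  have "k (x \<otimes>\<^bsub>A\<^esub> y) = k x \<otimes>\<^bsub>B\<^esub> k y" if "x \<in> carrier A" "y \<in> carrier A" for x y
    using that by (intro gi) (simp_all add: gk kc A Bc fm gm)
  moreover have "k (x \<oplus>\<^bsub>A\<^esub> y) = k x \<oplus>\<^bsub>B\<^esub> k y" if "x \<in> carrier A" "y \<in> carrier A" for x y
    using that by (intro gi) (simp_all add: gk kc A Bc fm gm)
  moreover have "k (c \<odot>\<^bsub>A\<^esub> x) = c \<odot>\<^bsub>B\<^esub> k x" if "x \<in> carrier A" for c x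
    using that by (intro gi) (simp_all add: gk kc A(3)[OF that that] Bc(3)[OF kc kc] fm(3)[OF that that] gm(3)[OF kc kc])
  moreover have "\<one>\<^bsub>A\<^esub> \<in> carrier A" "\<one>\<^bsub>B\<^esub> \<in> carrier B"
    by (simp_all add: A_def B twisted_group_algebra_def)
  then have "k \<one>\<^bsub>A\<^esub> = \<one>\<^bsub>B\<^esub>"
    by (intro gi) (simp_all add: gk kc fm(4) gm(4))
  ultimately have "k \<in> algebra_iso A B"
    using kb kc by (auto simp: algebra_iso_def ring_iso_def ring_hom_def)
  then show ?thesis by blast
qed

text \<open>The direct sum over \<open>I\<close> of the twisted group algebras of \<open>Q\<close>
  at \<open>b \<chi>\<close>. All components are packed into one function on
  \<open>I \<times> carrier Q\<close>, which gives the sum a type that does not depend on the group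
  being decomposed.\<close>

definition twisted_sum_algebra ::
  "'x set \<Rightarrow> ('q, 'm) monoid_scheme \<Rightarrow> ('x \<Rightarrow> 'q \<times> 'q \<Rightarrow> complex)
    \<Rightarrow> (complex, 'x \<times> 'q \<Rightarrow> complex) module" where
  "twisted_sum_algebra I Q b =
    \<lparr>carrier = I \<times> carrier Q \<rightarrow>\<^sub>E UNIV,
     monoid.mult = (\<lambda>u v. \<lambda>(\<chi>, x)\<in>I \<times> carrier Q.
        \<Sum>(y, z)\<in>{(y, z) \<in> carrier Q \<times> carrier Q. y \<otimes>\<^bsub>Q\<^esub> z = x}. u (\<chi>, y) * v (\<chi>, z) * b \<chi> (y, z)),
     one = (\<lambda>(\<chi>, x)\<in>I \<times> carrier Q. if x = \<one>\<^bsub>Q\<^esub> then inverse (b \<chi> (\<one>\<^bsub>Q\<^esub>, \<one>\<^bsub>Q\<^esub>)) else 0),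
     ring.zero = (\<lambda>p\<in>I \<times> carrier Q. 0),
     ring.add = (\<lambda>u v. \<lambda>p\<in>I \<times> carrier Q. u p + v p),
     module.smult = (\<lambda>c u. \<lambda>p\<in>I \<times> carrier Q. c * u p)\<rparr>"

section \<open>Covers split by a complete family of cocycles\<close>

text \<open>Modelled on a central extension \<open>1 \<rightarrow> Z \<rightarrow> G \<rightarrow> Q \<rightarrow> 1\<close>: the index set \<open>I\<close> is the
  character group of \<open>Z\<close>, \<open>a \<chi>\<close> represents the transgression of \<open>\<chi>\<close>, and \<open>C \<chi>\<close> extends \<open>\<chi>\<close> to
  a function on \<open>G\<close> trivializing the inflation of \<open>a \<chi>\<close>.  Sections and characters are kept out of
  the axioms because in this form they are visibly stable under direct products.\<close>

locale split_cover = G: group G + Q: group Q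
  for G :: "('a, 'm) monoid_scheme" and Q :: "('q, 'n) monoid_scheme" +
  fixes \<pi> :: "'a \<Rightarrow> 'q" and I :: "'x set"
    and a :: "'x \<Rightarrow> 'q \<times> 'q \<Rightarrow> complex" and C :: "'x \<Rightarrow> 'a \<Rightarrow> complex"
  assumes finite_carrier: "finite (carrier G)"
    and hom: "\<pi> \<in> hom G Q"
    and surj: "\<pi> ` carrier G = carrier Q"
    and finite_index: "finite I"
    and cocycle: "\<chi> \<in> I \<Longrightarrow> a \<chi> \<in> carrier (Z2 Q)"
    and nonzero: "\<chi> \<in> I \<Longrightarrow> g \<in> carrier G \<Longrightarrow> C \<chi> g \<noteq> 0"
    and split: "\<chi> \<in> I \<Longrightarrow> g \<in> carrier G \<Longrightarrow> h \<in> carrier G \<Longrightarrow>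
      C \<chi> g * C \<chi> h * a \<chi> (\<pi> g, \<pi> h) = C \<chi> (g \<otimes>\<^bsub>G\<^esub> h)"
    and separation: "g \<in> carrier G \<Longrightarrow> h \<in> carrier G \<Longrightarrow> \<pi> g = \<pi> h \<Longrightarrow> g \<noteq> h \<Longrightarrow>
      (\<Sum>\<chi>\<in>I. C \<chi> g / C \<chi> h) = 0"
    and orthogonality: "\<chi> \<in> I \<Longrightarrow> \<theta> \<in> I \<Longrightarrow> \<chi> \<noteq> \<theta> \<Longrightarrow> x \<in> carrier Q \<Longrightarrow>
      (\<Sum>g\<in>{g \<in> carrier G. \<pi> g = x}. C \<chi> g / C \<theta> g) = 0"
    and card_fibre: "x \<in> carrier Q \<Longrightarrow> card {g \<in> carrier G. \<pi> g = x} = card I"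
    and inflation_surj: "\<gamma> \<in> carrier (Z2 G) \<Longrightarrow>
      \<exists>\<alpha>\<in>carrier (Z2 Q). cohomologous G \<gamma> (pullback_cochain G \<pi> \<alpha>)"
    and hom_cstar_const: "\<eta> \<in> hom G cstar \<Longrightarrow> g \<in> carrier G \<Longrightarrow> h \<in> carrier G \<Longrightarrow> \<pi> g = \<pi> h \<Longrightarrow>
      \<eta> g = \<eta> h"
begin

section \<open>Cocycles on the quotient with cohomologous inflations\<close>

lemma \<pi>_closed [simp]: "g \<in> carrier G \<Longrightarrow> \<pi> g \<in> carrier Q"
  using surj by blast

lemma \<pi>_mult [simp]: "g \<in> carrier G \<Longrightarrow> h \<in> carrier G \<Longrightarrow> \<pi> (g \<otimes>\<^bsub>G\<^esub> h) = \<pi> g \<otimes>\<^bsub>Q\<^esub> \<pi> h"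
  using hom by (rule hom_mult)

lemma \<pi>_one [simp]: "\<pi> \<one>\<^bsub>G\<^esub> = \<one>\<^bsub>Q\<^esub>"
  using hom_one[OF hom G.is_group Q.is_group] .

lemma separation_sum:
  assumes "g \<in> carrier G" "h \<in> carrier G" "\<pi> g = \<pi> h"
  shows "(\<Sum>\<chi>\<in>I. C \<chi> g / C \<chi> h) = (if g = h then of_nat (card I) else 0)"
  using separation[OF assms] nonzero assms(2) by auto

lemma orthogonality_sum:
  assumes "\<chi> \<in> I" "\<theta> \<in> I" "x \<in> carrier Q"
  shows "(\<Sum>g\<in>{g \<in> carrier G. \<pi> g = x}. C \<chi> g / C \<theta> g) = (if \<chi> = \<theta> then of_nat (card I) else 0)"
proof (cases "\<chi> = \<theta>")
  case True
  then have "(\<Sum>g\<in>{g \<in> carrier G. \<pi> g = x}. C \<chi> g / C \<theta> g) = (\<Sum>g\<in>{g \<in> carrier G. \<pi> g = x}. 1)"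
    using nonzero assms(2) by (intro sum.cong) auto
  then show ?thesis using True card_fibre[OF assms(3)] by simp
qed (use orthogonality assms in simp)

lemma index_nonempty: "card I > 0"
proof -
  let ?Z = "{g \<in> carrier G. \<pi> g = \<one>\<^bsub>Q\<^esub>}"
  have "\<one>\<^bsub>G\<^esub> \<in> ?Z" "finite ?Z" using finite_carrier by simp_all
  then have "card ?Z > 0" using card_gt_0_iff by blast
  then show ?thesis using card_fibre[OF Q.one_closed] by simp
qed

text \<open>If \<open>D\<close> trivializes the inflation of \<open>\<alpha> / \<beta>\<close>, then some \<open>C \<chi>\<close> is not orthogonal to \<open>D\<close> on
  the kernel of \<open>\<pi>\<close>; translating the sum by an element of the kernel shows that \<open>D / C \<chi>\<close> is
  constant on fibres.\<close>

lemma cohomologous_pullback_iff: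
  assumes \<alpha>: "\<alpha> \<in> carrier (Z2 Q)" and \<beta>: "\<beta> \<in> carrier (Z2 Q)"
  shows "cohomologous G (pullback_cochain G \<pi> \<alpha>) (pullback_cochain G \<pi> \<beta>) \<longleftrightarrow>
    (\<exists>\<chi>\<in>I. cohomologous Q (\<lambda>p. \<alpha> p * a \<chi> p) \<beta>)"
proof
  assume "cohomologous G (pullback_cochain G \<pi> \<alpha>) (pullback_cochain G \<pi> \<beta>)"
  then obtain D where D0: "\<And>g. g \<in> carrier G \<Longrightarrow> D g \<noteq> 0"
    and "\<And>g h. g \<in> carrier G \<Longrightarrow> h \<in> carrier G \<Longrightarrow>
      D g * D h * pullback_cochain G \<pi> \<beta> (g, h) = D (g \<otimes>\<^bsub>G\<^esub> h) * pullback_cochain G \<pi> \<alpha> (g, h)"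
    by (rule cohomologousE) blast
  then have D: "D g * D h * \<beta> (\<pi> g, \<pi> h) = D (g \<otimes>\<^bsub>G\<^esub> h) * \<alpha> (\<pi> g, \<pi> h)"
    if "g \<in> carrier G" "h \<in> carrier G" for g h using that by simp
  let ?Z = "{g \<in> carrier G. \<pi> g = \<one>\<^bsub>Q\<^esub>}"
  have finZ: "finite ?Z" using finite_carrier by simp
  \<comment> \<open>Fourier inversion at the identity: weighting the coefficients of
    \<open>D\<close> with \<open>C \<chi>\<close> at 1 and summing over \<chi> recovers
    \<open>card I\<close> times the nonzero value of \<open>D\<close> at 1, so not all coefficients
    vanish.\<close>
  have "\<exists>\<chi>\<in>I. (\<Sum>z\<in>?Z. D z / C \<chi> z) \<noteq> 0"
  proof (rule ccontr)
    assume neg: "\<not> (\<exists>\<chi>\<in>I. (\<Sum>z\<in>?Z. D z / C \<chi> z) \<noteq> 0)"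
    have "0 = (\<Sum>\<chi>\<in>I. C \<chi> \<one>\<^bsub>G\<^esub> * (\<Sum>z\<in>?Z. D z / C \<chi> z))" using neg by simp
    also have "\<dots> = (\<Sum>\<chi>\<in>I. \<Sum>z\<in>?Z. D z * (C \<chi> \<one>\<^bsub>G\<^esub> / C \<chi> z))"
      by (simp add: sum_distrib_left mult.left_commute mult.commute)
    also have "\<dots> = (\<Sum>z\<in>?Z. D z * (\<Sum>\<chi>\<in>I. C \<chi> \<one>\<^bsub>G\<^esub> / C \<chi> z))"
      unfolding sum_distrib_left by (rule sum.swap)
    also have "\<dots> = (\<Sum>z\<in>?Z. if z = \<one>\<^bsub>G\<^esub> then D z * of_nat (card I) else 0)"
    proof (intro sum.cong refl)
      fix z assume "z \<in> ?Z"
      then show "D z * (\<Sum>\<chi>\<in>I. C \<chi> \<one>\<^bsub>G\<^esub> / C \<chi> z) = (if z = \<one>\<^bsub>G\<^esub> then D z * of_nat (card I) else 0)"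
        using separation_sum[of "\<one>\<^bsub>G\<^esub>" z] by auto
    qed
    also have "\<dots> = D \<one>\<^bsub>G\<^esub> * of_nat (card I)"
      using finZ by (subst sum.delta) auto
    finally show False using D0 index_nonempty by simp
  qed
  then obtain \<chi> where \<chi>: "\<chi> \<in> I" "(\<Sum>z\<in>?Z. D z / C \<chi> z) \<noteq> 0" by blast
  define r where "r g = D g / C \<chi> g" for g
  \<comment> \<open>The factor relating r(zg) to r(z) r(g) for z in the kernel. It does not depend
    on g because an unnormalized cocycle takes the same value at (1, x) for every x.\<close>
  define \<kappa> where "\<kappa> = \<beta> (\<one>\<^bsub>Q\<^esub>, \<one>\<^bsub>Q\<^esub>) / \<alpha> (\<one>\<^bsub>Q\<^esub>, \<one>\<^bsub>Q\<^esub>) / a \<chi> (\<one>\<^bsub>Q\<^esub>, \<one>\<^bsub>Q\<^esub>)"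
  note a = cocycle[OF \<chi>(1)]
  have r0: "r g \<noteq> 0" if "g \<in> carrier G" for g
    using that D0 nonzero \<chi>(1) by (simp add: r_def)
  have rm: "r g * r h * \<beta> (\<pi> g, \<pi> h) = r (g \<otimes>\<^bsub>G\<^esub> h) * (\<alpha> (\<pi> g, \<pi> h) * a \<chi> (\<pi> g, \<pi> h))"
    if "g \<in> carrier G" "h \<in> carrier G" for g h
  proof -
    have "r g * r h * \<beta> (\<pi> g, \<pi> h) = D (g \<otimes>\<^bsub>G\<^esub> h) * \<alpha> (\<pi> g, \<pi> h) / (C \<chi> g * C \<chi> h)"
      using D[OF that] by (simp add: r_def)
    also have "C \<chi> g * C \<chi> h = C \<chi> (g \<otimes>\<^bsub>G\<^esub> h) / a \<chi> (\<pi> g, \<pi> h)"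
      using split[OF \<chi>(1) that] Z2_nonzero[OF a, of "\<pi> g" "\<pi> h"] that by (simp add: field_simps)
    finally show ?thesis by (simp add: r_def)
  qed
  have rz: "r (z \<otimes>\<^bsub>G\<^esub> g) = \<kappa> * r z * r g" if z: "z \<in> ?Z" and g: "g \<in> carrier G" for z g
    using rm[of z g] z g Z2_one_left[OF Q.is_group \<alpha>, of "\<pi> g"] Z2_one_left[OF Q.is_group \<beta>, of "\<pi> g"]
      Z2_one_left[OF Q.is_group a, of "\<pi> g"] Z2_nonzero[OF \<alpha>, of "\<one>\<^bsub>Q\<^esub>" "\<one>\<^bsub>Q\<^esub>"]
      Z2_nonzero[OF a, of "\<one>\<^bsub>Q\<^esub>" "\<one>\<^bsub>Q\<^esub>"]
    by (simp add: \<kappa>_def field_simps)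
  \<comment> \<open>Translating by \<open>w\<close> multiplies the sum of \<open>r\<close> over the
    kernel by \<open>\<kappa> * r w\<close>. The sum is nonzero by the choice of \<chi>, so this
    factor is 1 and \<open>r\<close> is invariant under the kernel.\<close>
  have \<kappa>: "\<kappa> * r w = 1" if w: "w \<in> ?Z" for w
  proof -
    have "bij_betw (\<lambda>z. w \<otimes>\<^bsub>G\<^esub> z) ?Z ?Z"
    proof (rule bij_betw_byWitness[of _ "\<lambda>z. inv\<^bsub>G\<^esub> w \<otimes>\<^bsub>G\<^esub> z"])
      have "\<pi> (inv\<^bsub>G\<^esub> w) = \<one>\<^bsub>Q\<^esub>"
        using w group_hom.hom_inv[of G Q \<pi> w] hom G.is_group Q.is_group
        by (simp add: group_hom_def group_hom_axioms_def)
      then show "(\<lambda>z. inv\<^bsub>G\<^esub> w \<otimes>\<^bsub>G\<^esub> z) ` ?Z \<subseteq> ?Z" using w by auto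
    qed (use w in \<open>auto simp flip: G.m_assoc\<close>)
    then have "(\<Sum>z\<in>?Z. r z) = (\<Sum>z\<in>?Z. r (w \<otimes>\<^bsub>G\<^esub> z))"
      by (rule sum.reindex_bij_betw[symmetric])
    also have "\<dots> = \<kappa> * r w * (\<Sum>z\<in>?Z. r z)"
      using rz[OF w] by (simp add: sum_distrib_left)
    finally show ?thesis using \<chi>(2) unfolding r_def[symmetric] by simp
  qed
  have rc: "r g = r h" if gh: "g \<in> carrier G" "h \<in> carrier G" "\<pi> g = \<pi> h" for g h
  proof -
    have "\<pi> (inv\<^bsub>G\<^esub> h) = inv\<^bsub>Q\<^esub> (\<pi> h)"
      using gh group_hom.hom_inv[of G Q \<pi> h] hom G.is_group Q.is_group
      by (simp add: group_hom_def group_hom_axioms_def)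
    then have "g \<otimes>\<^bsub>G\<^esub> inv\<^bsub>G\<^esub> h \<in> ?Z" using gh by simp
    then have "r (g \<otimes>\<^bsub>G\<^esub> inv\<^bsub>G\<^esub> h \<otimes>\<^bsub>G\<^esub> h) = r h" using rz \<kappa> gh by simp
    then show ?thesis using gh by (simp add: G.m_assoc)
  qed
  \<comment> \<open>\<open>r\<close> is constant on fibres, so it descends to \<open>Q\<close>; the
    chosen preimage is irrelevant.\<close>
  define q where "q x = r (inv_into (carrier G) \<pi> x)" for x
  have q: "q (\<pi> g) = r g" if "g \<in> carrier G" for g
  proof -
    have "\<pi> g \<in> \<pi> ` carrier G" using that by blast
    then show ?thesis unfolding q_def using that by (intro rc inv_into_into f_inv_into_f)
  qed
  have "cohomologous Q (\<lambda>p. \<alpha> p * a \<chi> p) \<beta>"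
  proof (rule cohomologousI[of _ q])
    fix x assume "x \<in> carrier Q"
    then obtain g where g: "g \<in> carrier G" "x = \<pi> g" using surj by blast
    show "q x \<noteq> 0" using g q r0 by simp
    fix y assume "y \<in> carrier Q"
    then obtain h where h: "h \<in> carrier G" "y = \<pi> h" using surj by blast
    show "q x * q y * \<beta> (x, y) = q (x \<otimes>\<^bsub>Q\<^esub> y) * (\<alpha> (x, y) * a \<chi> (x, y))"
      using rm[OF g(1) h(1)] g h q[OF G.m_closed[OF g(1) h(1)]] q by simp
  qed
  then show "\<exists>\<chi>\<in>I. cohomologous Q (\<lambda>p. \<alpha> p * a \<chi> p) \<beta>" using \<chi>(1) by blast
next
  assume "\<exists>\<chi>\<in>I. cohomologous Q (\<lambda>p. \<alpha> p * a \<chi> p) \<beta>"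
  then obtain \<chi> where \<chi>: "\<chi> \<in> I" "cohomologous Q (\<lambda>p. \<alpha> p * a \<chi> p) \<beta>" by blast
  obtain q where q0: "\<And>x. x \<in> carrier Q \<Longrightarrow> q x \<noteq> 0" and q: "\<And>x y. x \<in> carrier Q \<Longrightarrow> y \<in> carrier Q \<Longrightarrow>
      q x * q y * \<beta> (x, y) = q (x \<otimes>\<^bsub>Q\<^esub> y) * (\<alpha> (x, y) * a \<chi> (x, y))"
    by (rule cohomologousE[OF \<chi>(2)]) blast
  show "cohomologous G (pullback_cochain G \<pi> \<alpha>) (pullback_cochain G \<pi> \<beta>)"
  \<comment> \<open>The pullback of \<open>q\<close> carries the coboundary found on
    \<open>Q\<close>, and \<open>C \<chi>\<close> removes the inflation of
    \<open>a \<chi>\<close>.\<close>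
  proof (rule cohomologousI[of _ "\<lambda>g. q (\<pi> g) * C \<chi> g"])
    fix g assume g: "g \<in> carrier G"
    show "q (\<pi> g) * C \<chi> g \<noteq> 0" using g q0 nonzero \<chi>(1) by simp
    fix h assume h: "h \<in> carrier G"
    have "q (\<pi> g) * C \<chi> g * (q (\<pi> h) * C \<chi> h) * \<beta> (\<pi> g, \<pi> h) =
        (q (\<pi> g) * q (\<pi> h) * \<beta> (\<pi> g, \<pi> h)) * (C \<chi> g * C \<chi> h)"
      by (simp add: mult_ac)
    also have "\<dots> = q (\<pi> g \<otimes>\<^bsub>Q\<^esub> \<pi> h) * (C \<chi> g * C \<chi> h * a \<chi> (\<pi> g, \<pi> h)) * \<alpha> (\<pi> g, \<pi> h)"
      using q[of "\<pi> g" "\<pi> h"] g h by (simp add: mult_ac)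
    finally show "q (\<pi> g) * C \<chi> g * (q (\<pi> h) * C \<chi> h) * pullback_cochain G \<pi> \<beta> (g, h) =
        q (\<pi> (g \<otimes>\<^bsub>G\<^esub> h)) * C \<chi> (g \<otimes>\<^bsub>G\<^esub> h) * pullback_cochain G \<pi> \<alpha> (g, h)"
      unfolding split[OF \<chi>(1) g h] using g h by simp
  qed
qed

end

section \<open>Fourier decomposition of the twisted group algebra\<close>

context split_cover
begin

text \<open>The coefficient at \<open>\<chi>\<close> of the image of \<open>u\<close> is obtained by pushing \<open>u\<close> forward along \<open>\<pi>\<close>
  with weight \<open>f \<cdot> C \<chi>\<close>; this is a Fourier transform on the fibres of \<open>\<pi>\<close>.\<close>

lemma twisted_group_algebra_decomposition:
  assumes \<alpha>: "\<alpha> \<in> carrier (Z2 Q)" and \<gamma>: "\<gamma> \<in> carrier (Z2 G)"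
    and coh: "cohomologous G \<gamma> (pullback_cochain G \<pi> \<alpha>)"
  shows "algebra_iso (twisted_group_algebra G \<gamma>)
    (twisted_sum_algebra I Q (\<lambda>\<chi> p. \<alpha> p * a \<chi> p)) \<noteq> {}"
proof -
  let ?A = "twisted_group_algebra G \<gamma>"
  define b where "b = (\<lambda>\<chi> p. \<alpha> p * a \<chi> p)"
  let ?B = "twisted_sum_algebra I Q b"
  obtain f where f0: "\<And>g. g \<in> carrier G \<Longrightarrow> f g \<noteq> 0"
    and "\<And>g h. g \<in> carrier G \<Longrightarrow> h \<in> carrier G \<Longrightarrow>
      f g * f h * pullback_cochain G \<pi> \<alpha> (g, h) = f (g \<otimes>\<^bsub>G\<^esub> h) * \<gamma> (g, h)"
    by (rule cohomologousE[OF coh]) blast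
  then have f: "f g * f h * \<alpha> (\<pi> g, \<pi> h) = f (g \<otimes>\<^bsub>G\<^esub> h) * \<gamma> (g, h)"
    if "g \<in> carrier G" "h \<in> carrier G" for g h using that by simp
  \<comment> \<open>The combined weight turns the cocycle \<gamma> on \<open>G\<close> into the
    cocycle \<open>b \<chi>\<close> on \<open>Q\<close>: \<open>f\<close> passes from \<gamma> to
    the inflation of \<alpha>, and \<open>C \<chi>\<close> from there to the inflation of
    \<open>b \<chi>\<close>.\<close>
  define c where "c \<chi> g = f g * C \<chi> g" for \<chi> g
  define N where "N = (of_nat (card I) :: complex)"
  have N: "N \<noteq> 0" using index_nonempty by (simp add: N_def)
  have c0: "c \<chi> g \<noteq> 0" if "\<chi> \<in> I" "g \<in> carrier G" for \<chi> g
    using that f0 nonzero by (simp add: c_def)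
  have c: "c \<chi> g * c \<chi> h * b \<chi> (\<pi> g, \<pi> h) = c \<chi> (g \<otimes>\<^bsub>G\<^esub> h) * \<gamma> (g, h)"
    if "\<chi> \<in> I" "g \<in> carrier G" "h \<in> carrier G" for \<chi> g h
  proof -
    have "c \<chi> g * c \<chi> h * b \<chi> (\<pi> g, \<pi> h) =
        (f g * f h * \<alpha> (\<pi> g, \<pi> h)) * (C \<chi> g * C \<chi> h * a \<chi> (\<pi> g, \<pi> h))"
      by (simp add: c_def b_def mult_ac)
    also have "\<dots> = c \<chi> (g \<otimes>\<^bsub>G\<^esub> h) * \<gamma> (g, h)"
      unfolding f[OF that(2,3)] split[OF that] by (simp add: c_def mult_ac)
    finally show ?thesis .
  qed
  define fib where "fib x = {g \<in> carrier G. \<pi> g = x}" for x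
  have fib: "finite (fib x)" "g \<in> fib x \<longleftrightarrow> g \<in> carrier G \<and> \<pi> g = x" for g x
    using finite_carrier by (auto simp: fib_def)
  define F where "F u = (\<lambda>(\<chi>, x)\<in>I \<times> carrier Q. \<Sum>g\<in>fib x. u g * c \<chi> g)" for u
  \<comment> \<open>The inverse transform. The same normalization \<open>N = card I\<close> serves
    both compositions: separation of group elements gives one, orthogonality of the weights on
    fibres the other.\<close>
  define F' where "F' v = (\<lambda>g\<in>carrier G. (\<Sum>\<chi>\<in>I. v (\<chi>, \<pi> g) / c \<chi> g) / N)" for v
  have sep: "(\<Sum>\<chi>\<in>I. c \<chi> h / c \<chi> g) = (if h = g then N else 0)"
    if "g \<in> carrier G" "h \<in> carrier G" "\<pi> h = \<pi> g" for g h
  proof -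
    have "(\<Sum>\<chi>\<in>I. c \<chi> h / c \<chi> g) = (f h / f g) * (\<Sum>\<chi>\<in>I. C \<chi> h / C \<chi> g)"
      by (simp add: c_def sum_distrib_left)
    then show ?thesis using separation_sum[OF that(2,1,3)] f0 that(1) by (simp add: N_def)
  qed
  have orth: "(\<Sum>g\<in>fib x. c \<chi> g / c \<theta> g) = (if \<chi> = \<theta> then N else 0)"
    if "\<chi> \<in> I" "\<theta> \<in> I" "x \<in> carrier Q" for \<chi> \<theta> x
  proof -
    have "(\<Sum>g\<in>fib x. c \<chi> g / c \<theta> g) = (\<Sum>g\<in>fib x. C \<chi> g / C \<theta> g)"
      using f0 fib by (intro sum.cong) (auto simp: c_def)
    then show ?thesis using orthogonality_sum[OF that] by (simp add: N_def fib_def)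
  qed
  have "bij_betw F (carrier ?A) (carrier ?B)"
  proof (rule bij_betw_byWitness[of _ F'])
    show "\<forall>u\<in>carrier ?A. F' (F u) = u"
    proof
      fix u assume u: "u \<in> carrier ?A"
      have "(\<Sum>\<chi>\<in>I. F u (\<chi>, \<pi> g) / c \<chi> g) / N = u g" if g: "g \<in> carrier G" for g
      proof -
        have "(\<Sum>\<chi>\<in>I. F u (\<chi>, \<pi> g) / c \<chi> g) = (\<Sum>\<chi>\<in>I. \<Sum>h\<in>fib (\<pi> g). u h * (c \<chi> h / c \<chi> g))"
          using g by (intro sum.cong) (auto simp: F_def sum_divide_distrib)
        also have "\<dots> = (\<Sum>h\<in>fib (\<pi> g). u h * (\<Sum>\<chi>\<in>I. c \<chi> h / c \<chi> g))"
          unfolding sum_distrib_left by (rule sum.swap)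
        also have "\<dots> = (\<Sum>h\<in>fib (\<pi> g). if h = g then u h * N else 0)"
          using sep[OF g] fib by (intro sum.cong) auto
        also have "\<dots> = u g * N" using fib g by (subst sum.delta) auto
        finally show ?thesis using N by simp
      qed
      then show "F' (F u) = u"
        using u by (auto simp: F'_def twisted_group_algebra_def fun_eq_iff PiE_def extensional_def)
    qed
    show "\<forall>v\<in>carrier ?B. F (F' v) = v"
    proof
      fix v assume v: "v \<in> carrier ?B"
      have "(\<Sum>g\<in>fib x. F' v g * c \<chi> g) = v (\<chi>, x)" if x: "\<chi> \<in> I" "x \<in> carrier Q" for \<chi> x
      proof -
        have "(\<Sum>g\<in>fib x. F' v g * c \<chi> g) = (\<Sum>g\<in>fib x. \<Sum>\<theta>\<in>I. (v (\<theta>, x) / N) * (c \<chi> g / c \<theta> g))"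
          using fib by (intro sum.cong) (auto simp: F'_def sum_divide_distrib sum_distrib_left mult_ac)
        also have "\<dots> = (\<Sum>\<theta>\<in>I. (v (\<theta>, x) / N) * (\<Sum>g\<in>fib x. c \<chi> g / c \<theta> g))"
          unfolding sum_distrib_left by (rule sum.swap)
        also have "\<dots> = (\<Sum>\<theta>\<in>I. if \<chi> = \<theta> then v (\<theta>, x) else 0)"
          using orth[OF x(1) _ x(2)] N by (intro sum.cong) auto
        also have "\<dots> = v (\<chi>, x)" using finite_index x by simp
        finally show ?thesis .
      qed
      then show "F (F' v) = v"
        using v by (auto simp: F_def twisted_sum_algebra_def fun_eq_iff PiE_def extensional_def)
    qed
    show "F ` carrier ?A \<subseteq> carrier ?B"
      unfolding F_def twisted_sum_algebra_def by (simp add: PiE_def image_subset_iff)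
    show "F' ` carrier ?B \<subseteq> carrier ?A"
      unfolding F'_def twisted_group_algebra_def by (simp add: PiE_def image_subset_iff)
  qed
  moreover have "F (u \<otimes>\<^bsub>?A\<^esub> v) = F u \<otimes>\<^bsub>?B\<^esub> F v" for u v
  proof -
    have "(\<Sum>k\<in>fib x. (u \<otimes>\<^bsub>?A\<^esub> v) k * c \<chi> k) =
        (\<Sum>(y, z)\<in>{(y, z) \<in> carrier Q \<times> carrier Q. y \<otimes>\<^bsub>Q\<^esub> z = x}. F u (\<chi>, y) * F v (\<chi>, z) * b \<chi> (y, z))"
      (is "?l = (\<Sum>(y, z)\<in>?T. _)") if x: "\<chi> \<in> I" "x \<in> carrier Q" for \<chi> x
    proof -
      \<comment> \<open>Multiplicativity is one sum of \<open>t\<close> over \<open>S\<close>,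
        grouped in two ways: by the product in \<open>G\<close>, which gives the transform of a
        product, and by the pair of images in \<open>Q\<close>, which gives the product of the
        transforms.\<close>
      define S where "S = {(g, h). g \<in> carrier G \<and> h \<in> carrier G \<and> \<pi> g \<otimes>\<^bsub>Q\<^esub> \<pi> h = x}"
      define t where "t = (\<lambda>(g, h). u g * c \<chi> g * (v h * c \<chi> h) * b \<chi> (\<pi> g, \<pi> h))"
      have finS: "finite S"
        by (rule finite_subset[of _ "carrier G \<times> carrier G"]) (auto simp: S_def finite_carrier)
      have "?T \<subseteq> (\<lambda>(g, h). (\<pi> g, \<pi> h)) ` (carrier G \<times> carrier G)"
        unfolding surj[symmetric] by auto
      then have finT: "finite ?T"
        by (rule finite_subset) (simp add: finite_carrier)
      have "?l = (\<Sum>k\<in>fib x. \<Sum>p\<in>{p\<in>S. (\<lambda>(g, h). g \<otimes>\<^bsub>G\<^esub> h) p = k}. t p)"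
      proof (intro sum.cong refl)
        fix k assume k: "k \<in> fib x"
        have eq: "{(g, h) \<in> carrier G \<times> carrier G. g \<otimes>\<^bsub>G\<^esub> h = k} =
            {p\<in>S. (\<lambda>(g, h). g \<otimes>\<^bsub>G\<^esub> h) p = k}"
          using k fib \<pi>_mult by (auto simp: S_def)
        have "(u \<otimes>\<^bsub>?A\<^esub> v) k * c \<chi> k =
            (\<Sum>(g, h)\<in>{(g, h) \<in> carrier G \<times> carrier G. g \<otimes>\<^bsub>G\<^esub> h = k}. u g * v h * \<gamma> (g, h)) * c \<chi> k"
          using k fib by (simp add: twisted_group_algebra_def)
        also have "\<dots> = (\<Sum>p\<in>{p\<in>S. (\<lambda>(g, h). g \<otimes>\<^bsub>G\<^esub> h) p = k}. t p)"
          unfolding eq sum_distrib_right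
        proof (intro sum.cong refl)
          fix p assume p: "p \<in> {p\<in>S. (\<lambda>(g, h). g \<otimes>\<^bsub>G\<^esub> h) p = k}"
          then obtain g h where gh: "p = (g, h)" "g \<in> carrier G" "h \<in> carrier G" "g \<otimes>\<^bsub>G\<^esub> h = k"
            by (auto simp: S_def)
          have "t p = u g * v h * (c \<chi> g * c \<chi> h * b \<chi> (\<pi> g, \<pi> h))"
            by (simp add: t_def gh(1) mult_ac)
          then show "(case p of (g, h) \<Rightarrow> u g * v h * \<gamma> (g, h)) * c \<chi> k = t p"
            unfolding c[OF x(1) gh(2,3)] gh(4) by (simp add: gh(1) mult_ac)
        qed
        finally show "(u \<otimes>\<^bsub>?A\<^esub> v) k * c \<chi> k = (\<Sum>p\<in>{p\<in>S. (\<lambda>(g, h). g \<otimes>\<^bsub>G\<^esub> h) p = k}. t p)" .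
      qed
      also have "\<dots> = sum t S"
        using finS fib(1) by (rule sum.group) (auto simp: S_def fib_def)
      also have "\<dots> = (\<Sum>q\<in>?T. \<Sum>p\<in>{p\<in>S. (\<lambda>(g, h). (\<pi> g, \<pi> h)) p = q}. t p)"
        using finS finT by (rule sum.group[symmetric]) (auto simp: S_def)
      also have "\<dots> = (\<Sum>(y, z)\<in>?T. F u (\<chi>, y) * F v (\<chi>, z) * b \<chi> (y, z))"
      proof (intro sum.cong refl)
        fix q assume "q \<in> ?T"
        then obtain y z where q: "q = (y, z)" "y \<in> carrier Q" "z \<in> carrier Q" "y \<otimes>\<^bsub>Q\<^esub> z = x" by auto
        have "{p\<in>S. (\<lambda>(g, h). (\<pi> g, \<pi> h)) p = q} = fib y \<times> fib z"
          using q by (auto simp: S_def fib_def)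
        then have "(\<Sum>p\<in>{p\<in>S. (\<lambda>(g, h). (\<pi> g, \<pi> h)) p = q}. t p) = (\<Sum>g\<in>fib y. \<Sum>h\<in>fib z. t (g, h))"
          by (simp add: sum.cartesian_product)
        also have "\<dots> = (\<Sum>g\<in>fib y. \<Sum>h\<in>fib z. u g * c \<chi> g * (v h * c \<chi> h) * b \<chi> (y, z))"
          by (intro sum.cong refl) (auto simp: t_def fib_def)
        also have "\<dots> = (\<Sum>g\<in>fib y. u g * c \<chi> g) * (\<Sum>h\<in>fib z. v h * c \<chi> h) * b \<chi> (y, z)"
          unfolding sum_product unfolding sum_distrib_right ..
        finally show "(\<Sum>p\<in>{p\<in>S. (\<lambda>(g, h). (\<pi> g, \<pi> h)) p = q}. t p) =
            (case q of (y, z) \<Rightarrow> F u (\<chi>, y) * F v (\<chi>, z) * b \<chi> (y, z))"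
          using q x by (simp add: F_def)
      qed
      finally show ?thesis .
    qed
    then show ?thesis
      by (auto simp: F_def[of "u \<otimes>\<^bsub>?A\<^esub> v"] twisted_sum_algebra_def fun_eq_iff)
  qed
  moreover have "F (u \<oplus>\<^bsub>?A\<^esub> v) = F u \<oplus>\<^bsub>?B\<^esub> F v" for u v
  proof -
    have "(\<Sum>g\<in>fib x. (u \<oplus>\<^bsub>?A\<^esub> v) g * c \<chi> g) = (\<Sum>g\<in>fib x. u g * c \<chi> g) + (\<Sum>g\<in>fib x. v g * c \<chi> g)"
      for x \<chi>
      unfolding sum.distrib[symmetric]
      by (intro sum.cong) (auto simp: twisted_group_algebra_def fib_def algebra_simps)
    then show ?thesis
      by (auto simp: F_def twisted_sum_algebra_def fun_eq_iff)
  qed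
  moreover have "F (s \<odot>\<^bsub>?A\<^esub> u) = s \<odot>\<^bsub>?B\<^esub> F u" for s u
  proof -
    have "(\<Sum>g\<in>fib x. (s \<odot>\<^bsub>?A\<^esub> u) g * c \<chi> g) = s * (\<Sum>g\<in>fib x. u g * c \<chi> g)" for x \<chi>
      unfolding sum_distrib_left
      by (intro sum.cong) (auto simp: twisted_group_algebra_def fib_def algebra_simps)
    then show ?thesis
      by (auto simp: F_def twisted_sum_algebra_def fun_eq_iff)
  qed
  moreover have "F \<one>\<^bsub>?A\<^esub> = \<one>\<^bsub>?B\<^esub>"
  proof -
    have "(\<Sum>g\<in>fib x. \<one>\<^bsub>?A\<^esub> g * c \<chi> g) =
        (if x = \<one>\<^bsub>Q\<^esub> then inverse (b \<chi> (\<one>\<^bsub>Q\<^esub>, \<one>\<^bsub>Q\<^esub>)) else 0)" if x: "\<chi> \<in> I" "x \<in> carrier Q" for \<chi> x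
    proof -
      have "(\<Sum>g\<in>fib x. \<one>\<^bsub>?A\<^esub> g * c \<chi> g) =
          (\<Sum>g\<in>fib x. if g = \<one>\<^bsub>G\<^esub> then c \<chi> \<one>\<^bsub>G\<^esub> / \<gamma> (\<one>\<^bsub>G\<^esub>, \<one>\<^bsub>G\<^esub>) else 0)"
        by (intro sum.cong) (auto simp: twisted_group_algebra_def fib_def field_simps)
      also have "\<dots> = (if x = \<one>\<^bsub>Q\<^esub> then c \<chi> \<one>\<^bsub>G\<^esub> / \<gamma> (\<one>\<^bsub>G\<^esub>, \<one>\<^bsub>G\<^esub>) else 0)"
        using fib by (subst sum.delta) auto
      \<comment> \<open>The relation \<open>c\<close> at (1, 1), with one factor
        \<open>c \<chi> \<one>\<close> cancelled, matches the units of the two unnormalized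
        algebras.\<close>
      also have "c \<chi> \<one>\<^bsub>G\<^esub> / \<gamma> (\<one>\<^bsub>G\<^esub>, \<one>\<^bsub>G\<^esub>) = inverse (b \<chi> (\<one>\<^bsub>Q\<^esub>, \<one>\<^bsub>Q\<^esub>))"
        using c[OF x(1) G.one_closed G.one_closed] c0[OF x(1) G.one_closed]
          Z2_nonzero[OF \<gamma> G.one_closed G.one_closed] Z2_nonzero[OF \<alpha> Q.one_closed Q.one_closed]
          Z2_nonzero[OF cocycle[OF x(1)] Q.one_closed Q.one_closed]
        by (simp add: b_def field_simps)
      finally show ?thesis .
    qed
    then show ?thesis
      by (auto simp: F_def twisted_sum_algebra_def fun_eq_iff)
  qed
  ultimately have "F \<in> algebra_iso ?A ?B"
    by (auto simp: algebra_iso_def ring_iso_def ring_hom_def bij_betw_def)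
  then show ?thesis unfolding b_def by blast
qed

end

text \<open>The criterion for two inflations to be cohomologous and the target of the decomposition
  mention only \<open>Q\<close>, \<open>I\<close> and \<open>a\<close>, which the two covers share.
  Corresponding classes are those inflated from the same cocycle on \<open>Q\<close>.\<close>

theorem twisted_equiv_of_split_covers:
  assumes "split_cover G Q \<pi> I a C" and "split_cover H Q \<rho> I a C'"
  shows "G \<sim>\<^sub>\<complex> H"
proof -
  interpret G: split_cover G Q \<pi> I a C by fact
  interpret H: split_cover H Q \<rho> I a C' by fact
  let ?p = "\<lambda>\<alpha>. H2_class G (pullback_cochain G \<pi> \<alpha>)"
  let ?q = "\<lambda>\<alpha>. H2_class H (pullback_cochain H \<rho> \<alpha>)"
  note pZ = H2_pullback_class(1)[OF G.G.is_group G.Q.is_group G.hom]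
  note qZ = H2_pullback_class(1)[OF H.G.is_group G.Q.is_group H.hom]
  have p: "?p \<in> hom (Z2 Q) (H2 G)"
    by (rule H2_class_pullback_hom[OF G.G.is_group G.Q.is_group G.hom])
  have q: "?q \<in> hom (Z2 Q) (H2 H)"
    by (rule H2_class_pullback_hom[OF H.G.is_group G.Q.is_group H.hom])
  have ps: "?p ` carrier (Z2 Q) = carrier (H2 G)"
  proof
    show "?p ` carrier (Z2 Q) \<subseteq> carrier (H2 G)" using p by (auto simp: hom_def)
    show "carrier (H2 G) \<subseteq> ?p ` carrier (Z2 Q)"
      unfolding carrier_H2 using G.inflation_surj H2_class_eq_iff[OF G.G.is_group] pZ by blast
  qed
  have qs: "?q ` carrier (Z2 Q) = carrier (H2 H)"
  proof
    show "?q ` carrier (Z2 Q) \<subseteq> carrier (H2 H)" using q by (auto simp: hom_def)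
    show "carrier (H2 H) \<subseteq> ?q ` carrier (Z2 Q)"
      unfolding carrier_H2 using H.inflation_surj H2_class_eq_iff[OF H.G.is_group] qZ by blast
  qed
  have eq: "?p \<alpha> = ?p \<beta> \<longleftrightarrow> ?q \<alpha> = ?q \<beta>" if "\<alpha> \<in> carrier (Z2 Q)" "\<beta> \<in> carrier (Z2 Q)" for \<alpha> \<beta>
    using H2_class_eq_iff[OF G.G.is_group] H2_class_eq_iff[OF H.G.is_group] that pZ qZ
      G.cohomologous_pullback_iff[OF that] H.cohomologous_pullback_iff[OF that] by simp
  obtain \<psi> where \<psi>: "\<psi> \<in> iso (H2 G) (H2 H)" "\<And>\<alpha>. \<alpha> \<in> carrier (Z2 Q) \<Longrightarrow> \<psi> (?p \<alpha>) = ?q \<alpha>"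
    using iso_of_epis_same_kernel[OF p ps q qs _ eq] Z2_comm_group[OF G.Q.is_group]
    by (auto simp: comm_group_def)
  have "algebra_iso (twisted_group_algebra G \<gamma>) (twisted_group_algebra H \<delta>) \<noteq> {}"
    if c: "c \<in> carrier (H2 G)" and \<gamma>: "\<gamma> \<in> c" and \<delta>: "\<delta> \<in> \<psi> c" for c \<gamma> \<delta>
  proof -
    obtain \<alpha> where \<alpha>: "\<alpha> \<in> carrier (Z2 Q)" "c = ?p \<alpha>" using c ps by blast
    have "\<gamma> \<in> carrier (Z2 G)" "cohomologous G \<gamma> (pullback_cochain G \<pi> \<alpha>)"
      using \<gamma> \<alpha> mem_H2_class[OF G.G.is_group pZ] by blast+
    moreover have "\<delta> \<in> carrier (Z2 H)" "cohomologous H \<delta> (pullback_cochain H \<rho> \<alpha>)"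
      using \<delta> \<alpha> \<psi>(2) mem_H2_class[OF H.G.is_group qZ] by blast+
    ultimately show ?thesis
      using G.twisted_group_algebra_decomposition[OF \<alpha>(1), of \<gamma>]
        H.twisted_group_algebra_decomposition[OF \<alpha>(1), of \<delta>]
        algebra_iso_common_target[OF _ _ refl] by blast
  qed
  then show ?thesis unfolding twisted_equiv_def using \<psi>(1) by blast
qed

section \<open>Direct products\<close>

text \<open>For commuting x and y this is the scalar by which the basis elements of the twisted
  group algebra fail to commute: the product of y and x is this scalar times the product of x and
  y.\<close>

definition commutator_pairing ::
  "('a \<times> 'a \<Rightarrow> complex) \<Rightarrow> 'a \<Rightarrow> 'a \<Rightarrow> complex" where
  "commutator_pairing \<gamma> x y = \<gamma> (y, x) / \<gamma> (x, y)"

lemma commutator_pairing_swap: "commutator_pairing \<gamma> y x = inverse (commutator_pairing \<gamma> x y)"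
  by (simp add: commutator_pairing_def)

text \<open>The basis element of y is moved past those of x and x' one at a time, by the cocycle
  identity at (y, x, x'), (x, y, x') and (x, x', y); commutativity identifies the products that
  occur as arguments.\<close>

lemma commutator_pairing_mult_left:
  assumes "group G" and \<gamma>: "\<gamma> \<in> carrier (Z2 G)"
    and x: "x \<in> carrier G" "x' \<in> carrier G" "y \<in> carrier G"
    and comm: "x \<otimes>\<^bsub>G\<^esub> y = y \<otimes>\<^bsub>G\<^esub> x" "x' \<otimes>\<^bsub>G\<^esub> y = y \<otimes>\<^bsub>G\<^esub> x'"
  shows "commutator_pairing \<gamma> (x \<otimes>\<^bsub>G\<^esub> x') y = commutator_pairing \<gamma> x y * commutator_pairing \<gamma> x' y"
proof -
  interpret group G by fact
  note n = Z2_nonzero[OF \<gamma>] and co = Z2_cocycle[OF \<gamma>]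
  let ?m = "\<lambda>u v. u \<otimes>\<^bsub>G\<^esub> v"
  have "\<gamma> (x, x') * (\<gamma> (y, ?m x x') * \<gamma> (x, y) * \<gamma> (x', y)) =
      (\<gamma> (y, ?m x x') * \<gamma> (x, x')) * \<gamma> (x, y) * \<gamma> (x', y)" by simp
  also have "\<dots> = \<gamma> (y, x) * (\<gamma> (x, y) * \<gamma> (?m x y, x')) * \<gamma> (x', y)"
    using co[of y x x'] x comm by simp
  also have "\<dots> = \<gamma> (y, x) * \<gamma> (y, x') * (\<gamma> (x, ?m x' y) * \<gamma> (x', y))"
    using co[of x y x'] x comm by simp
  also have "\<dots> = \<gamma> (x, x') * (\<gamma> (y, x) * \<gamma> (y, x') * \<gamma> (?m x x', y))"
    using co[of x x' y] x by simp
  finally show ?thesis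
    using n x by (simp add: commutator_pairing_def frac_eq_eq mult_ac)
qed

lemma commutator_pairing_mult_right:
  assumes "group G" and \<gamma>: "\<gamma> \<in> carrier (Z2 G)"
    and x: "x \<in> carrier G" "y \<in> carrier G" "y' \<in> carrier G"
    and comm: "x \<otimes>\<^bsub>G\<^esub> y = y \<otimes>\<^bsub>G\<^esub> x" "x \<otimes>\<^bsub>G\<^esub> y' = y' \<otimes>\<^bsub>G\<^esub> x"
  shows "commutator_pairing \<gamma> x (y \<otimes>\<^bsub>G\<^esub> y') = commutator_pairing \<gamma> x y * commutator_pairing \<gamma> x y'"
  using commutator_pairing_mult_left[OF assms(1) \<gamma> x(2,3,1)] comm
  by (simp add: commutator_pairing_swap[of \<gamma> x])

text \<open>In the twisted group algebra this computes the product of the basis elements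
  \<open>(g, 1) \<cdot> (1, h)\<close> and \<open>(g', 1) \<cdot> (1, h')\<close>, moving \<open>(1, h)\<close> past \<open>(g', 1)\<close>.\<close>

lemma DirProd_cocycle_decomposition:
  assumes "group G" "group H" and \<gamma>: "\<gamma> \<in> carrier (Z2 (G \<times>\<times> H))"
    and g: "g \<in> carrier G" "g' \<in> carrier G" and h: "h \<in> carrier H" "h' \<in> carrier H"
  shows "\<gamma> ((g, \<one>\<^bsub>H\<^esub>), (\<one>\<^bsub>G\<^esub>, h)) * \<gamma> ((g', \<one>\<^bsub>H\<^esub>), (\<one>\<^bsub>G\<^esub>, h')) * \<gamma> ((g, h), (g', h')) =
    \<gamma> ((g \<otimes>\<^bsub>G\<^esub> g', \<one>\<^bsub>H\<^esub>), (\<one>\<^bsub>G\<^esub>, h \<otimes>\<^bsub>H\<^esub> h')) *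
    (\<gamma> ((g, \<one>\<^bsub>H\<^esub>), (g', \<one>\<^bsub>H\<^esub>)) * \<gamma> ((\<one>\<^bsub>G\<^esub>, h), (\<one>\<^bsub>G\<^esub>, h')) *
     commutator_pairing \<gamma> (g', \<one>\<^bsub>H\<^esub>) (\<one>\<^bsub>G\<^esub>, h))"
proof -
  interpret G: group G by fact
  interpret H: group H by fact
  note n = Z2_nonzero[OF \<gamma>] and co = Z2_cocycle[OF \<gamma>]
  define A A' B B' where "A = (g, \<one>\<^bsub>H\<^esub>)" and "A' = (g', \<one>\<^bsub>H\<^esub>)" and "B = (\<one>\<^bsub>G\<^esub>, h)" and "B' = (\<one>\<^bsub>G\<^esub>, h')"
  note defs = A_def A'_def B_def B'_def
  let ?P = "G \<times>\<times> H"
  let ?m = "\<lambda>u v. u \<otimes>\<^bsub>?P\<^esub> v"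
  have car: "A \<in> carrier ?P" "A' \<in> carrier ?P" "B \<in> carrier ?P" "B' \<in> carrier ?P"
    using g h by (auto simp: defs)
  have m: "?m A B = (g, h)" "?m A' B' = (g', h')" "?m (g, h) A' = (g \<otimes>\<^bsub>G\<^esub> g', h)"
    "?m B A' = (g', h)" "?m A' B = (g', h)" "?m A A' = (g \<otimes>\<^bsub>G\<^esub> g', \<one>\<^bsub>H\<^esub>)"
    "?m (g \<otimes>\<^bsub>G\<^esub> g', \<one>\<^bsub>H\<^esub>) B = (g \<otimes>\<^bsub>G\<^esub> g', h)" "?m B B' = (\<one>\<^bsub>G\<^esub>, h \<otimes>\<^bsub>H\<^esub> h')"
    using g h by (simp_all add: defs)
  have mc: "(g, h) \<in> carrier ?P" "(g', h) \<in> carrier ?P" "(g \<otimes>\<^bsub>G\<^esub> g', \<one>\<^bsub>H\<^esub>) \<in> carrier ?P"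
    using g h by auto
  \<comment> \<open>The claim multiplied by the denominator of the pairing, which is cancelled at
    the end. The chain applies the cocycle identity at (AB, A', B'), (A, B, A'), (A, A', B) and
    (AA', B, B').\<close>
  have "\<gamma> (A', B) * (\<gamma> (A, B) * \<gamma> (A', B') * \<gamma> ((g, h), (g', h'))) =
      \<gamma> (A', B) * \<gamma> (A, B) * (\<gamma> ((g, h), (g', h')) * \<gamma> (A', B'))" by simp
  also have "\<dots> = \<gamma> (A', B) * (\<gamma> (A, B) * \<gamma> ((g, h), A')) * \<gamma> ((g \<otimes>\<^bsub>G\<^esub> g', h), B')"
    using co[OF mc(1) car(2,4)] unfolding m by simp
  also have "\<dots> = (\<gamma> (A, (g', h)) * \<gamma> (A', B)) * \<gamma> (B, A') * \<gamma> ((g \<otimes>\<^bsub>G\<^esub> g', h), B')"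
    using co[OF car(1,3,2)] unfolding m by simp
  also have "\<dots> = \<gamma> (A, A') * \<gamma> (B, A') * (\<gamma> ((g \<otimes>\<^bsub>G\<^esub> g', \<one>\<^bsub>H\<^esub>), B) * \<gamma> ((g \<otimes>\<^bsub>G\<^esub> g', h), B'))"
    using co[OF car(1,2,3)] unfolding m by simp
  also have "\<dots> = \<gamma> (A', B) * (\<gamma> ((g \<otimes>\<^bsub>G\<^esub> g', \<one>\<^bsub>H\<^esub>), (\<one>\<^bsub>G\<^esub>, h \<otimes>\<^bsub>H\<^esub> h')) *
      (\<gamma> (A, A') * \<gamma> (B, B') * commutator_pairing \<gamma> A' B))"
    using co[OF mc(3) car(3,4)] n[OF car(2,3)] unfolding m by (simp add: commutator_pairing_def)
  finally show ?thesis using n[OF car(2,3)] unfolding defs by simp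
qed

section \<open>Direct products of covers\<close>

lemma hom_DirProd_cstar:
  assumes "group G" "group H" "\<eta> \<in> hom (G \<times>\<times> H) cstar"
  shows "(\<lambda>g. \<eta> (g, \<one>\<^bsub>H\<^esub>)) \<in> hom G cstar" and "(\<lambda>h. \<eta> (\<one>\<^bsub>G\<^esub>, h)) \<in> hom H cstar"
    and "g \<in> carrier G \<Longrightarrow> h \<in> carrier H \<Longrightarrow> \<eta> (g, h) = \<eta> (g, \<one>\<^bsub>H\<^esub>) * \<eta> (\<one>\<^bsub>G\<^esub>, h)"
proof -
  interpret G: group G by fact
  interpret H: group H by fact
  have m: "\<eta> (g \<otimes>\<^bsub>G\<^esub> g', h \<otimes>\<^bsub>H\<^esub> h') = \<eta> (g, h) * \<eta> (g', h')"
    if "g \<in> carrier G" "g' \<in> carrier G" "h \<in> carrier H" "h' \<in> carrier H" for g g' h h'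
    using hom_mult[OF assms(3), of "(g, h)" "(g', h')"] that by (simp add: cstar_def)
  have n: "\<eta> (g, h) \<in> carrier cstar" if "g \<in> carrier G" "h \<in> carrier H" for g h
    using assms(3) that by (auto simp: hom_def)
  show "(\<lambda>g. \<eta> (g, \<one>\<^bsub>H\<^esub>)) \<in> hom G cstar"
  proof (rule homI)
    fix x y assume "x \<in> carrier G" "y \<in> carrier G"
    then show "\<eta> (x \<otimes>\<^bsub>G\<^esub> y, \<one>\<^bsub>H\<^esub>) = \<eta> (x, \<one>\<^bsub>H\<^esub>) \<otimes>\<^bsub>cstar\<^esub> \<eta> (y, \<one>\<^bsub>H\<^esub>)"
      using m[of x y "\<one>\<^bsub>H\<^esub>" "\<one>\<^bsub>H\<^esub>"] by (simp add: cstar_def)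
  qed (use n in simp)
  show "(\<lambda>h. \<eta> (\<one>\<^bsub>G\<^esub>, h)) \<in> hom H cstar"
  proof (rule homI)
    fix x y assume "x \<in> carrier H" "y \<in> carrier H"
    then show "\<eta> (\<one>\<^bsub>G\<^esub>, x \<otimes>\<^bsub>H\<^esub> y) = \<eta> (\<one>\<^bsub>G\<^esub>, x) \<otimes>\<^bsub>cstar\<^esub> \<eta> (\<one>\<^bsub>G\<^esub>, y)"
      using m[of "\<one>\<^bsub>G\<^esub>" "\<one>\<^bsub>G\<^esub>" x y] by (simp add: cstar_def)
  qed (use n in simp)
  show "\<eta> (g, h) = \<eta> (g, \<one>\<^bsub>H\<^esub>) * \<eta> (\<one>\<^bsub>G\<^esub>, h)" if "g \<in> carrier G" "h \<in> carrier H"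
    using m[of g "\<one>\<^bsub>G\<^esub>" "\<one>\<^bsub>H\<^esub>" h] that by simp
qed

lemma split_cover_hom_cstar_const_DirProd:
  assumes "split_cover G Q \<pi> I a C" "split_cover G' Q' \<pi>' I' a' C'"
    and "\<eta> \<in> hom (G \<times>\<times> G') cstar" "g \<in> carrier (G \<times>\<times> G')" "h \<in> carrier (G \<times>\<times> G')"
    and "map_prod \<pi> \<pi>' g = map_prod \<pi> \<pi>' h"
  shows "\<eta> g = \<eta> h"
proof -
  interpret A: split_cover G Q \<pi> I a C by fact
  interpret B: split_cover G' Q' \<pi>' I' a' C' by fact
  note d = hom_DirProd_cstar[OF A.G.is_group B.G.is_group assms(3)]
  obtain g1 g2 h1 h2 where gh: "g = (g1, g2)" "h = (h1, h2)" by (cases g, cases h)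
  then have "\<eta> g = \<eta> (g1, \<one>\<^bsub>G'\<^esub>) * \<eta> (\<one>\<^bsub>G\<^esub>, g2)" "\<eta> h = \<eta> (h1, \<one>\<^bsub>G'\<^esub>) * \<eta> (\<one>\<^bsub>G\<^esub>, h2)"
    using assms(4,5) d(3)[of g1 g2] d(3)[of h1 h2] by auto
  moreover have "\<eta> (g1, \<one>\<^bsub>G'\<^esub>) = \<eta> (h1, \<one>\<^bsub>G'\<^esub>)" "\<eta> (\<one>\<^bsub>G\<^esub>, g2) = \<eta> (\<one>\<^bsub>G\<^esub>, h2)"
    using A.hom_cstar_const[OF d(1)] B.hom_cstar_const[OF d(2)] assms(4-6) gh by auto
  ultimately show ?thesis by simp
qed

text \<open>The three ingredients of \<gamma> descend for different reasons: the restrictions up to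
  coboundaries \<open>f1\<close> and \<open>f2\<close>, by surjectivity of inflation on each factor;
  the pairing \<open>b\<close> exactly, because in each variable it is a homomorphism to C^x and
  hence constant on fibres.\<close>

lemma split_cover_inflation_surj_DirProd:
  assumes "split_cover G Q \<pi> I a C" "split_cover G' Q' \<pi>' I' a' C'"
    and \<gamma>: "\<gamma> \<in> carrier (Z2 (G \<times>\<times> G'))"
  shows "\<exists>\<alpha>\<in>carrier (Z2 (Q \<times>\<times> Q')).
    cohomologous (G \<times>\<times> G') \<gamma> (pullback_cochain (G \<times>\<times> G') (map_prod \<pi> \<pi>') \<alpha>)"
proof -
  interpret A: split_cover G Q \<pi> I a C by fact
  interpret B: split_cover G' Q' \<pi>' I' a' C' by fact
  let ?G = "G \<times>\<times> G'" and ?Q = "Q \<times>\<times> Q'"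
  let ?e = "\<lambda>g. (g, \<one>\<^bsub>G'\<^esub>)" and ?e' = "\<lambda>h. (\<one>\<^bsub>G\<^esub>, h)"
  have grp: "group ?G" "group ?Q"
    by (simp_all add: DirProd_group A.G.is_group B.G.is_group A.Q.is_group B.Q.is_group)
  have e: "?e \<in> hom G ?G" "?e' \<in> hom G' ?G" by (auto simp: hom_def)
  have dec: "pullback_cochain G ?e \<gamma> \<in> carrier (Z2 G)" "pullback_cochain G' ?e' \<gamma> \<in> carrier (Z2 G')"
    using H2_pullback_class(1)[OF A.G.is_group grp(1) e(1) \<gamma>]
      H2_pullback_class(1)[OF B.G.is_group grp(1) e(2) \<gamma>] by blast+
  obtain \<alpha>1 where \<alpha>1: "\<alpha>1 \<in> carrier (Z2 Q)"
    and coh1: "cohomologous G (pullback_cochain G ?e \<gamma>) (pullback_cochain G \<pi> \<alpha>1)"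
    using A.inflation_surj[OF dec(1)] by blast
  obtain f1 where f10: "\<And>g. g \<in> carrier G \<Longrightarrow> f1 g \<noteq> 0"
    and f1_pullback: "\<And>g h. g \<in> carrier G \<Longrightarrow> h \<in> carrier G \<Longrightarrow> f1 g * f1 h *
      pullback_cochain G \<pi> \<alpha>1 (g, h) = f1 (g \<otimes>\<^bsub>G\<^esub> h) * pullback_cochain G ?e \<gamma> (g, h)"
    by (rule cohomologousE[OF coh1]) blast
  have f1: "f1 g * f1 h * \<alpha>1 (\<pi> g, \<pi> h) = f1 (g \<otimes>\<^bsub>G\<^esub> h) * \<gamma> (?e g, ?e h)"
    if "g \<in> carrier G" "h \<in> carrier G" for g h
    using f1_pullback[OF that] that by simp
  obtain \<alpha>2 where \<alpha>2: "\<alpha>2 \<in> carrier (Z2 Q')"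
    and coh2: "cohomologous G' (pullback_cochain G' ?e' \<gamma>) (pullback_cochain G' \<pi>' \<alpha>2)"
    using B.inflation_surj[OF dec(2)] by blast
  obtain f2 where f20: "\<And>g. g \<in> carrier G' \<Longrightarrow> f2 g \<noteq> 0"
    and f2_pullback: "\<And>g h. g \<in> carrier G' \<Longrightarrow> h \<in> carrier G' \<Longrightarrow> f2 g * f2 h *
      pullback_cochain G' \<pi>' \<alpha>2 (g, h) = f2 (g \<otimes>\<^bsub>G'\<^esub> h) * pullback_cochain G' ?e' \<gamma> (g, h)"
    by (rule cohomologousE[OF coh2]) blast
  have f2: "f2 g * f2 h * \<alpha>2 (\<pi>' g, \<pi>' h) = f2 (g \<otimes>\<^bsub>G'\<^esub> h) * \<gamma> (?e' g, ?e' h)"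
    if "g \<in> carrier G'" "h \<in> carrier G'" for g h
    using f2_pullback[OF that] that by simp
  define b where "b g h = commutator_pairing \<gamma> (?e g) (?e' h)" for g h
  have b0: "b g h \<noteq> 0" if "g \<in> carrier G" "h \<in> carrier G'" for g h
    unfolding b_def commutator_pairing_def using that by (simp add: Z2_nonzero[OF \<gamma>])
  have bl: "b (g \<otimes>\<^bsub>G\<^esub> g') h = b g h * b g' h"
    if "g \<in> carrier G" "g' \<in> carrier G" "h \<in> carrier G'" for g g' h
    using commutator_pairing_mult_left[OF grp(1) \<gamma>, of "?e g" "?e g'" "?e' h"] that
    by (simp add: b_def)
  have br: "b g (h \<otimes>\<^bsub>G'\<^esub> h') = b g h * b g h'"
    if "g \<in> carrier G" "h \<in> carrier G'" "h' \<in> carrier G'" for g h h'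
    using commutator_pairing_mult_right[OF grp(1) \<gamma>, of "?e g" "?e' h" "?e' h'"] that
    by (simp add: b_def)
  \<comment> \<open>The two arguments are changed one after the other, each by the constancy of
    homomorphisms on fibres.\<close>
  have bc: "b g h = b g' h'"
    if "g \<in> carrier G" "g' \<in> carrier G" "\<pi> g = \<pi> g'" "h \<in> carrier G'" "h' \<in> carrier G'" "\<pi>' h = \<pi>' h'"
    for g g' h h'
  proof -
    have "(\<lambda>g. b g h) \<in> hom G cstar" "b g' \<in> hom G' cstar"
      using that b0 bl br by (auto simp: hom_def cstar_def)
    then show ?thesis
      using A.hom_cstar_const[of "\<lambda>g. b g h" g g'] B.hom_cstar_const[of "b g'" h h'] that by simp
  qed
  define \<beta> where "\<beta> x y = b (inv_into (carrier G) \<pi> x) (inv_into (carrier G') \<pi>' y)" for x y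
  have \<beta>: "\<beta> (\<pi> g) (\<pi>' h) = b g h" if "g \<in> carrier G" "h \<in> carrier G'" for g h
  proof -
    have "\<pi> g \<in> \<pi> ` carrier G" "\<pi>' h \<in> \<pi>' ` carrier G'" using that by auto
    then show ?thesis unfolding \<beta>_def using that by (intro bc inv_into_into f_inv_into_f)
  qed
  have \<beta>0: "\<beta> x y \<noteq> 0" if xy: "x \<in> carrier Q" "y \<in> carrier Q'" for x y
  proof -
    obtain g where g: "g \<in> carrier G" "x = \<pi> g"
      using xy(1) A.surj by blast
    obtain h where h: "h \<in> carrier G'" "y = \<pi>' h"
      using xy(2) B.surj by blast
    from g h show ?thesis using \<beta> b0 by simp
  qed
  have \<beta>l: "\<beta> (x \<otimes>\<^bsub>Q\<^esub> x') y = \<beta> x y * \<beta> x' y"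
    if xy: "x \<in> carrier Q" "x' \<in> carrier Q" "y \<in> carrier Q'" for x x' y
  proof -
    obtain g where g: "g \<in> carrier G" "x = \<pi> g"
      using xy(1) A.surj by blast
    obtain g' where g': "g' \<in> carrier G" "x' = \<pi> g'"
      using xy(2) A.surj by blast
    obtain h where h: "h \<in> carrier G'" "y = \<pi>' h"
      using xy(3) B.surj by blast
    from g g' h show ?thesis using \<beta>[of "g \<otimes>\<^bsub>G\<^esub> g'" h] \<beta> bl by simp
  qed
  have \<beta>r: "\<beta> x (y \<otimes>\<^bsub>Q'\<^esub> y') = \<beta> x y * \<beta> x y'"
    if xy: "x \<in> carrier Q" "y \<in> carrier Q'" "y' \<in> carrier Q'" for x y y'
  proof -
    obtain g where g: "g \<in> carrier G" "x = \<pi> g"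
      using xy(1) A.surj by blast
    obtain h where h: "h \<in> carrier G'" "y = \<pi>' h"
      using xy(2) B.surj by blast
    obtain h' where h': "h' \<in> carrier G'" "y' = \<pi>' h'"
      using xy(3) B.surj by blast
    from g h h' show ?thesis using \<beta>[of g "h \<otimes>\<^bsub>G'\<^esub> h'"] \<beta> br by simp
  qed
  \<comment> \<open>The pairing couples the second coordinate of the first argument with the first
    coordinate of the second, the two entries that change places in a product. Bimultiplicativity of
    \<beta> makes this term a cocycle.\<close>
  define \<alpha> where "\<alpha> = (\<lambda>((x, y), (x', y')). \<alpha>1 (x, x') * \<alpha>2 (y, y') * \<beta> x' y)"
  have "restrict \<alpha> (carrier ?Q \<times> carrier ?Q) \<in> carrier (Z2 ?Q)"
  proof (rule Z2_restrictI[OF grp(2)])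
    fix u v assume "u \<in> carrier ?Q" "v \<in> carrier ?Q"
    then show "\<alpha> (u, v) \<noteq> 0"
      using \<beta>0 Z2_nonzero[OF \<alpha>1] Z2_nonzero[OF \<alpha>2] by (auto simp: \<alpha>_def)
  next
    fix u v w assume "u \<in> carrier ?Q" "v \<in> carrier ?Q" "w \<in> carrier ?Q"
    then obtain x y x' y' x'' y'' where u: "u = (x, y)" "v = (x', y')" "w = (x'', y'')"
      and x: "x \<in> carrier Q" "x' \<in> carrier Q" "x'' \<in> carrier Q"
      and y: "y \<in> carrier Q'" "y' \<in> carrier Q'" "y'' \<in> carrier Q'"
      by (cases u, cases v, cases w) auto
    have "\<alpha> (u, v) * \<alpha> (u \<otimes>\<^bsub>?Q\<^esub> v, w) =
        (\<alpha>1 (x, x') * \<alpha>1 (x \<otimes>\<^bsub>Q\<^esub> x', x'')) * (\<alpha>2 (y, y') * \<alpha>2 (y \<otimes>\<^bsub>Q'\<^esub> y', y'')) *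
        (\<beta> x' y * (\<beta> x'' y * \<beta> x'' y'))"
      using \<beta>r x y by (simp add: u \<alpha>_def)
    also have "\<dots> = \<alpha> (u, v \<otimes>\<^bsub>?Q\<^esub> w) * \<alpha> (v, w)"
      unfolding Z2_cocycle[OF \<alpha>1 x] Z2_cocycle[OF \<alpha>2 y] using \<beta>l x y by (simp add: u \<alpha>_def)
    finally show "\<alpha> (u, v) * \<alpha> (u \<otimes>\<^bsub>?Q\<^esub> v, w) = \<alpha> (u, v \<otimes>\<^bsub>?Q\<^esub> w) * \<alpha> (v, w)" .
  qed
  moreover have "cohomologous ?G \<gamma> (pullback_cochain ?G (map_prod \<pi> \<pi>') (restrict \<alpha> (carrier ?Q \<times> carrier ?Q)))"
  \<comment> \<open>\<open>f1\<close> and \<open>f2\<close> account for the factors. The denominator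
    is the change of basis from (g, h) to the product of the basis elements of (g, 1) and (1,
    h).\<close>
  proof (rule cohomologousI[of _ "\<lambda>(g, h). f1 g * f2 h / \<gamma> (?e g, ?e' h)"])
    fix u assume "u \<in> carrier ?G"
    then show "(case u of (g, h) \<Rightarrow> f1 g * f2 h / \<gamma> (?e g, ?e' h)) \<noteq> 0"
      using f10 f20 Z2_nonzero[OF \<gamma>] by auto
  next
    fix u v assume uv: "u \<in> carrier ?G" "v \<in> carrier ?G"
    then obtain g h g' h' where u: "u = (g, h)" "v = (g', h')"
      and g: "g \<in> carrier G" "g' \<in> carrier G" and h: "h \<in> carrier G'" "h' \<in> carrier G'"
      by (cases u, cases v) auto
    have nz: "\<gamma> (?e x, ?e' y) \<noteq> 0" if "x \<in> carrier G" "y \<in> carrier G'" for x y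
      using that by (simp add: Z2_nonzero[OF \<gamma>])
    let ?gg = "g \<otimes>\<^bsub>G\<^esub> g'" and ?hh = "h \<otimes>\<^bsub>G'\<^esub> h'"
    define s where "s = \<gamma> (?e g, ?e' h) * \<gamma> (?e g', ?e' h')"
    have s0: "s \<noteq> 0" using nz g h by (simp add: s_def)
    have "f1 g * f2 h / \<gamma> (?e g, ?e' h) * (f1 g' * f2 h' / \<gamma> (?e g', ?e' h')) *
        (\<alpha>1 (\<pi> g, \<pi> g') * \<alpha>2 (\<pi>' h, \<pi>' h') * b g' h) =
        (f1 g * f1 g' * \<alpha>1 (\<pi> g, \<pi> g')) * (f2 h * f2 h' * \<alpha>2 (\<pi>' h, \<pi>' h')) * b g' h / s"
      by (simp add: s_def)
    also have "\<dots> = f1 ?gg * f2 ?hh * (\<gamma> (?e g, ?e g') * \<gamma> (?e' h, ?e' h') * b g' h) / s"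
      unfolding f1[OF g] f2[OF h] by simp
    also have "\<gamma> (?e g, ?e g') * \<gamma> (?e' h, ?e' h') * b g' h = s * \<gamma> (u, v) / \<gamma> (?e ?gg, ?e' ?hh)"
      using DirProd_cocycle_decomposition[OF A.G.is_group B.G.is_group \<gamma> g h] nz[of ?gg ?hh] g h
      by (simp add: b_def s_def u nonzero_eq_divide_eq mult_ac)
    also have "f1 ?gg * f2 ?hh * (s * \<gamma> (u, v) / \<gamma> (?e ?gg, ?e' ?hh)) / s =
        f1 ?gg * f2 ?hh / \<gamma> (?e ?gg, ?e' ?hh) * \<gamma> (u, v)"
      using s0 by simp
    finally show "(case u of (g, h) \<Rightarrow> f1 g * f2 h / \<gamma> (?e g, ?e' h)) *
        (case v of (g, h) \<Rightarrow> f1 g * f2 h / \<gamma> (?e g, ?e' h)) *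
        pullback_cochain ?G (map_prod \<pi> \<pi>') (restrict \<alpha> (carrier ?Q \<times> carrier ?Q)) (u, v) =
        (case u \<otimes>\<^bsub>?G\<^esub> v of (g, h) \<Rightarrow> f1 g * f2 h / \<gamma> (?e g, ?e' h)) * \<gamma> (u, v)"
      using g h uv \<beta> by (simp add: u \<alpha>_def)
  qed
  ultimately show ?thesis by blast
qed

text \<open>Fibres and index sets are products, so the separation and orthogonality sums factor;
  distinct pairs differ in some coordinate, and the sum for that coordinate vanishes. Surjectivity
  of inflation is the one axiom with a contribution mixing the two factors.\<close>

lemma split_cover_DirProd:
  assumes "split_cover G Q \<pi> I a C" "split_cover G' Q' \<pi>' I' a' C'"
  shows "split_cover (G \<times>\<times> G') (Q \<times>\<times> Q') (map_prod \<pi> \<pi>') (I \<times> I')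
    (\<lambda>(\<chi>, \<theta>). \<lambda>((x, y), (x', y'))\<in>carrier (Q \<times>\<times> Q') \<times> carrier (Q \<times>\<times> Q'). a \<chi> (x, x') * a' \<theta> (y, y'))
    (\<lambda>(\<chi>, \<theta>) (g, h). C \<chi> g * C' \<theta> h)"
proof -
  interpret A: split_cover G Q \<pi> I a C by fact
  interpret B: split_cover G' Q' \<pi>' I' a' C' by fact
  let ?G = "G \<times>\<times> G'" and ?Q = "Q \<times>\<times> Q'"
  interpret G: group ?G by (rule DirProd_group[OF A.G.is_group B.G.is_group])
  interpret Q: group ?Q by (rule DirProd_group[OF A.Q.is_group B.Q.is_group])
  have fib: "{g \<in> carrier ?G. map_prod \<pi> \<pi>' g = (x, y)} =
      {g \<in> carrier G. \<pi> g = x} \<times> {g \<in> carrier G'. \<pi>' g = y}" for x y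
    by auto
  show ?thesis
  proof (unfold_locales, goal_cases)
    case 1
    then show ?case using A.finite_carrier B.finite_carrier by simp
  next
    case 2
    then show ?case by (auto simp: hom_def)
  next
    case 3
    then show ?case using A.surj B.surj by (simp add: map_prod_surj_on)
  next
    case 4
    then show ?case using A.finite_index B.finite_index by simp
  next
    case (5 p)
    then obtain \<chi> \<theta> where p: "p = (\<chi>, \<theta>)" "\<chi> \<in> I" "\<theta> \<in> I'" by blast
    let ?\<alpha> = "\<lambda>((x, y), (x', y')). a \<chi> (x, x') * a' \<theta> (y, y')"
    note aZ = A.cocycle[OF p(2)] and bZ = B.cocycle[OF p(3)]
    show ?case unfolding p(1) prod.case
    proof (rule Z2_restrictI[OF Q.is_group])
      fix u v w assume "u \<in> carrier ?Q" "v \<in> carrier ?Q" "w \<in> carrier ?Q"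
      then obtain x y x' y' x'' y'' where u: "u = (x, y)" "v = (x', y')" "w = (x'', y'')"
        and x: "x \<in> carrier Q" "x' \<in> carrier Q" "x'' \<in> carrier Q"
        and y: "y \<in> carrier Q'" "y' \<in> carrier Q'" "y'' \<in> carrier Q'"
        by (cases u, cases v, cases w) auto
      have "(a \<chi> (x, x') * a \<chi> (x \<otimes>\<^bsub>Q\<^esub> x', x'')) * (a' \<theta> (y, y') * a' \<theta> (y \<otimes>\<^bsub>Q'\<^esub> y', y'')) =
          (a \<chi> (x, x' \<otimes>\<^bsub>Q\<^esub> x'') * a \<chi> (x', x'')) * (a' \<theta> (y, y' \<otimes>\<^bsub>Q'\<^esub> y'') * a' \<theta> (y', y''))"
        unfolding Z2_cocycle[OF aZ x] Z2_cocycle[OF bZ y] ..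
      then show "?\<alpha> (u, v) * ?\<alpha> (u \<otimes>\<^bsub>?Q\<^esub> v, w) = ?\<alpha> (u, v \<otimes>\<^bsub>?Q\<^esub> w) * ?\<alpha> (v, w)"
        by (simp add: u mult_ac)
    qed (use Z2_nonzero[OF aZ] Z2_nonzero[OF bZ] in auto)
  next
    case (6 p g)
    then show ?case using A.nonzero B.nonzero by auto
  next
    case (7 p g h)
    then obtain \<chi> \<theta> g1 g2 h1 h2 where p: "p = (\<chi>, \<theta>)" "g = (g1, g2)" "h = (h1, h2)"
      and "\<chi> \<in> I" "\<theta> \<in> I'" "g1 \<in> carrier G" "h1 \<in> carrier G" "g2 \<in> carrier G'" "h2 \<in> carrier G'"
      by (cases p, cases g, cases h) auto
    then show ?case
      using A.split[of \<chi> g1 h1, symmetric] B.split[of \<theta> g2 h2, symmetric] by simp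
  next
    case (8 g h)
    then obtain g1 g2 h1 h2 where p: "g = (g1, g2)" "h = (h1, h2)"
      and c: "g1 \<in> carrier G" "h1 \<in> carrier G" "g2 \<in> carrier G'" "h2 \<in> carrier G'"
      and e: "\<pi> g1 = \<pi> h1" "\<pi>' g2 = \<pi>' h2"
      by (cases g, cases h) auto
    have "(\<Sum>q\<in>I \<times> I'. (case q of (\<chi>, \<theta>) \<Rightarrow> \<lambda>(g, h). C \<chi> g * C' \<theta> h) g /
          (case q of (\<chi>, \<theta>) \<Rightarrow> \<lambda>(g, h). C \<chi> g * C' \<theta> h) h) =
        (\<Sum>\<chi>\<in>I. \<Sum>\<theta>\<in>I'. (C \<chi> g1 / C \<chi> h1) * (C' \<theta> g2 / C' \<theta> h2))"
      by (simp add: p sum.cartesian_product split_def)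
    also have "\<dots> = (\<Sum>\<chi>\<in>I. C \<chi> g1 / C \<chi> h1) * (\<Sum>\<theta>\<in>I'. C' \<theta> g2 / C' \<theta> h2)"
      by (simp add: sum_product)
    also have "\<dots> = 0"
      using A.separation_sum[OF c(1,2) e(1)] B.separation_sum[OF c(3,4) e(2)] 8(4) p by auto
    finally show ?case .
  next
    case (9 p q z)
    then obtain \<chi> \<theta> \<chi>' \<theta>' x y where p: "p = (\<chi>, \<theta>)" "q = (\<chi>', \<theta>')" "z = (x, y)"
      and c: "\<chi> \<in> I" "\<chi>' \<in> I" "\<theta> \<in> I'" "\<theta>' \<in> I'" "x \<in> carrier Q" "y \<in> carrier Q'"
      by (cases p, cases q, cases z) auto
    have "(\<Sum>g\<in>{g \<in> carrier ?G. map_prod \<pi> \<pi>' g = z}.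
          (case p of (\<chi>, \<theta>) \<Rightarrow> \<lambda>(g, h). C \<chi> g * C' \<theta> h) g /
          (case q of (\<chi>, \<theta>) \<Rightarrow> \<lambda>(g, h). C \<chi> g * C' \<theta> h) g) =
        (\<Sum>g\<in>{g \<in> carrier G. \<pi> g = x}. \<Sum>h\<in>{g \<in> carrier G'. \<pi>' g = y}.
          (C \<chi> g / C \<chi>' g) * (C' \<theta> h / C' \<theta>' h))"
      unfolding p fib by (simp add: sum.cartesian_product split_def)
    also have "\<dots> = (\<Sum>g\<in>{g \<in> carrier G. \<pi> g = x}. C \<chi> g / C \<chi>' g) *
        (\<Sum>h\<in>{g \<in> carrier G'. \<pi>' g = y}. C' \<theta> h / C' \<theta>' h)"
      by (simp add: sum_product)
    also have "\<dots> = 0"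
      using A.orthogonality_sum[OF c(1,2,5)] B.orthogonality_sum[OF c(3,4,6)] 9(3) p by auto
    finally show ?case .
  next
    case (10 z)
    then obtain x y where "z = (x, y)" "x \<in> carrier Q" "y \<in> carrier Q'" by (cases z) auto
    then show ?case unfolding \<open>z = (x, y)\<close> fib
      using A.card_fibre B.card_fibre by (simp add: card_cartesian_product)
  next
    case (11 \<gamma>)
    then show ?case by (rule split_cover_inflation_surj_DirProd[OF assms])
  next
    case (12 \<eta> g h)
    then show ?case by (rule split_cover_hom_cstar_const_DirProd[OF assms])
  qed
qed

text \<open>This is the extension with trivial kernel: a single character, whose transgression
  cocycle and weight are constantly 1.\<close>

lemma split_cover_trivial:
  assumes "group A" "finite (carrier A)"
  shows "split_cover A A (\<lambda>g. g) {()} (\<lambda>_. \<lambda>p\<in>carrier A \<times> carrier A. 1) (\<lambda>_ _. 1)"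
proof -
  interpret group A by fact
  have fibre: "{g \<in> carrier A. g = x} = {x}" if "x \<in> carrier A" for x using that by auto
  show ?thesis
  proof (unfold_locales, goal_cases)
    case (11 \<gamma>)
    then show ?case by (intro bexI[of _ \<gamma>] cohomologousI[of _ "\<lambda>_. 1"]) auto
  qed (use assms(2) in \<open>auto simp: hom_def Z2_def cstar_def fibre\<close>)
qed

section \<open>Compatible pairs\<close>

lemma bij_betw_char_group:
  assumes "group A" "i \<in> iso A B"
  shows "bij_betw (\<lambda>\<chi>. \<lambda>z\<in>carrier A. \<chi> (i z)) (carrier (char_group B)) (carrier (char_group A))"
proof -
  have bij: "bij_betw i (carrier A) (carrier B)" and hom: "i \<in> hom A B"
    using assms(2) by (auto simp: iso_def)
  let ?j = "inv_into (carrier A) i"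
  have j: "?j \<in> hom B A"
    using group.iso_set_sym[OF assms] by (simp add: iso_def)
  have ij: "i (?j y) = y" "?j y \<in> carrier A" if "y \<in> carrier B" for y
    using that bij by (auto simp: bij_betw_def f_inv_into_f inv_into_into)
  have ji: "?j (i x) = x" "i x \<in> carrier B" if "x \<in> carrier A" for x
    using that bij by (auto simp: bij_betw_def)
  have pull: "(\<lambda>z\<in>carrier A. \<chi> (i z)) \<in> carrier (char_group A)" if "\<chi> \<in> carrier (char_group B)" for \<chi>
    using that hom assms(1) by (auto simp: char_group_def hom_def Pi_def group.is_monoid monoid.m_closed)
  have push: "(\<lambda>z\<in>carrier B. \<chi> (?j z)) \<in> carrier (char_group B)" if "\<chi> \<in> carrier (char_group A)" for \<chi>
  proof -
    \<comment> \<open>Closure of the carrier of \<open>B\<close> under multiplication is transported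
      from \<open>A\<close>.\<close>
    have "i (?j x \<otimes>\<^bsub>A\<^esub> ?j y) = x \<otimes>\<^bsub>B\<^esub> y" if "x \<in> carrier B" "y \<in> carrier B" for x y
      using that ij hom_mult[OF hom] by simp
    then have "x \<otimes>\<^bsub>B\<^esub> y \<in> carrier B" if "x \<in> carrier B" "y \<in> carrier B" for x y
      using that ij(2) ji(2) assms(1) by (metis group.is_monoid monoid.m_closed)
    then show ?thesis
      using that j ij(2) by (auto simp: char_group_def hom_def Pi_def)
  qed
  show ?thesis
  proof (rule bij_betw_byWitness[of _ "\<lambda>\<chi>. \<lambda>z\<in>carrier B. \<chi> (?j z)"])
    show "\<forall>\<chi>\<in>carrier (char_group B). (\<lambda>z\<in>carrier B. (\<lambda>z\<in>carrier A. \<chi> (i z)) (?j z)) = \<chi>"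
      using ij by (auto simp: char_group_def fun_eq_iff extensional_def)
    show "\<forall>\<chi>\<in>carrier (char_group A). (\<lambda>z\<in>carrier A. (\<lambda>z\<in>carrier B. \<chi> (?j z)) (i z)) = \<chi>"
      using ji by (auto simp: char_group_def fun_eq_iff extensional_def)
  qed (use pull push in auto)
qed

lemma tra_inf_exact_inflation_surj:
  assumes "group G" "central_subgroup Z G" "tra_inf_exact G Z" and \<gamma>: "\<gamma> \<in> carrier (Z2 G)"
  obtains \<alpha> where "\<alpha> \<in> carrier (Z2 (G Mod Z))"
    "cohomologous G \<gamma> (pullback_cochain G (\<lambda>x. Z #>\<^bsub>G\<^esub> x) \<alpha>)"
proof -
  interpret normal Z G by (rule central_subgroup_normal[OF assms(1,2)])
  have "inflation G Z ` carrier (H2 (G Mod Z)) = carrier (H2 G)"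
    using assms(3) by (simp add: tra_inf_exact_def short_exact_def epi_def)
  then have "H2_class G \<gamma> \<in> inflation G Z ` H2_class (G Mod Z) ` carrier (Z2 (G Mod Z))"
    using \<gamma> by (simp add: carrier_H2)
  then obtain \<alpha> where \<alpha>: "\<alpha> \<in> carrier (Z2 (G Mod Z))"
    and eq: "H2_class G \<gamma> = inflation G Z (H2_class (G Mod Z) \<alpha>)" by blast
  note pb = H2_pullback_class[OF assms(1) factorgroup_is_group r_coset_hom_Mod \<alpha>]
  have "cohomologous G \<gamma> (pullback_cochain G (\<lambda>x. Z #>\<^bsub>G\<^esub> x) \<alpha>)"
    using eq pb(2) H2_class_eq_iff[OF assms(1) \<gamma> pb(1)] by (simp add: inflation_def)
  then show ?thesis using that \<alpha> by blast
qed

text \<open>The transgression of the restriction of \<open>\<eta>\<close> to \<open>Z\<close> is the coboundary of \<open>\<eta> \<circ> \<mu>\<close>.\<close>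

lemma tra_inf_exact_hom_trivial:
  assumes "group G" "central_subgroup Z G" "tra_inf_exact G Z"
    and \<eta>: "\<eta> \<in> hom G cstar" and z: "z \<in> Z"
  shows "\<eta> z = 1"
proof -
  interpret normal Z G by (rule central_subgroup_normal[OF assms(1,2)])
  interpret M: group "G Mod Z" by (rule factorgroup_is_group)
  note [simp del] = mult_FactGroup carrier_FactGroup
  obtain \<mu> where \<mu>: "is_section G Z \<mu>" using section_exists[OF assms(1) is_subgroup] by blast
  note d = section_defect[OF assms(1,2) \<mu>]
  let ?X = "char_group (G\<lparr>carrier := Z\<rparr>)"
  let ?\<chi> = "restrict \<eta> Z" and ?e = "\<lambda>z\<in>Z. 1 :: complex"
  have \<chi>: "?\<chi> \<in> carrier ?X" "?e \<in> carrier ?X"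
    using \<eta> mem_carrier by (auto simp: char_group_def hom_def cstar_def Pi_def)
  have m: "\<eta> (g \<otimes>\<^bsub>G\<^esub> h) = \<eta> g * \<eta> h" "\<eta> g \<noteq> 0" if "g \<in> carrier G" "h \<in> carrier G" for g h
    using \<eta> that by (auto simp: hom_def cstar_def)
  have minv: "\<eta> (inv\<^bsub>G\<^esub> g) * \<eta> g = 1" if "g \<in> carrier G" for g
    using m(1)[of "inv\<^bsub>G\<^esub> g" g] character_one[OF assms(1) \<eta>] that by simp
  \<comment> \<open>The comparison is with the transgression of the trivial character
    \<open>?e\<close>, whose cocycle is constantly 1; injectivity on characters then applies
    directly.\<close>
  have "cohomologous (G Mod Z) (transgression_cocycle G Z \<mu> ?\<chi>) (transgression_cocycle G Z \<mu> ?e)"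
  proof (rule cohomologousI[of _ "\<lambda>U. \<eta> (\<mu> U)"])
    fix U assume U: "U \<in> carrier (G Mod Z)"
    show "\<eta> (\<mu> U) \<noteq> 0" using m(2) d(1)[OF U U] by blast
    fix V assume V: "V \<in> carrier (G Mod Z)"
    let ?UV = "U \<otimes>\<^bsub>G Mod Z\<^esub> V"
    have c: "\<mu> U \<in> carrier G" "\<mu> V \<in> carrier G" "\<mu> ?UV \<in> carrier G"
      using d(1) U V M.m_closed by blast+
    show "\<eta> (\<mu> U) * \<eta> (\<mu> V) * transgression_cocycle G Z \<mu> ?e (U, V) =
        \<eta> (\<mu> ?UV) * transgression_cocycle G Z \<mu> ?\<chi> (U, V)"
      using U V d(2)[OF U V] c minv[OF c(3)]
      by (simp add: transgression_cocycle_def m mult_ac)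
  qed
  then have "transgression G Z ?\<chi> = transgression G Z ?e"
    using transgression_indep[OF assms(1,2) \<mu>] \<chi> transgression_cocycle_Z2[OF assms(1,2) \<mu>]
      H2_class_eq_iff[OF M.is_group] by simp
  moreover have "inj_on (transgression G Z) (carrier ?X)"
    using assms(3) by (simp add: tra_inf_exact_def short_exact_def mon_def)
  ultimately have "?\<chi> = ?e" using \<chi> by (simp add: inj_on_eq_iff)
  then show ?thesis using z by (metis restrict_apply')
qed

text \<open>The parameters \<open>c\<close>, \<phi> and \<open>a\<close> let a second group be
  described by the index set, quotient and cocycles of the first. Hence \<open>a \<chi>\<close> need
  only be cohomologous, after pullback along \<phi>, to the transgression of the character
  \<open>c \<chi>\<close>.\<close>

lemma split_cover_of_central_extension:
  fixes a :: "'x \<Rightarrow> 'q \<times> 'q \<Rightarrow> complex"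
  assumes "group G" "finite (carrier G)" and cen: "central_subgroup Z G"
    and ex: "tra_inf_exact G Z" and \<mu>: "is_section G Z \<mu>"
    and "group Q" and \<phi>: "\<phi> \<in> iso (G Mod Z) Q"
    and c: "bij_betw c I (carrier (char_group (G\<lparr>carrier := Z\<rparr>)))"
    and a: "\<And>\<chi>. \<chi> \<in> I \<Longrightarrow> a \<chi> \<in> carrier (Z2 Q)"
    and coh: "\<And>\<chi>. \<chi> \<in> I \<Longrightarrow> cohomologous (G Mod Z) (transgression_cocycle G Z \<mu> (c \<chi>))
      (pullback_cochain (G Mod Z) \<phi> (a \<chi>))"
  obtains C where "split_cover G Q (\<lambda>g. \<phi> (Z #>\<^bsub>G\<^esub> g)) I a C"
proof -
  interpret normal Z G by (rule central_subgroup_normal[OF assms(1) cen])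
  interpret M: group "G Mod Z" by (rule factorgroup_is_group)
  interpret Q: group Q by fact
  note [simp del] = mult_FactGroup carrier_FactGroup
  note d = section_defect[OF assms(1) cen \<mu>]
  let ?Z = "G\<lparr>carrier := Z\<rparr>" and ?M = "G Mod Z"
  have central: "z \<otimes>\<^bsub>G\<^esub> g = g \<otimes>\<^bsub>G\<^esub> z" if "z \<in> Z" "g \<in> carrier G" for z g
    using cen that by (auto simp: central_subgroup_def)
  have finZ: "finite Z" using assms(2) subset by (rule finite_subset[rotated])
  have commZ: "comm_group ?Z"
    by (rule group.group_comm_groupI[OF subgroup_imp_group[OF is_subgroup]])
      (use central mem_carrier in auto)
  have coset: "Z #>\<^bsub>G\<^esub> g \<in> carrier ?M" "Z #>\<^bsub>G\<^esub> (g \<otimes>\<^bsub>G\<^esub> h) = (Z #>\<^bsub>G\<^esub> g) \<otimes>\<^bsub>?M\<^esub> (Z #>\<^bsub>G\<^esub> h)"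
    if "g \<in> carrier G" "h \<in> carrier G" for g h
    using r_coset_hom_Mod that by (auto simp: hom_def)
  have \<mu>c: "\<mu> U \<in> carrier G" if "U \<in> carrier ?M" for U using d(1) that by blast
  have \<mu>U: "Z #>\<^bsub>G\<^esub> \<mu> U = U" if U: "U \<in> carrier ?M" for U
  proof -
    obtain g where "g \<in> carrier G" "U = Z #>\<^bsub>G\<^esub> g" using U by (auto simp: carrier_FactGroup)
    then show ?thesis using \<mu> U repr_independence[OF _ _ is_subgroup] by (auto simp: is_section_def)
  qed
  have coset_mult: "Z #>\<^bsub>G\<^esub> (t \<otimes>\<^bsub>G\<^esub> g) = Z #>\<^bsub>G\<^esub> g" if "t \<in> Z" "g \<in> carrier G" for t g
    using that by (metis coset_join2 coset_mult_assoc is_subgroup mem_carrier subset)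
  have coset_eqD: "\<exists>t\<in>Z. g = t \<otimes>\<^bsub>G\<^esub> h" if "g \<in> carrier G" "h \<in> carrier G" "Z #>\<^bsub>G\<^esub> g = Z #>\<^bsub>G\<^esub> h" for g h
    using rcos_self[OF that(1) is_subgroup] that(3) by (auto simp: r_coset_def)
  \<comment> \<open>The component in \<open>Z\<close> of an element relative to the section
    \<mu>.\<close>
  define zc where "zc g = g \<otimes>\<^bsub>G\<^esub> inv\<^bsub>G\<^esub> (\<mu> (Z #>\<^bsub>G\<^esub> g))" for g
  have zc_eq: "zc (t \<otimes>\<^bsub>G\<^esub> \<mu> U) = t" if "t \<in> Z" "U \<in> carrier ?M" for t U
    using that mem_carrier \<mu>c by (simp add: zc_def coset_mult \<mu>U m_assoc)
  have decomp: "\<exists>t\<in>Z. g = t \<otimes>\<^bsub>G\<^esub> \<mu> (Z #>\<^bsub>G\<^esub> g)" if "g \<in> carrier G" for g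
    using that coset_eqD[of g "\<mu> (Z #>\<^bsub>G\<^esub> g)"] coset \<mu>c \<mu>U by simp
  have zc: "zc g \<in> Z" "g = zc g \<otimes>\<^bsub>G\<^esub> \<mu> (Z #>\<^bsub>G\<^esub> g)" if g: "g \<in> carrier G" for g
  proof -
    obtain t where t: "t \<in> Z" "g = t \<otimes>\<^bsub>G\<^esub> \<mu> (Z #>\<^bsub>G\<^esub> g)" using decomp g by blast
    then have "zc g = t" using zc_eq[OF t(1) coset(1)[OF g g]] by simp
    then show "zc g \<in> Z" "g = zc g \<otimes>\<^bsub>G\<^esub> \<mu> (Z #>\<^bsub>G\<^esub> g)" using t by simp_all
  qed
  have zc_left: "zc (t \<otimes>\<^bsub>G\<^esub> g) = t \<otimes>\<^bsub>G\<^esub> zc g" if "t \<in> Z" "g \<in> carrier G" for t g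
    using that mem_carrier \<mu>c coset by (simp add: zc_def coset_mult m_assoc)
  define df where "df U V = \<mu> U \<otimes>\<^bsub>G\<^esub> \<mu> V \<otimes>\<^bsub>G\<^esub> inv\<^bsub>G\<^esub> (\<mu> (U \<otimes>\<^bsub>?M\<^esub> V))" for U V
  have df: "df U V \<in> Z" if "U \<in> carrier ?M" "V \<in> carrier ?M" for U V
    unfolding df_def using d(2) that .
  \<comment> \<open>Centrality lets the \<open>Z\<close>-components be collected in front; what
    remains of the two representatives is the defect of the section, the argument of the
    transgression cocycle.\<close>
  have zc_mult: "zc (g \<otimes>\<^bsub>G\<^esub> h) = zc g \<otimes>\<^bsub>G\<^esub> zc h \<otimes>\<^bsub>G\<^esub> df (Z #>\<^bsub>G\<^esub> g) (Z #>\<^bsub>G\<^esub> h)"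
    if g: "g \<in> carrier G" and h: "h \<in> carrier G" for g h
  proof -
    let ?U = "Z #>\<^bsub>G\<^esub> g" and ?V = "Z #>\<^bsub>G\<^esub> h"
    have UV: "?U \<in> carrier ?M" "?V \<in> carrier ?M" using coset g h by blast+
    have mc: "\<mu> ?U \<in> carrier G" "\<mu> ?V \<in> carrier G" "\<mu> (?U \<otimes>\<^bsub>?M\<^esub> ?V) \<in> carrier G"
      using \<mu>c UV by simp_all
    have zG: "zc g \<in> carrier G" "zc h \<in> carrier G" using zc g h mem_carrier by blast+
    have "g \<otimes>\<^bsub>G\<^esub> h = (zc g \<otimes>\<^bsub>G\<^esub> \<mu> ?U) \<otimes>\<^bsub>G\<^esub> (zc h \<otimes>\<^bsub>G\<^esub> \<mu> ?V)"
      by (rule arg_cong2[where f = "\<lambda>x y. x \<otimes>\<^bsub>G\<^esub> y", OF zc(2)[OF g] zc(2)[OF h]])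
    also have "\<dots> = zc g \<otimes>\<^bsub>G\<^esub> (\<mu> ?U \<otimes>\<^bsub>G\<^esub> zc h) \<otimes>\<^bsub>G\<^esub> \<mu> ?V"
      using mc zG by (simp add: m_assoc)
    also have "\<dots> = zc g \<otimes>\<^bsub>G\<^esub> zc h \<otimes>\<^bsub>G\<^esub> (\<mu> ?U \<otimes>\<^bsub>G\<^esub> \<mu> ?V)"
      using mc zG central[OF zc(1)[OF h] mc(1), symmetric] by (simp add: m_assoc)
    finally have prod: "g \<otimes>\<^bsub>G\<^esub> h = zc g \<otimes>\<^bsub>G\<^esub> zc h \<otimes>\<^bsub>G\<^esub> (\<mu> ?U \<otimes>\<^bsub>G\<^esub> \<mu> ?V)" .
    have "zc (g \<otimes>\<^bsub>G\<^esub> h) = g \<otimes>\<^bsub>G\<^esub> h \<otimes>\<^bsub>G\<^esub> inv\<^bsub>G\<^esub> (\<mu> (?U \<otimes>\<^bsub>?M\<^esub> ?V))"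
      by (simp only: zc_def coset(2)[OF g h])
    also have "\<dots> = zc g \<otimes>\<^bsub>G\<^esub> zc h \<otimes>\<^bsub>G\<^esub> df ?U ?V"
      unfolding prod using mc zG by (simp add: df_def m_assoc)
    finally show ?thesis .
  qed
  have cX: "c \<chi> \<in> carrier (char_group ?Z)" if "\<chi> \<in> I" for \<chi>
    using c that by (auto simp: bij_betw_def)
  have cm: "c \<chi> (s \<otimes>\<^bsub>G\<^esub> t) = c \<chi> s * c \<chi> t" "c \<chi> s \<noteq> 0" if "\<chi> \<in> I" "s \<in> Z" "t \<in> Z" for \<chi> s t
    using cX[OF that(1)] that(2,3) by (auto simp: char_group_def hom_def cstar_def)
  have "\<forall>\<chi>\<in>I. \<exists>w. (\<forall>U\<in>carrier ?M. w U \<noteq> 0) \<and>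
      (\<forall>U\<in>carrier ?M. \<forall>V\<in>carrier ?M. w U * w V * a \<chi> (\<phi> U, \<phi> V) = w (U \<otimes>\<^bsub>?M\<^esub> V) * c \<chi> (df U V))"
    using coh by (simp add: cohomologous_def transgression_cocycle_def df_def)
  then obtain w where w0: "\<And>\<chi> U. \<chi> \<in> I \<Longrightarrow> U \<in> carrier ?M \<Longrightarrow> w \<chi> U \<noteq> 0"
    and w: "\<And>\<chi> U V. \<chi> \<in> I \<Longrightarrow> U \<in> carrier ?M \<Longrightarrow> V \<in> carrier ?M \<Longrightarrow>
      w \<chi> U * w \<chi> V * a \<chi> (\<phi> U, \<phi> V) = w \<chi> (U \<otimes>\<^bsub>?M\<^esub> V) * c \<chi> (df U V)"
    unfolding bchoice_iff by blast
  \<comment> \<open>The character on the \<open>Z\<close>-component trivializes the inflated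
    transgression cocycle; \<open>w\<close> corrects from that cocycle to the prescribed
    \<open>a \<chi>\<close>.\<close>
  define C where "C \<chi> g = c \<chi> (zc g) * w \<chi> (Z #>\<^bsub>G\<^esub> g)" for \<chi> g
  have \<phi>b: "bij_betw \<phi> (carrier ?M) (carrier Q)" and \<phi>h: "\<phi> \<in> hom ?M Q"
    using \<phi> by (auto simp: iso_def)
  have \<phi>inj: "U = V" if "\<phi> U = \<phi> V" "U \<in> carrier ?M" "V \<in> carrier ?M" for U V
    using \<phi>b that by (auto simp: bij_betw_def inj_on_def)
  \<comment> \<open>Fibres are translates of \<open>Z\<close>, which turns sums over fibres into
    character sums over \<open>Z\<close>.\<close>
  have fib: "bij_betw (\<lambda>t. t \<otimes>\<^bsub>G\<^esub> \<mu> U) Z {g \<in> carrier G. \<phi> (Z #>\<^bsub>G\<^esub> g) = \<phi> U}"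
    if U: "U \<in> carrier ?M" for U
  proof (rule bij_betw_byWitness[of _ zc])
    show "\<forall>g\<in>{g \<in> carrier G. \<phi> (Z #>\<^bsub>G\<^esub> g) = \<phi> U}. zc g \<otimes>\<^bsub>G\<^esub> \<mu> U = g"
      using zc(2) \<phi>inj U coset(1) by fastforce
  qed (use U zc_eq zc(1) coset_mult \<mu>U \<mu>c mem_carrier in auto)
  have "split_cover G Q (\<lambda>g. \<phi> (Z #>\<^bsub>G\<^esub> g)) I a C"
  proof (unfold_locales, goal_cases)
    case 1
    show ?case by fact
  next
    case 2
    show ?case using Group.hom_compose[OF r_coset_hom_Mod \<phi>h] by (simp add: comp_def)
  next
    case 3
    have "(\<lambda>g. Z #>\<^bsub>G\<^esub> g) ` carrier G = carrier ?M" by (auto simp: carrier_FactGroup)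
    then have "(\<lambda>g. \<phi> (Z #>\<^bsub>G\<^esub> g)) ` carrier G = \<phi> ` carrier ?M" by (metis image_image)
    then show ?case using \<phi>b by (simp add: bij_betw_def)
  next
    case 4
    have "finite (carrier (char_group ?Z))"
      using finite_char_group[of ?Z] commZ finZ by (simp add: comm_group_def)
    then show ?case using bij_betw_finite[OF c] by simp
  next
    case (5 \<chi>)
    then show ?case by (rule a)
  next
    case (6 \<chi> g)
    then show ?case
      using cm(2)[OF 6(1) zc(1) zc(1)] w0[OF 6(1)] coset(1) by (simp add: C_def)
  next
    case (7 \<chi> g h)
    note i = 7(1) and g = 7(2) and h = 7(3)
    let ?U = "Z #>\<^bsub>G\<^esub> g" and ?V = "Z #>\<^bsub>G\<^esub> h"
    have UV: "?U \<in> carrier ?M" "?V \<in> carrier ?M" using coset g h by blast+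
    have z: "zc g \<in> Z" "zc h \<in> Z" "df ?U ?V \<in> Z" "zc g \<otimes>\<^bsub>G\<^esub> zc h \<in> Z" using zc g h df UV by auto
    have "C \<chi> g * C \<chi> h * a \<chi> (\<phi> ?U, \<phi> ?V) =
        c \<chi> (zc g) * c \<chi> (zc h) * (w \<chi> ?U * w \<chi> ?V * a \<chi> (\<phi> ?U, \<phi> ?V))"
      by (simp add: C_def)
    also have "\<dots> = c \<chi> (zc g \<otimes>\<^bsub>G\<^esub> zc h \<otimes>\<^bsub>G\<^esub> df ?U ?V) * w \<chi> (?U \<otimes>\<^bsub>?M\<^esub> ?V)"
      unfolding w[OF i UV] using z by (simp add: cm i)
    also have "\<dots> = C \<chi> (g \<otimes>\<^bsub>G\<^esub> h)"
      by (simp only: C_def zc_mult[OF g h] coset(2)[OF g h])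
    finally show ?case .
  next
    case (8 g h)
    then have eq: "Z #>\<^bsub>G\<^esub> g = Z #>\<^bsub>G\<^esub> h" using \<phi>inj coset(1) by blast
    then obtain t where t: "t \<in> Z" "g = t \<otimes>\<^bsub>G\<^esub> h" using coset_eqD 8 by blast
    then have "t \<noteq> \<one>\<^bsub>?Z\<^esub>" using 8 by auto
    then have "(\<Sum>\<theta>\<in>carrier (char_group ?Z). \<theta> t) = 0"
      using sum_characters_nontrivial[OF commZ] finZ t(1) by simp
    then have "(\<Sum>\<chi>\<in>I. c \<chi> t) = 0" using sum.reindex_bij_betw[OF c, of "\<lambda>\<theta>. \<theta> t"] by simp
    \<comment> \<open>Elements of one fibre share their coset, so the correction \<open>w\<close>
      cancels and only the character of their quotient \<open>t\<close> remains.\<close>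
    moreover have "C \<chi> g / C \<chi> h = c \<chi> t" if "\<chi> \<in> I" for \<chi>
      using zc_left[OF t(1) 8(2)] cm[OF that t(1) zc(1)[OF 8(2)]] cm(2)[OF that zc(1) t(1), of h]
        w0[OF that coset(1)[OF 8(2,2)]] 8(2) by (simp add: C_def eq flip: t(2))
    ultimately show ?case by simp
  next
    case (9 \<chi> \<theta> x)
    then obtain U where U: "U \<in> carrier ?M" "x = \<phi> U" using \<phi>b by (auto simp: bij_betw_def)
    have "c \<chi> \<noteq> c \<theta>" using c 9 by (auto simp: bij_betw_def inj_on_def)
    then have "(\<Sum>t\<in>Z. c \<chi> t / c \<theta> t) = 0"
      using character_orthogonality[of ?Z "c \<chi>" "c \<theta>"] cX 9 commZ by (simp add: comm_group_def)
    moreover have "(\<Sum>g\<in>{g \<in> carrier G. \<phi> (Z #>\<^bsub>G\<^esub> g) = x}. C \<chi> g / C \<theta> g) =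
        (\<Sum>t\<in>Z. C \<chi> (t \<otimes>\<^bsub>G\<^esub> \<mu> U) / C \<theta> (t \<otimes>\<^bsub>G\<^esub> \<mu> U))"
      unfolding U(2) by (rule sum.reindex_bij_betw[OF fib[OF U(1)], symmetric])
    \<comment> \<open>On a fixed fibre the corrections are constant and factor out, leaving the
      orthogonality relation for distinct characters of \<open>Z\<close>.\<close>
    moreover have "\<dots> = (w \<chi> U / w \<theta> U) * (\<Sum>t\<in>Z. c \<chi> t / c \<theta> t)"
      unfolding sum_distrib_left
      using U \<mu>c by (intro sum.cong) (simp_all add: C_def zc_eq coset_mult \<mu>U mult.commute)
    ultimately show ?case by simp
  next
    case (10 x)
    then obtain U where U: "U \<in> carrier ?M" "x = \<phi> U" using \<phi>b by (auto simp: bij_betw_def)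
    have "card {g \<in> carrier G. \<phi> (Z #>\<^bsub>G\<^esub> g) = x} = card Z"
      unfolding U(2) using bij_betw_same_card[OF fib[OF U(1)]] by simp
    also have "\<dots> = card I"
      using card_char_group[OF commZ] finZ bij_betw_same_card[OF c] by simp
    finally show ?case .
  next
    case (11 \<gamma>)
    obtain \<beta> where \<beta>: "\<beta> \<in> carrier (Z2 ?M)" "cohomologous G \<gamma> (pullback_cochain G (\<lambda>x. Z #>\<^bsub>G\<^esub> x) \<beta>)"
      by (rule tra_inf_exact_inflation_surj[OF assms(1) cen ex 11])
    let ?j = "inv_into (carrier ?M) \<phi>"
    have j: "?j \<in> hom Q ?M" using M.iso_set_sym[OF \<phi>] by (simp add: iso_def)
    have "pullback_cochain G (\<lambda>g. \<phi> (Z #>\<^bsub>G\<^esub> g)) (pullback_cochain Q ?j \<beta>) =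
        pullback_cochain G (\<lambda>x. Z #>\<^bsub>G\<^esub> x) \<beta>"
      using \<phi>b coset(1) by (auto simp: pullback_cochain_def bij_betw_def fun_eq_iff)
    moreover have "pullback_cochain Q ?j \<beta> \<in> carrier (Z2 Q)"
      by (rule H2_pullback_class(1)[OF assms(6) M.is_group j \<beta>(1)])
    ultimately show ?case using \<beta>(2) by metis
  next
    case (12 \<eta> g h)
    then have "Z #>\<^bsub>G\<^esub> g = Z #>\<^bsub>G\<^esub> h" using \<phi>inj coset(1) by blast
    then obtain t where t: "t \<in> Z" "g = t \<otimes>\<^bsub>G\<^esub> h" using coset_eqD 12 by blast
    then have "\<eta> g = \<eta> t * \<eta> h"
      using hom_mult[OF 12(1) mem_carrier[OF t(1)] 12(3)] by (simp add: cstar_def)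
    then show ?case using tra_inf_exact_hom_trivial[OF assms(1) cen ex 12(1) t(1)] by simp
  qed
  then show ?thesis by (rule that)
qed

text \<open>The common data are all taken from \<open>G\<close>: the quotient by \<open>Z\<close>,
  the characters of \<open>Z\<close> and their transgression cocycles for a fixed section.
  \<open>H\<close> covers the same quotient through \<phi>, with index \<chi> standing for its
  pullback along \<open>i\<close>.\<close>

lemma split_covers_of_compatible_pair:
  fixes G :: "('a, 'm) monoid_scheme" and H :: "('b, 'n) monoid_scheme"
  assumes "compatible_pair G H"
  obtains Q :: "'a set monoid" and \<pi> \<rho> a C C' and I :: "('a \<Rightarrow> complex) set"
  where "split_cover G Q \<pi> I a C" "split_cover H Q \<rho> I a C'"
proof -
  obtain Z Z' i \<phi> where G: "group G" "finite (carrier G)" "central_subgroup Z G" "tra_inf_exact G Z"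
    and H: "group H" "finite (carrier H)" "central_subgroup Z' H" "tra_inf_exact H Z'"
    and i: "i \<in> iso (H\<lparr>carrier := Z'\<rparr>) (G\<lparr>carrier := Z\<rparr>)" and \<phi>: "\<phi> \<in> iso (H Mod Z') (G Mod Z)"
    and compat: "\<And>\<chi>. \<chi> \<in> carrier (char_group (G\<lparr>carrier := Z\<rparr>)) \<Longrightarrow>
      H2_pullback (H Mod Z') \<phi> (transgression G Z \<chi>) = transgression H Z' (\<lambda>z\<in>Z'. \<chi> (i z))"
    using assms unfolding compatible_pair_def by blast
  interpret G: normal Z G by (rule central_subgroup_normal[OF G(1,3)])
  interpret H: normal Z' H by (rule central_subgroup_normal[OF H(1,3)])
  note M = G.factorgroup_is_group and M' = H.factorgroup_is_group
  obtain \<mu> where \<mu>: "is_section G Z \<mu>" using section_exists[OF G(1) G.is_subgroup] by blast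
  obtain \<nu> where \<nu>: "is_section H Z' \<nu>" using section_exists[OF H(1) H.is_subgroup] by blast
  let ?I = "carrier (char_group (G\<lparr>carrier := Z\<rparr>))"
  let ?a = "transgression_cocycle G Z \<mu>" and ?c = "\<lambda>\<chi>. \<lambda>z\<in>Z'. \<chi> (i z)"
  have a: "?a \<chi> \<in> carrier (Z2 (G Mod Z))" if "\<chi> \<in> ?I" for \<chi>
    using transgression_cocycle_Z2[OF G(1,3) \<mu> that] .
  obtain C where C: "split_cover G (G Mod Z) (\<lambda>g. Z #>\<^bsub>G\<^esub> g) ?I ?a C"
  proof (rule split_cover_of_central_extension[OF G \<mu> M, of "\<lambda>U. U" "\<lambda>\<chi>. \<chi>" ?I ?a])
    show "(\<lambda>U. U) \<in> iso (G Mod Z) (G Mod Z)" by (simp add: iso_set_refl)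
    show "cohomologous (G Mod Z) (?a \<chi>) (pullback_cochain (G Mod Z) (\<lambda>U. U) (?a \<chi>))" for \<chi>
      by (rule cohomologousI[of _ "\<lambda>_. 1"]) simp_all
  qed (simp_all add: a bij_betw_def)
  have c: "bij_betw ?c ?I (carrier (char_group (H\<lparr>carrier := Z'\<rparr>)))"
    using bij_betw_char_group[OF H.subgroup_imp_group[OF H.is_subgroup] i] by simp
  \<comment> \<open>This is the commuting square of the compatible pair, read on representatives.
    Independence of the transgression from the section allows arbitrary sections on both
    sides.\<close>
  have coh: "cohomologous (H Mod Z') (transgression_cocycle H Z' \<nu> (?c \<chi>))
      (pullback_cochain (H Mod Z') \<phi> (?a \<chi>))" if \<chi>: "\<chi> \<in> ?I" for \<chi>
  proof -
    have c\<chi>: "?c \<chi> \<in> carrier (char_group (H\<lparr>carrier := Z'\<rparr>))"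
      using c \<chi> by (auto simp: bij_betw_def)
    have "\<phi> \<in> hom (H Mod Z') (G Mod Z)" using \<phi> by (simp add: iso_def)
    note pb = H2_pullback_class[OF M' M this a[OF \<chi>]]
    have "H2_class (H Mod Z') (transgression_cocycle H Z' \<nu> (?c \<chi>)) =
        H2_class (H Mod Z') (pullback_cochain (H Mod Z') \<phi> (?a \<chi>))"
      using compat[OF \<chi>] transgression_indep[OF G(1,3) \<mu> \<chi>] transgression_indep[OF H(1,3) \<nu> c\<chi>] pb(2)
      by simp
    then show ?thesis
      using H2_class_eq_iff[OF M' transgression_cocycle_Z2[OF H(1,3) \<nu> c\<chi>] pb(1)] by simp
  qed
  obtain C' where "split_cover H (G Mod Z) (\<lambda>h. \<phi> (Z' #>\<^bsub>H\<^esub> h)) ?I ?a C'"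
    using split_cover_of_central_extension[OF H \<nu> M \<phi> c a coh] by blast
  with C show ?thesis by (rule that)
qed

theorem corollary1p5:
  fixes G\<^sub>1 :: "'a monoid" and G\<^sub>2 :: "'b monoid" and H\<^sub>1 :: "'c monoid" and H\<^sub>2 :: "'d monoid"
  assumes "group G\<^sub>1" "finite (carrier G\<^sub>1)" "group G\<^sub>2" "finite (carrier G\<^sub>2)"
    and "group H\<^sub>1" "finite (carrier H\<^sub>1)" "group H\<^sub>2" "finite (carrier H\<^sub>2)"
    and "compatible_pair G\<^sub>1 H\<^sub>1" and "compatible_pair G\<^sub>2 H\<^sub>2"
  shows "G\<^sub>1 \<times>\<times> G\<^sub>2 \<sim>\<^sub>\<complex> H\<^sub>1 \<times>\<times> H\<^sub>2 \<and>
    (\<forall>A :: 'e monoid. comm_group A \<and> finite (carrier A) \<longrightarrow> G\<^sub>1 \<times>\<times> A \<sim>\<^sub>\<complex> H\<^sub>1 \<times>\<times> A)"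
proof (intro conjI allI impI)
  obtain Q\<^sub>1 :: "'a set monoid" and \<pi>\<^sub>1 \<rho>\<^sub>1 a\<^sub>1 C\<^sub>1 C\<^sub>1' and I\<^sub>1 :: "('a \<Rightarrow> complex) set"
    where 1: "split_cover G\<^sub>1 Q\<^sub>1 \<pi>\<^sub>1 I\<^sub>1 a\<^sub>1 C\<^sub>1" "split_cover H\<^sub>1 Q\<^sub>1 \<rho>\<^sub>1 I\<^sub>1 a\<^sub>1 C\<^sub>1'"
    by (rule split_covers_of_compatible_pair[OF assms(9)]) blast
  obtain Q\<^sub>2 :: "'b set monoid" and \<pi>\<^sub>2 \<rho>\<^sub>2 a\<^sub>2 C\<^sub>2 C\<^sub>2' and I\<^sub>2 :: "('b \<Rightarrow> complex) set"
    where 2: "split_cover G\<^sub>2 Q\<^sub>2 \<pi>\<^sub>2 I\<^sub>2 a\<^sub>2 C\<^sub>2" "split_cover H\<^sub>2 Q\<^sub>2 \<rho>\<^sub>2 I\<^sub>2 a\<^sub>2 C\<^sub>2'"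
    by (rule split_covers_of_compatible_pair[OF assms(10)]) blast
  show "G\<^sub>1 \<times>\<times> G\<^sub>2 \<sim>\<^sub>\<complex> H\<^sub>1 \<times>\<times> H\<^sub>2"
    using split_cover_DirProd[OF 1(1) 2(1)] split_cover_DirProd[OF 1(2) 2(2)]
    by (rule twisted_equiv_of_split_covers)
  fix A :: "'e monoid" assume "comm_group A \<and> finite (carrier A)"
  then have A: "split_cover A A (\<lambda>g. g) {()} (\<lambda>_. \<lambda>p\<in>carrier A \<times> carrier A. 1) (\<lambda>_ _. 1)"
    by (simp add: split_cover_trivial comm_group_def)
  show "G\<^sub>1 \<times>\<times> A \<sim>\<^sub>\<complex> H\<^sub>1 \<times>\<times> A"
    using split_cover_DirProd[OF 1(1) A] split_cover_DirProd[OF 1(2) A]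
    by (rule twisted_equiv_of_split_covers)
qed

end
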